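(* There is a function $f$ such that, for every $h$, the Directed Steiner Tree problem can be solved in time $O^*(f(h)^k)$ on directed graphs whose underlying undirected graph excludes $K_h$ as a topological minor.
   Context: Directed Steiner Tree (DST): the input is a directed graph $D=(V,A)$, a root $r\in V$, a set $T\subseteq V\setminus\{r\}$ of terminals and an integer $k$; the question is whether there is a set $S\subseteq V\setminus(T\cup\{r\})$ with $|S|\le k$ such that $D[S\cup T\cup\{r\}]$ contains a directed path from $r$ to every $t\in T$. $O^*(\cdot)$ suppresses factors polynomial in the input size. A graph $H$ is a topological minor of $G$ if some subgraph of $G$ is isomorphic to a subdivision of $H$ (obtained by replacing edges of $H$ by non-trivial paths); statements about digraphs refer to the underlying undirected graph. *)

theory Defs
  imports
    "Graph_Theory.Graph_Theory"
    "HOL-Computational_Algebra.Polynomial"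
begin

section \<open>Topological minors\<close>

text \<open>
  As elsewhere in the graph library, an undirected graph is a symmetric digraph, and
  \<^const>\<open>mk_symmetric\<close> yields the underlying undirected graph of a digraph. Subdivision vertices
  are taken from the vertex type of \<open>H\<close>, which therefore has to be infinite for this to be the
  usual notion; it is only used below with vertex type \<^typ>\<open>nat\<close>.
\<close>

definition topological_minor :: "('a, 'b) pre_digraph \<Rightarrow> ('c, 'd) pre_digraph \<Rightarrow> bool" where
  "topological_minor H G \<longleftrightarrow>
     (\<exists>S S' rev_H rev_S'. subgraph S G \<and> digraph_iso S S' \<and> subdivision (H, rev_H) (S', rev_S'))"

definition excludes_topological_clique :: "nat \<Rightarrow> 'a pair_pre_digraph \<Rightarrow> bool" where
  "excludes_topological_clique h D \<longleftrightarrow>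
     \<not> (\<exists>K :: nat pair_pre_digraph.
          K\<^bsub>h\<^esub> (with_proj K) \<and> topological_minor (with_proj K) (with_proj (mk_symmetric (with_proj D))))"


section \<open>Directed Steiner Tree\<close>

text \<open>The vertices of an input digraph are named \<open>0, \<dots>, n - 1\<close>; loops are permitted.\<close>

definition dst_instance :: "nat \<Rightarrow> nat pair_pre_digraph \<Rightarrow> nat \<Rightarrow> nat set \<Rightarrow> bool" where
  "dst_instance n D r T \<longleftrightarrow>
     pair_fin_digraph D \<and> pverts D = {..<n} \<and> r \<in> pverts D \<and> T \<subseteq> pverts D - {r}"

definition dst_solvable :: "'a pair_pre_digraph \<Rightarrow> 'a \<Rightarrow> 'a set \<Rightarrow> nat \<Rightarrow> bool" where
  "dst_solvable D r T k \<longleftrightarrow>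
     (\<exists>S. S \<subseteq> pverts D - (T \<union> {r}) \<and> card S \<le> k \<and>
          (\<forall>t\<in>T. \<exists>p. pre_digraph.apath (with_proj D \<restriction> (S \<union> T \<union> {r})) r p t))"


section \<open>Machine model\<close>

text \<open>
  Running times refer to a first-order, call-by-value functional language over binary trees
  (S-expressions without atoms), in the style of N. D. Jones, Computability and Complexity from a
  Programming Perspective. A program is a finite list of function bodies, a call refers to a
  function by its index, and the arguments are accessed by position. Every evaluated construct
  costs one time unit. Since values are never mutated, each construct is a bounded number of
  pointer operations on shared cells, so \<open>t\<close> steps can be simulated by a Turing machine in time
  polynomial in \<open>t\<close> and the input size, and conversely a Turing machine is simulated with constant
  overhead per step. Bounds of the form \<open>c\<^sup>k\<close> times a polynomial in the input size are closed
  under such polynomial overheads (with another constant \<open>c\<close>).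
\<close>

datatype val = Leaf | Node val val

fun left :: "val \<Rightarrow> val" where
  "left Leaf = Leaf"
| "left (Node a b) = a"

fun right :: "val \<Rightarrow> val" where
  "right Leaf = Leaf"
| "right (Node a b) = b"

datatype expr =
    EVar nat
  | ELeaf
  | ENode expr expr
  | ELeft expr
  | ERight expr
  | EIf expr expr expr
  | ECall nat "expr list"

type_synonym program = "expr list"

text \<open>
  \<open>eval P env e v t\<close>: in program \<open>P\<close> with argument values \<open>env\<close>, expression \<open>e\<close> evaluates to \<open>v\<close> in
  exactly \<open>t\<close> steps. Divergence and out-of-range indices mean that there is no such \<open>v\<close>.
  A conditional takes its first branch iff the condition is not \<^const>\<open>Leaf\<close>.
\<close>

inductive eval :: "program \<Rightarrow> val list \<Rightarrow> expr \<Rightarrow> val \<Rightarrow> nat \<Rightarrow> bool"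
  and evals :: "program \<Rightarrow> val list \<Rightarrow> expr list \<Rightarrow> val list \<Rightarrow> nat \<Rightarrow> bool"
  for P :: program
where
  eval_var: "i < length env \<Longrightarrow> eval P env (EVar i) (env ! i) 1"
| eval_leaf: "eval P env ELeaf Leaf 1"
| eval_node: "eval P env a v s \<Longrightarrow> eval P env b w t \<Longrightarrow> eval P env (ENode a b) (Node v w) (s + t + 1)"
| eval_left: "eval P env e v t \<Longrightarrow> eval P env (ELeft e) (left v) (t + 1)"
| eval_right: "eval P env e v t \<Longrightarrow> eval P env (ERight e) (right v) (t + 1)"
| eval_if_node: "eval P env c (Node x y) s \<Longrightarrow> eval P env a v t \<Longrightarrow> eval P env (EIf c a b) v (s + t + 1)"
| eval_if_leaf: "eval P env c Leaf s \<Longrightarrow> eval P env b v t \<Longrightarrow> eval P env (EIf c a b) v (s + t + 1)"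
| eval_call: "i < length P \<Longrightarrow> evals P env es vs s \<Longrightarrow> eval P vs (P ! i) v t
    \<Longrightarrow> eval P env (ECall i es) v (s + t + 1)"
| evals_Nil: "evals P env [] [] 0"
| evals_Cons: "eval P env e v s \<Longrightarrow> evals P env es vs t \<Longrightarrow> evals P env (e # es) (v # vs) (s + t)"

inductive_cases
      eval_varE: "eval P env (EVar i) v t"
  and eval_leafE: "eval P env ELeaf v t"
  and eval_nodeE: "eval P env (ENode a b) v t"
  and eval_leftE: "eval P env (ELeft e) v t"
  and eval_rightE: "eval P env (ERight e) v t"
  and eval_ifE: "eval P env (EIf c a b) v t"
  and eval_callE: "eval P env (ECall i es) v t"
  and evals_NilE: "evals P env [] vs t"
  and evals_ConsE: "evals P env (e # es) vs t"

lemma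
  shows eval_deterministic: "eval P env e v t \<Longrightarrow> eval P env e v' t' \<Longrightarrow> v = v' \<and> t = t'"
    and evals_deterministic: "evals P env es vs s \<Longrightarrow> evals P env es vs' s' \<Longrightarrow> vs = vs' \<and> s = s'"
proof (induction arbitrary: v' t' and vs' s' rule: eval_evals.inducts)
  case eval_var
  from eval_var.prems show ?case by (rule eval_varE) auto
next
  case eval_leaf
  from eval_leaf.prems show ?case by (rule eval_leafE) auto
next
  case eval_node
  from eval_node.prems show ?case by (rule eval_nodeE) (auto dest!: eval_node.IH(2,4))
next
  case eval_left
  from eval_left.prems show ?case by (rule eval_leftE) (auto dest!: eval_left.IH(2))
next
  case eval_right
  from eval_right.prems show ?case by (rule eval_rightE) (auto dest!: eval_right.IH(2))
next
  case eval_if_node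
  from eval_if_node.prems show ?case by (rule eval_ifE) (auto dest!: eval_if_node.IH(2,4))
next
  case eval_if_leaf
  from eval_if_leaf.prems show ?case by (rule eval_ifE) (auto dest!: eval_if_leaf.IH(2,4))
next
  case eval_call
  from eval_call.prems show ?case by (rule eval_callE) (auto dest!: eval_call.IH(3,5))
next
  case evals_Nil
  from evals_Nil.prems show ?case by (rule evals_NilE) auto
next
  case evals_Cons
  from evals_Cons.prems show ?case by (rule evals_ConsE) (auto dest!: evals_Cons.IH(2,4))
qed

text \<open>The entry point is function \<open>0\<close>, applied to the input as its only argument.\<close>

definition computes_in :: "program \<Rightarrow> val \<Rightarrow> val \<Rightarrow> nat \<Rightarrow> bool" where
  "computes_in P x y t \<longleftrightarrow> P \<noteq> [] \<and> eval P [x] (P ! 0) y t"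


section \<open>Encoding of instances\<close>

fun enc_bool :: "bool \<Rightarrow> val" where
  "enc_bool False = Leaf"
| "enc_bool True = Node Leaf Leaf"

fun enc_list :: "('a \<Rightarrow> val) \<Rightarrow> 'a list \<Rightarrow> val" where
  "enc_list f [] = Leaf"
| "enc_list f (x # xs) = Node (f x) (enc_list f xs)"

text \<open>Binary digits, least significant first.\<close>

fun binary :: "nat \<Rightarrow> bool list" where
  "binary m = (if m = 0 then [] else odd m # binary (m div 2))"

declare binary.simps [simp del]

text \<open>Adjacency matrix, characteristic vectors of \<open>{r}\<close> and of \<open>T\<close>, and \<open>k\<close> in binary.\<close>

definition enc_dst :: "nat \<Rightarrow> nat pair_pre_digraph \<Rightarrow> nat \<Rightarrow> nat set \<Rightarrow> nat \<Rightarrow> val" where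
  "enc_dst n D r T k =
     Node (enc_list (enc_list enc_bool) (map (\<lambda>u. map (\<lambda>v. (u, v) \<in> parcs D) [0..<n]) [0..<n]))
    (Node (enc_list enc_bool (map (\<lambda>v. v = r) [0..<n]))
    (Node (enc_list enc_bool (map (\<lambda>v. v \<in> T) [0..<n]))
          (enc_list enc_bool (binary k))))"

end

theory Submission
  imports Defs
begin

text \<open>
  A terminal is reached as soon as every source component of the subgraph induced by the terminals is
  entered, so a solution has to dominate these components, and a component counts as a single target.
  Contracting them destroys topological minor freeness, but the vertices that dominate them remain single
  vertices. If each of a set \<open>N\<close> of nonterminals is adjacent to many components, then some component has
  fewer than \<open>h\<close> neighbours in \<open>N\<close>: otherwise Mader's argument, run with branch vertices from \<open>N\<close> only,
  yields a subdivision of the clique on \<open>h\<close> vertices.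

  Hence, as long as some nonterminal dominates at least \<open>c\<close> undominated components, there is a component
  with fewer than \<open>h\<close> such heavy dominators. Branch on which of them to take, or exclude them all. In the
  latter case the component has to be dominated by a light vertex, which happens at most \<open>c * k\<close> times, so
  there are at most \<open>(h + 1) ^ ((c + 1) * k)\<close> branches. In the end at most \<open>c * k\<close> components are
  undominated, and a Dreyfus--Wagner style recursion over subsets of these components and of the chosen
  vertices finishes in single exponential time.
\<close>

section \<open>Linkages as clique models, and Mader's merging argument\<close>

section \<open>Linkages\<close>

text \<open>Mader's merging needs many branch candidates per connected set, but there may be far
  more components than nonterminals. Hence two regimes in \<open>few_neighbours\<close>. With few
  components, \<open>sparse_cover\<close> thins them out until the ratio holds while half of the
  candidates stay well attached. With many, components act as subdivided edges: either one of them
  sees only pairs already joined by others, which is a clique linkage at once, or all of them give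
  distinct edges, so that some graph on the candidates is dense and Mader's argument applies to that
  graph. The branching threshold \<open>high_deg\<close> is what both regimes together require. The
  second obstacle is the order of quantifiers: the polynomial is fixed before \<open>h\<close>, so
  all dependence on \<open>h\<close> has to go into \<open>f h ^ k\<close>. For positive budgets the
  algorithm is therefore a single loop expression that receives its constants as data, and its cost
  is one polynomial in a number \<open>M\<close> that bounds every loop; only \<open>M\<close>
  depends on \<open>h\<close>. Numbers are handled in unary, which is affordable because the budget
  can be capped at the number of vertices.\<close>

definition connected_set :: "'a rel \<Rightarrow> 'a set \<Rightarrow> bool" where
  "connected_set E C \<longleftrightarrow> C \<noteq> {} \<and> (\<forall>u\<in>C. \<forall>v\<in>C. (u, v) \<in> (E \<inter> C \<times> C)\<^sup>*)"

definition touches :: "'a rel \<Rightarrow> 'a \<Rightarrow> 'a set \<Rightarrow> bool" where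
  "touches E x C \<longleftrightarrow> (\<exists>u\<in>C. (x, u) \<in> E)"

text \<open>A subdivision up to the choice of paths: \<open>v\<close> gives the branch vertices and
  \<open>U e\<close> contains the interior of the path for the edge \<open>e\<close>. With sets
  instead of paths, components can be merged and auxiliary edges expanded without rerouting; as the
  sets are nonempty, every edge ends up properly subdivided.\<close>

definition linkage :: "'a rel \<Rightarrow> nat \<Rightarrow> (nat \<times> nat) set \<Rightarrow> (nat \<Rightarrow> 'a) \<Rightarrow> (nat \<times> nat \<Rightarrow> 'a set) \<Rightarrow> bool" where
  "linkage E h W v U \<longleftrightarrow> inj_on v {..<h} \<and>
     (\<forall>e\<in>W. connected_set E (U e) \<and> touches E (v (fst e)) (U e) \<and> touches E (v (snd e)) (U e)
        \<and> U e \<inter> v ` {..<h} = {}) \<and>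
     (\<forall>e\<in>W. \<forall>e'\<in>W. e \<noteq> e' \<longrightarrow> U e \<inter> U e' = {})"

lemma sym_restrict_rtrancl:
  assumes "sym E" "(u, v) \<in> (E \<inter> C \<times> C)\<^sup>*" shows "(v, u) \<in> (E \<inter> C \<times> C)\<^sup>*"
proof -
  have "sym (E \<inter> C \<times> C)" using assms(1) by (auto simp: sym_def)
  then show ?thesis using assms(2) by (meson sym_rtrancl symD)
qed

lemma connected_setI_hub:
  assumes "sym E" "c \<in> C" "\<And>u. u \<in> C \<Longrightarrow> (c, u) \<in> (E \<inter> C \<times> C)\<^sup>*"
  shows "connected_set E C"
  unfolding connected_set_def using assms sym_restrict_rtrancl[OF assms(1)]
  by (meson empty_iff rtrancl_trans)

lemma connected_set_mono_rtrancl: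
  "connected_set E C \<Longrightarrow> C \<subseteq> D \<Longrightarrow> u \<in> C \<Longrightarrow> v \<in> C \<Longrightarrow> (u, v) \<in> (E \<inter> D \<times> D)\<^sup>*"
  unfolding connected_set_def
  by (rule rtrancl_mono[THEN subsetD, of "E \<inter> C \<times> C"]) auto

lemma touches_rtrancl:
  assumes "connected_set E C" "C \<subseteq> D" "x \<in> D" "touches E x C" "v \<in> C"
  shows "(x, v) \<in> (E \<inter> D \<times> D)\<^sup>*"
proof -
  obtain u where u: "u \<in> C" "(x, u) \<in> E" using assms by (auto simp: touches_def)
  then have "(x, u) \<in> E \<inter> D \<times> D" using assms by auto
  then show ?thesis using connected_set_mono_rtrancl[OF assms(1,2) u(1) assms(5)] by (rule converse_rtrancl_into_rtrancl)
qed

lemma connected_set_join: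
  assumes "sym E" "connected_set E C" "connected_set E C'" "touches E x C" "touches E x C'"
  shows "connected_set E (insert x (C \<union> C'))"
proof (rule connected_setI_hub[OF assms(1), of x])
  fix u assume "u \<in> insert x (C \<union> C')"
  then consider "u = x" | "u \<in> C" | "u \<in> C'" by auto
  then show "(x, u) \<in> (E \<inter> insert x (C \<union> C') \<times> insert x (C \<union> C'))\<^sup>*"
  proof cases
    case 2 show ?thesis by (rule touches_rtrancl[OF assms(2) _ _ assms(4) 2]) auto
  next
    case 3 show ?thesis by (rule touches_rtrancl[OF assms(3) _ _ assms(5) 3]) auto
  qed simp
qed simp

text \<open>Double counting of the pairs of an element of \<open>N\<close> and one of its
  sets.\<close>

lemma sum_card_incidences:
  assumes "finite N" "finite F"
  shows "(\<Sum>C\<in>F. card {y\<in>N. C \<in> A y}) = (\<Sum>y\<in>N. card (A y \<inter> F))"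
proof -
  have "(\<Sum>C\<in>F. card {y\<in>N. C \<in> A y}) = (\<Sum>C\<in>F. \<Sum>y\<in>N. if C \<in> A y then 1 else 0)"
    using assms by (intro sum.cong refl) (simp only: card_eq_sum sum.inter_filter)
  also have "\<dots> = (\<Sum>y\<in>N. \<Sum>C\<in>F. if C \<in> A y then 1 else 0)" by (rule sum.swap)
  also have "\<dots> = (\<Sum>y\<in>N. card (A y \<inter> F))"
  proof (intro sum.cong refl)
    fix y
    have "A y \<inter> F = {C\<in>F. C \<in> A y}" by auto
    then show "(\<Sum>C\<in>F. if C \<in> A y then 1 else 0) = card (A y \<inter> F)"
      using assms by (simp only: card_eq_sum sum.inter_filter)
  qed
  finally show ?thesis .
qed

text \<open>\<open>A y\<close> selects exactly \<open>c\<close> of the sets next to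
  \<open>y\<close>, even if there are more. Then the effect of a merge on \<open>y\<close> depends
  only on which of the merged sets were selected.\<close>

definition attached :: "'a rel \<Rightarrow> 'a set set \<Rightarrow> 'a set \<Rightarrow> ('a \<Rightarrow> 'a set set) \<Rightarrow> nat \<Rightarrow> bool" where
  "attached E F N A c \<longleftrightarrow> finite F \<and> finite N \<and> (\<forall>C\<in>F. connected_set E C) \<and>
     (\<forall>C\<in>F. \<forall>C'\<in>F. C \<noteq> C' \<longrightarrow> C \<inter> C' = {}) \<and> N \<inter> \<Union>F = {} \<and>
     (\<forall>y\<in>N. A y \<subseteq> F \<and> card (A y) = c \<and> (\<forall>C\<in>A y. touches E y C))"

text \<open>Only a vertex that has selected both \<open>C\<close> and \<open>C'\<close> would lose
  an attachment, so exactly these leave \<open>N\<close>; for any other vertex the merged set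
  replaces at most one selected set. The connecting vertex \<open>x\<close> is among those that
  leave, hence \<open>X\<close> and \<open>N'\<close> are disjoint.\<close>

lemma attached_merge:
  assumes "sym E" and at: "attached E F N A c" and C: "C \<in> A x" "C' \<in> A x" "C \<noteq> C'" "x \<in> N"
  defines "N' \<equiv> {y\<in>N. \<not> (C \<in> A y \<and> C' \<in> A y)}" and "X \<equiv> insert x (C \<union> C')"
  defines "F' \<equiv> insert X (F - {C, C'})"
  defines "A' \<equiv> (\<lambda>y. if C \<in> A y \<or> C' \<in> A y then insert X (A y - {C, C'}) else A y)"
  shows "attached E F' N' A' c" "Suc (card F') = card F" "\<Union>F' \<union> N' \<subseteq> \<Union>F \<union> N"
proof -
  note at' = at[unfolded attached_def]
  have CF: "C \<in> F" "C' \<in> F" using at' C by blast+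
  have XF: "X \<notin> F"
  proof
    assume "X \<in> F"
    then have "x \<in> \<Union>F" by (auto simp: X_def)
    then show False using at' C by blast
  qed
  have ne: "C \<noteq> {}" "C' \<noteq> {}" using at' CF by (auto simp: connected_set_def)
  have finF: "finite F" using at' by blast
  show "Suc (card F') = card F"
  proof -
    have "card (F - {C, C'}) = card F - 2" using CF C finF by (simp add: card_Diff_subset)
    moreover have "card {C, C'} \<le> card F" using CF finF by (intro card_mono) auto
    ultimately show ?thesis using XF finF C by (simp add: F'_def)
  qed
  show "\<Union>F' \<union> N' \<subseteq> \<Union>F \<union> N" using CF C by (auto simp: F'_def N'_def X_def)
  have con: "connected_set E X" unfolding X_def using at' C CF assms(1)
    by (intro connected_set_join) blast+
  have dis: "D \<inter> X = {}" if "D \<in> F" "D \<noteq> C" "D \<noteq> C'" for D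
  proof -
    have "x \<notin> D" "D \<inter> C = {}" "D \<inter> C' = {}" using at' that CF C by blast+
    then show ?thesis by (auto simp: X_def)
  qed
  have xN: "x \<notin> N'" using C by (auto simp: N'_def)
  have "N' \<inter> X = {}"
  proof -
    have "N' \<inter> (C \<union> C') = {}" using at' CF by (auto simp: N'_def)
    then show ?thesis using xN by (auto simp: X_def)
  qed
  moreover have "A' y \<subseteq> F' \<and> card (A' y) = c \<and> (\<forall>D\<in>A' y. touches E y D)" if y: "y \<in> N'" for y
  proof (cases "C \<in> A y \<or> C' \<in> A y")
    case True
    have yN: "y \<in> N" and not2: "\<not> (C \<in> A y \<and> C' \<in> A y)" using y by (auto simp: N'_def)
    have Ay: "A y \<subseteq> F" "card (A y) = c" "\<forall>D\<in>A y. touches E y D" using at' yN by blast+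
    have finA: "finite (A y)" using Ay(1) finF finite_subset by blast
    have t: "touches E y X" using True Ay(3) by (auto simp: touches_def X_def)
    have "A y - {C, C'} = A y - {if C \<in> A y then C else C'}" using not2 True by (cases "C \<in> A y") auto
    moreover have "(if C \<in> A y then C else C') \<in> A y" using True by auto
    ultimately have "card (A y - {C, C'}) = c - 1" using Ay(2) by (simp only: card_Diff_singleton)
    moreover have "c > 0" using True Ay finA card_gt_0_iff by blast
    moreover have "X \<notin> A y" using XF Ay by blast
    ultimately have "card (A' y) = c" using True finA by (simp add: A'_def)
    then show ?thesis using True Ay t by (auto simp: A'_def F'_def)
  next
    case False
    then show ?thesis using at' y by (auto simp: A'_def F'_def N'_def)
  qed
  moreover have "D \<inter> D' = {}" if D: "D \<in> F'" "D' \<in> F'" "D \<noteq> D'" for D D'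
  proof -
    consider "D = X" "D' \<in> F" "D' \<noteq> C" "D' \<noteq> C'" | "D' = X" "D \<in> F" "D \<noteq> C" "D \<noteq> C'" | "D \<in> F" "D' \<in> F"
      using D unfolding F'_def by blast
    then show ?thesis
    proof cases
      case 1 then show ?thesis using dis[of D'] by (simp add: Int_commute)
    next
      case 2 then show ?thesis using dis[of D] by simp
    next
      case 3 then show ?thesis using at' D(3) by simp
    qed
  qed
  moreover have "finite F'" "finite N'" "\<forall>C\<in>F'. connected_set E C"
    using at' con by (auto simp: F'_def N'_def)
  moreover have "N' \<inter> \<Union>F' \<subseteq> (N' \<inter> X) \<union> (N \<inter> \<Union>F)" by (auto simp: F'_def N'_def)
  then have "N' \<inter> \<Union>F' = {}" using at' \<open>N' \<inter> X = {}\<close> by auto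
  ultimately show "attached E F' N' A' c" unfolding attached_def by blast
qed

lemma linkage_extend:
  assumes "linkage E h W v U" "e \<notin> W" "fst e < h" "snd e < h" "connected_set E C"
    "\<And>i. i < h \<Longrightarrow> touches E (v i) C" "C \<inter> v ` {..<h} = {}" "\<And>e. e \<in> W \<Longrightarrow> U e \<inter> C = {}"
  shows "linkage E h (insert e W) v (U(e := C))"
proof -
  have dis: "(U(e := C)) a \<inter> (U(e := C)) b = {}" if ab: "a \<in> insert e W" "b \<in> insert e W" "a \<noteq> b" for a b
  proof -
    have W: "U a \<inter> U b = {}" if "a \<in> W" "b \<in> W" "a \<noteq> b" for a b
      using assms(1) that by (simp add: linkage_def)
    consider "a = e" "b \<in> W" "b \<noteq> e" | "b = e" "a \<in> W" "a \<noteq> e" | "a \<in> W" "b \<in> W" "a \<noteq> e" "b \<noteq> e"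
      using ab by auto
    then show ?thesis using assms(8) W[OF _ _ \<open>a \<noteq> b\<close>] by cases (simp_all add: Int_commute)
  qed
  have "connected_set E ((U(e := C)) a) \<and> touches E (v (fst a)) ((U(e := C)) a)
      \<and> touches E (v (snd a)) ((U(e := C)) a) \<and> (U(e := C)) a \<inter> v ` {..<h} = {}" if "a \<in> insert e W" for a
    using that assms by (cases "a = e") (simp_all add: linkage_def)
  moreover have "inj_on v {..<h}" using assms(1) by (simp add: linkage_def)
  ultimately show ?thesis unfolding linkage_def
    by (intro conjI ballI impI dis) (assumption | simp only:)+
qed

text \<open>Mader's argument, with branch vertices taken from \<open>N\<close> only: as long as some two sets have few
  common neighbours, merge them; afterwards the neighbourhood of any one set is dense enough for
  the induction hypothesis, and that set is left over to route one more edge.\<close>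

lemma linkage_exists:
  assumes "finite W" "sym E"
  shows "attached E F N A (Suc (card W)) \<Longrightarrow> F \<noteq> {} \<Longrightarrow> Suc h * fact (card W) * card F \<le> card N
    \<Longrightarrow> W \<subseteq> {..<h} \<times> {..<h}
    \<Longrightarrow> \<exists>v U. linkage E h W v U \<and> v ` {..<h} \<subseteq> N \<and> (\<forall>e\<in>W. U e \<subseteq> \<Union>F \<union> N)"
  using assms(1)
proof (induction W arbitrary: F N A rule: finite_induct)
  case empty
  have "finite F" "finite N" using empty by (auto simp: attached_def)
  then have "card F > 0" using empty by (simp add: card_gt_0_iff)
  then have "h \<le> card N" using empty.prems(3)
    by (metis Suc_leD card.empty fact_0 le_trans mult.right_neutral mult_le_mono2 Suc_leI One_nat_def)
  then obtain v where "inj_on v {..<h}" "v ` {..<h} \<subseteq> N"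
    using card_le_inj[of "{..<h}" N] \<open>finite N\<close> by auto
  then show ?case by (auto simp: linkage_def)
next
  case (insert e W)
  let ?m = "Suc (card W)"
  \<comment> \<open>One factor more than the induction hypothesis needs: the double counting below
    costs the factor \<open>?m\<close>, the number of attachments left per vertex.\<close>
  let ?b = "Suc h * fact ?m"
  have cW: "card (insert e W) = ?m" using insert by simp
  from insert.prems show ?case
  proof (induction "card F" arbitrary: F N A rule: less_induct)
    case less
    note at' = less.prems(1)[unfolded attached_def cW]
    have finF: "finite F" and finN: "finite N" using at' by blast+
    have dens: "?b * card F \<le> card N" using less.prems(3) by (simp only: cW)
    show ?case
    \<comment> \<open>A pair with at most \<open>?b\<close> common vertices can be merged:
      \<open>F\<close> loses one set and \<open>N\<close> at most \<open>?b\<close> vertices, so the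
      required ratio survives.\<close>
    proof (cases "\<exists>x\<in>N. \<exists>C\<in>A x. \<exists>C'\<in>A x. C \<noteq> C' \<and> card {y\<in>N. C \<in> A y \<and> C' \<in> A y} \<le> ?b")
      case True
      then obtain x C C' where x: "x \<in> N" "C \<in> A x" "C' \<in> A x" "C \<noteq> C'"
        and few: "card {y\<in>N. C \<in> A y \<and> C' \<in> A y} \<le> ?b" by blast
      define N' where "N' = {y\<in>N. \<not> (C \<in> A y \<and> C' \<in> A y)}"
      define X where "X = insert x (C \<union> C')"
      define F' where "F' = insert X (F - {C, C'})"
      define A' where "A' = (\<lambda>y. if C \<in> A y \<or> C' \<in> A y then insert X (A y - {C, C'}) else A y)"
      note m = attached_merge[OF assms(2) less.prems(1) x(2,3,4,1), folded N'_def X_def, folded F'_def A'_def]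
      have "N' = N - {y\<in>N. C \<in> A y \<and> C' \<in> A y}" by (auto simp: N'_def)
      then have "card N' = card N - card {y\<in>N. C \<in> A y \<and> C' \<in> A y}"
        using finN by (simp add: card_Diff_subset)
      then have "card N \<le> card N' + ?b" using few by linarith
      moreover have "?b * card F = ?b * card F' + ?b" using m(2)[symmetric] by (simp only: mult_Suc_right add.commute)
      ultimately have "?b * card F' \<le> card N'" using dens by linarith
      then have d: "Suc h * fact (card (insert e W)) * card F' \<le> card N'" by (simp only: cW)
      have "card F' < card F" using m(2) by linarith
      moreover have "F' \<noteq> {}" by (simp add: F'_def)
      ultimately obtain v U where vU: "linkage E h (insert e W) v U" "v ` {..<h} \<subseteq> N'"
        "\<forall>e\<in>insert e W. U e \<subseteq> \<Union>F' \<union> N'"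
        using less.hyps[OF _ m(1) _ d less.prems(4)] by blast
      moreover have "N' \<subseteq> N" by (auto simp: N'_def)
      ultimately show ?thesis using m(3) by (meson order_trans)
    next
      case False
      have "card F > 0" using less.prems finF by (simp add: card_gt_0_iff)
      moreover have "?b > 0" by simp
      ultimately have "0 < ?b * card F" by (simp only: nat_0_less_mult_iff)
      then have "N \<noteq> {}" using dens by fastforce
      then obtain x where x: "x \<in> N" by blast
      have cA: "card (A y) = Suc ?m" if "y \<in> N" for y using at' that by blast
      have finA: "finite (A y)" if "y \<in> N" for y using at' that finF finite_subset by metis
      \<comment> \<open>Any two sets selected by a common vertex now have more than
        \<open>?b\<close> common vertices. Restrict to the vertices attached to \<open>C\<close> and
        remove \<open>C\<close> from their selections: every remaining set keeps at least
        \<open>?b\<close> vertices, and \<open>C\<close> touches all new candidates, so it can carry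
        the edge \<open>e\<close>.\<close>
      obtain C where C: "C \<in> A x" using cA[OF x] by fastforce
      have CF: "C \<in> F" using C x at' by blast
      define N1 where "N1 = {y\<in>N. C \<in> A y}"
      define A1 where "A1 = (\<lambda>y. A y - {C})"
      define F1 where "F1 = (\<Union>y\<in>N1. A1 y)"
      have F1F: "F1 \<subseteq> F - {C}" using at' by (auto simp: F1_def N1_def A1_def)
      have finF1: "finite F1" using F1F finF finite_subset by blast
      have finN1: "finite N1" using finN by (simp add: N1_def)
      have cA1: "card (A1 y) = ?m" if "y \<in> N1" for y
        using that cA finA by (simp add: A1_def N1_def)
      have at1: "attached E F1 N1 A1 (Suc (card W))"
        unfolding attached_def
      proof (intro conjI)
        show "N1 \<inter> \<Union>F1 = {}" using at' F1F N1_def by blast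
        show "\<forall>y\<in>N1. A1 y \<subseteq> F1 \<and> card (A1 y) = Suc (card W) \<and> (\<forall>C\<in>A1 y. touches E y C)"
          using cA1 at' by (auto simp: F1_def A1_def N1_def)
        show "\<forall>C\<in>F1. connected_set E C" using at' F1F by blast
        show "\<forall>C\<in>F1. \<forall>C'\<in>F1. C \<noteq> C' \<longrightarrow> C \<inter> C' = {}"
        proof (intro ballI)
          fix D D' assume "D \<in> F1" "D' \<in> F1"
          then have "D \<in> F" "D' \<in> F" using F1F by auto
          then show "D \<noteq> D' \<longrightarrow> D \<inter> D' = {}" using at' by simp
        qed
      qed (fact finF1 finN1)+
      have xN1: "x \<in> N1" using x C by (simp add: N1_def)
      then have "A1 x \<noteq> {}" using cA1 by force
      then have F1ne: "F1 \<noteq> {}" using xN1 by (auto simp: F1_def)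
      have deg: "?b \<le> card {y\<in>N1. C' \<in> A1 y}" if C': "C' \<in> F1" for C'
      proof -
        obtain y where y: "y \<in> N1" "C' \<in> A1 y" using C' by (auto simp: F1_def)
        then have "\<not> card {y\<in>N. C \<in> A y \<and> C' \<in> A y} \<le> ?b"
          using False by (auto simp: N1_def A1_def)
        moreover have "{y\<in>N. C \<in> A y \<and> C' \<in> A y} = {y\<in>N1. C' \<in> A1 y}"
          using y by (auto simp: N1_def A1_def)
        ultimately show ?thesis by simp
      qed
      have "?b * card F1 = (\<Sum>C'\<in>F1. ?b)" by simp
      also have "\<dots> \<le> (\<Sum>C'\<in>F1. card {y\<in>N1. C' \<in> A1 y})" using deg by (rule sum_mono)
      also have "\<dots> = (\<Sum>y\<in>N1. card (A1 y \<inter> F1))" by (rule sum_card_incidences[OF finN1 finF1])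
      also have "\<dots> = (\<Sum>y\<in>N1. ?m)"
      proof (intro sum.cong refl)
        fix y assume "y \<in> N1"
        then have "A1 y \<inter> F1 = A1 y" by (auto simp: F1_def)
        then show "card (A1 y \<inter> F1) = ?m" using cA1 \<open>y \<in> N1\<close> by simp
      qed
      also have "\<dots> = ?m * card N1" by simp
      finally have "?m * (Suc h * fact (card W) * card F1) \<le> ?m * card N1"
        by (simp only: fact_Suc of_nat_id mult.assoc mult.left_commute)
      then have "Suc h * fact (card W) * card F1 \<le> card N1" by (simp only: mult_le_cancel1)
      moreover have "W \<subseteq> {..<h} \<times> {..<h}" using less.prems(4) by blast
      ultimately obtain v U where vU: "linkage E h W v U" "v ` {..<h} \<subseteq> N1"
        "\<forall>e\<in>W. U e \<subseteq> \<Union>F1 \<union> N1"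
        using insert.IH[OF at1 F1ne] by blast
      have dis: "(\<Union>F1 \<union> N1) \<inter> C = {}"
      proof -
        have "D \<inter> C = {}" if "D \<in> F1" for D
        proof -
          have "D \<in> F" "D \<noteq> C" using that F1F by auto
          then show ?thesis using at' CF by simp
        qed
        moreover have "N1 \<inter> C = {}" using at' CF by (auto simp: N1_def)
        ultimately show ?thesis by blast
      qed
      have "linkage E h (insert e W) v (U(e := C))"
      proof (rule linkage_extend[OF vU(1) insert.hyps(2)])
        show "fst e < h" "snd e < h" using less.prems(4) by auto
        show "connected_set E C" using at' CF by blast
        show "touches E (v i) C" if "i < h" for i using vU(2) that at' by (auto simp: N1_def)
        show "C \<inter> v ` {..<h} = {}" using dis vU(2) by blast
        show "U e \<inter> C = {}" if "e \<in> W" for e using dis vU(3) that by blast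
      qed
      moreover have "v ` {..<h} \<subseteq> N" using vU(2) by (auto simp: N1_def)
      moreover have "\<Union>F1 \<union> N1 \<subseteq> \<Union>F \<union> N" using F1F by (auto simp: N1_def)
      then have "\<forall>e'\<in>insert e W. (U(e := C)) e' \<subseteq> \<Union>F \<union> N"
        using vU(3) CF by (metis Sup_upper fun_upd_apply insert_iff le_supI1 order_trans)
      ultimately show ?thesis by blast
    qed
  qed
qed

text \<open>Take \<open>B'\<close> maximal such that the truncated degrees into \<open>B'\<close> sum up to at least \<open>l * card B'\<close>. Then
  every further element of \<open>B\<close> is adjacent to at most \<open>l\<close> vertices that still lack neighbours in \<open>B'\<close>,
  so there are few such vertices.\<close>

lemma sparse_cover:
  fixes R :: "'a \<Rightarrow> 'b \<Rightarrow> bool"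
  assumes fin: "finite B" "finite N" and BN: "card B \<le> d * card N"
    and deg: "\<And>x. x \<in> N \<Longrightarrow> c + 2 * l * d \<le> card {b\<in>B. R x b}" and l: "l > 0" "d > 0"
  obtains B' where "B' \<subseteq> B" "card N \<le> 2 * card {x\<in>N. c \<le> card {b\<in>B'. R x b}}" "l * card B' \<le> c * card N"
proof -
  \<comment> \<open>Because of the truncation at \<open>c\<close>, saturated vertices no longer
    contribute: the growth of \<open>H\<close> counts bad vertices that gain a neighbour, and
    \<open>H\<close> never exceeds \<open>c * card N\<close>.\<close>
  define H where "H B' = (\<Sum>x\<in>N. min c (card {b\<in>B'. R x b}))" for B'
  define Q where "Q B' \<longleftrightarrow> B' \<subseteq> B \<and> l * card B' \<le> H B'" for B'
  have "Q {}" by (simp add: Q_def)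
  moreover have "\<forall>B'. Q B' \<longrightarrow> card B' < Suc (card B)" using fin by (simp add: Q_def card_mono less_Suc_eq_le)
  ultimately obtain B' where B': "Q B'" and max: "\<And>B''. Q B'' \<Longrightarrow> card B'' \<le> card B'"
    by (metis ex_has_greatest_nat)
  have sub: "B' \<subseteq> B" using B' by (simp add: Q_def)
  have finB': "finite B'" using sub fin finite_subset by blast
  define Bad where "Bad = {x\<in>N. card {b\<in>B'. R x b} < c}"
  have finBad: "finite Bad" using fin by (simp add: Bad_def)
  have gain: "card {x\<in>Bad. R x b} \<le> l" if b: "b \<in> B - B'" for b
  proof (rule ccontr)
    assume "\<not> ?thesis"
    then have big: "l < card {x\<in>Bad. R x b}" by simp
    have eq: "card {b'\<in>insert b B'. R x b'} = card {b'\<in>B'. R x b'} + (if R x b then 1 else 0)" for x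
    proof -
      have "{b'\<in>insert b B'. R x b'} = (if R x b then insert b {b'\<in>B'. R x b'} else {b'\<in>B'. R x b'})" by auto
      then show ?thesis using b finB' by simp
    qed
    have "H (insert b B') \<ge> (\<Sum>x\<in>N. min c (card {b\<in>B'. R x b}) + (if x \<in> Bad \<and> R x b then 1 else 0))"
      unfolding H_def eq by (intro sum_mono) (auto simp: Bad_def)
    also have "(\<Sum>x\<in>N. min c (card {b\<in>B'. R x b}) + (if x \<in> Bad \<and> R x b then 1 else 0))
      = H B' + card {x\<in>N. x \<in> Bad \<and> R x b}"
      by (simp only: sum.distrib H_def card_eq_sum[of "{x\<in>N. x \<in> Bad \<and> R x b}"] sum.inter_filter[OF fin(2)])
    also have "{x\<in>N. x \<in> Bad \<and> R x b} = {x\<in>Bad. R x b}" by (auto simp: Bad_def)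
    finally have "H B' + card {x\<in>Bad. R x b} \<le> H (insert b B')" .
    then have "l * card (insert b B') \<le> H (insert b B')" using B' big b finB' by (simp add: Q_def)
    then have "Q (insert b B')" using sub b by (auto simp: Q_def)
    then show False using max[of "insert b B'"] b finB' by simp
  qed
  have "(\<Sum>b\<in>B - B'. card {x\<in>Bad. b \<in> {b\<in>B - B'. R x b}}) \<le> (\<Sum>b\<in>B - B'. l)"
  proof (rule sum_mono)
    fix b assume b: "b \<in> B - B'"
    then have "{x\<in>Bad. b \<in> {b\<in>B - B'. R x b}} = {x\<in>Bad. R x b}" by auto
    then show "card {x\<in>Bad. b \<in> {b\<in>B - B'. R x b}} \<le> l" using gain[OF b] by (simp only:)
  qed
  also have "\<dots> \<le> l * card B" using fin by (simp add: card_mono)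
  finally have "(\<Sum>x\<in>Bad. card ({b\<in>B - B'. R x b} \<inter> (B - B'))) \<le> l * card B"
    using fin by (simp only: sum_card_incidences[OF finBad] finite_Diff)
  \<comment> \<open>The surplus \<open>2 * l * d\<close> in the degree hypothesis is aimed at this
    count: each bad vertex has that many neighbours outside \<open>B'\<close>, each of those sees at
    most \<open>l\<close> bad vertices, and \<open>card B \<le> d * card N\<close>, so at most half
    of \<open>N\<close> is bad.\<close>
  moreover have "(\<Sum>x\<in>Bad. 2 * l * d) \<le> (\<Sum>x\<in>Bad. card ({b\<in>B - B'. R x b} \<inter> (B - B')))"
  proof (rule sum_mono)
    fix x assume x: "x \<in> Bad"
    have "{b\<in>B - B'. R x b} \<inter> (B - B') = {b\<in>B. R x b} - {b\<in>B'. R x b}" by auto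
    moreover have "card ({b\<in>B. R x b} - {b\<in>B'. R x b}) = card {b\<in>B. R x b} - card {b\<in>B'. R x b}"
      using finB' sub by (intro card_Diff_subset) auto
    moreover have "card {b\<in>B'. R x b} < c" "c + 2 * l * d \<le> card {b\<in>B. R x b}"
      using deg[of x] x by (auto simp: Bad_def)
    then have "2 * l * d \<le> card {b\<in>B. R x b} - card {b\<in>B'. R x b}" by linarith
    ultimately show "2 * l * d \<le> card ({b\<in>B - B'. R x b} \<inter> (B - B'))" by (simp only:)
  qed
  ultimately have "(\<Sum>x\<in>Bad. 2 * l * d) \<le> l * card B" by (rule order_trans[rotated])
  also have "\<dots> \<le> l * (d * card N)" using BN by (rule mult_le_mono2)
  finally have "(l * d) * (2 * card Bad) \<le> (l * d) * card N" by (simp add: mult_ac)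
  then have bad: "2 * card Bad \<le> card N" using l by simp
  have "{x\<in>N. c \<le> card {b\<in>B'. R x b}} = N - Bad" by (auto simp: Bad_def)
  moreover have "card (N - Bad) = card N - card Bad" using fin by (simp add: Bad_def card_Diff_subset)
  ultimately have "card N \<le> 2 * card {x\<in>N. c \<le> card {b\<in>B'. R x b}}" using bad by simp
  moreover have "H B' \<le> (\<Sum>x\<in>N. c)" unfolding H_def by (intro sum_mono) simp
  then have "l * card B' \<le> c * card N" using B' by (simp add: Q_def mult.commute)
  ultimately show thesis using sub that by blast
qed

text \<open>Every neighbourhood is cut down to exactly the number of sets that
  \<open>attached\<close> prescribes.\<close>

lemma linkage_of_dense:
  assumes "sym E" "finite W" "W \<subseteq> {..<h} \<times> {..<h}" "finite F" "finite N" "N \<noteq> {}"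
    and F: "\<And>C. C \<in> F \<Longrightarrow> connected_set E C" "\<And>C C'. C \<in> F \<Longrightarrow> C' \<in> F \<Longrightarrow> C \<noteq> C' \<Longrightarrow> C \<inter> C' = {}" "N \<inter> \<Union>F = {}"
    and deg: "\<And>x. x \<in> N \<Longrightarrow> Suc (card W) \<le> card {C\<in>F. touches E x C}"
    and dens: "Suc h * fact (card W) * card F \<le> card N"
  shows "\<exists>v U. linkage E h W v U \<and> v ` {..<h} \<subseteq> N \<and> (\<forall>e\<in>W. U e \<subseteq> \<Union>F \<union> N)"
proof -
  have "\<forall>x\<in>N. \<exists>A \<subseteq> {C\<in>F. touches E x C}. card A = Suc (card W)"
    using deg by (meson obtain_subset_with_card_n)
  then obtain A where A: "\<And>x. x \<in> N \<Longrightarrow> A x \<subseteq> {C\<in>F. touches E x C} \<and> card (A x) = Suc (card W)"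
    by metis
  have "attached E F N A (Suc (card W))"
    unfolding attached_def
  proof (intro conjI ballI impI)
    fix y assume y: "y \<in> N"
    show "A y \<subseteq> F" "card (A y) = Suc (card W)" using A[OF y] by auto
    show "touches E y C" if "C \<in> A y" for C using A[OF y] that by auto
  qed (use assms in simp_all)
  moreover obtain x where "x \<in> N" using assms by blast
  then have "F \<noteq> {}" using deg[of x] by auto
  ultimately show ?thesis using linkage_exists[OF assms(2,1)] dens assms(3) by blast
qed

section \<open>Degree thresholds and the two density regimes\<close>

section \<open>Sparsity without clique linkages\<close>

definition clique_pairs :: "nat \<Rightarrow> (nat \<times> nat) set" where
  "clique_pairs h = {(i, j). i < j \<and> j < h}"

lemma clique_pairs: "finite (clique_pairs h)" "clique_pairs h \<subseteq> {..<h} \<times> {..<h}"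
proof -
  show "clique_pairs h \<subseteq> {..<h} \<times> {..<h}" by (auto simp: clique_pairs_def)
  then show "finite (clique_pairs h)" by (rule finite_subset) simp
qed

text \<open>The ratio of candidates to sets that \<open>linkage_exists\<close> asks for when all
  pairs are to be linked.\<close>

definition mader :: "nat \<Rightarrow> nat" where
  "mader h = Suc h * fact (card (clique_pairs h))"

text \<open>The degree that \<open>sparse_cover\<close> needs to leave \<open>Suc (mader h)\<close> times as many vertices as covering sets.\<close>

definition link_deg :: "nat \<Rightarrow> nat \<Rightarrow> nat" where
  "link_deg h d = (let c = Suc (card (clique_pairs h)) in c + 2 * (2 * c * Suc (mader h)) * d)"

text \<open>Minimum degree that forces a clique linkage in an arbitrary graph. The ratio is
  \<open>1\<close> since the covering elements are drawn from the vertices themselves.\<close>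

definition edge_density :: "nat \<Rightarrow> nat" where
  "edge_density h = link_deg h 1"

text \<open>The ratio \<open>edge_density h\<close> of sets to vertices is the point where
  \<open>few_neighbours\<close> switches to counting edges. The value becomes the constant
  \<open>c\<close> of the branching.\<close>

definition high_deg :: "nat \<Rightarrow> nat" where
  "high_deg h = link_deg h (edge_density h)"

lemma edge_density_pos: "edge_density h > 0" by (simp add: edge_density_def link_deg_def Let_def)

lemma high_deg_pos: "high_deg h > 0" by (simp add: high_deg_def link_deg_def Let_def)

text \<open>With \<open>l = 2 * c * Suc (mader h)\<close>, the bound on \<open>l * card B'\<close>
  and the survival of half of \<open>N\<close> combine to the ratio for Mader's argument. The
  successor leaves a spare copy of \<open>card B'\<close> for the case that \<open>B'\<close> has to
  be removed from the candidates.\<close>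

lemma sparse_cover_mader:
  fixes R :: "'a \<Rightarrow> 'b \<Rightarrow> bool"
  assumes "finite B" "finite N" "card B \<le> d * card N" "d > 0"
    and "\<And>x. x \<in> N \<Longrightarrow> link_deg h d \<le> card {b\<in>B. R x b}"
  obtains B' where "B' \<subseteq> B"
    "Suc (mader h) * card B' \<le> card {x\<in>N. Suc (card (clique_pairs h)) \<le> card {b\<in>B'. R x b}}"
    "card N \<le> 2 * card {x\<in>N. Suc (card (clique_pairs h)) \<le> card {b\<in>B'. R x b}}"
proof -
  define c where "c = Suc (card (clique_pairs h))"
  have "\<And>x. x \<in> N \<Longrightarrow> c + 2 * (2 * c * Suc (mader h)) * d \<le> card {b\<in>B. R x b}"
    using assms(5) unfolding link_deg_def c_def Let_def .
  then obtain B' where B': "B' \<subseteq> B" "card N \<le> 2 * card {x\<in>N. c \<le> card {b\<in>B'. R x b}}"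
    "2 * c * Suc (mader h) * card B' \<le> c * card N"
    by (rule sparse_cover[OF assms(1-3) _ _ assms(4), where l = "2 * c * Suc (mader h)" and R = R])
      (simp_all add: c_def)
  have "(2 * c) * (Suc (mader h) * card B') \<le> c * card N" using B'(3) by (simp only: mult.assoc)
  also have "\<dots> \<le> c * (2 * card {x\<in>N. c \<le> card {b\<in>B'. R x b}})" using B'(2) by (rule mult_le_mono2)
  finally have "(2 * c) * (Suc (mader h) * card B') \<le> (2 * c) * card {x\<in>N. c \<le> card {b\<in>B'. R x b}}"
    by (simp only: mult.assoc mult.left_commute)
  moreover have "0 < 2 * c" by (simp add: c_def)
  ultimately have "Suc (mader h) * card B' \<le> card {x\<in>N. c \<le> card {b\<in>B'. R x b}}"
    by (simp only: mult_le_cancel1)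
  then show thesis using that B' unfolding c_def by blast
qed

text \<open>Mader's theorem for a single graph: the vertices of a small set \<open>B'\<close>, taken
  as singletons, are the connected sets, and the well attached vertices outside \<open>B'\<close>
  are the branch candidates.\<close>

lemma linkage_of_min_degree:
  assumes "sym Q" "finite N" "N \<noteq> {}" "\<And>x. x \<in> N \<Longrightarrow> edge_density h \<le> card {y\<in>N. (x, y) \<in> Q}"
  shows "\<exists>v U. linkage Q h (clique_pairs h) v U \<and> v ` {..<h} \<subseteq> N \<and> (\<forall>e\<in>clique_pairs h. U e \<subseteq> N)"
proof -
  let ?c = "Suc (card (clique_pairs h))"
  obtain B' where B': "B' \<subseteq> N"
    "Suc (mader h) * card B' \<le> card {x\<in>N. ?c \<le> card {b\<in>B'. (x, b) \<in> Q}}"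
    "card N \<le> 2 * card {x\<in>N. ?c \<le> card {b\<in>B'. (x, b) \<in> Q}}"
    using sparse_cover_mader[of N N 1 h "\<lambda>x y. (x, y) \<in> Q"] assms unfolding edge_density_def by force
  define M where "M = {x\<in>N. ?c \<le> card {b\<in>B'. (x, b) \<in> Q}}"
  define M' where "M' = M - B'"
  have finB': "finite B'" using B' assms finite_subset by blast
  have finM: "finite M" using assms by (simp add: M_def)
  have "card N > 0" using assms by (simp add: card_gt_0_iff)
  then have "card M > 0" using B'(3) unfolding M_def[symmetric] by linarith
  have "card M \<le> card M' + card B'" unfolding M'_def using finB' finM
    by (metis add.commute card_Un_le le_trans card_mono finite_Un Un_Diff_cancel2 Un_upper1 finite_Diff)
  \<comment> \<open>The spare copy of \<open>card B'\<close> pays for removing \<open>B'\<close>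
    from \<open>M\<close>.\<close>
  then have dens: "mader h * card B' \<le> card M'" using B'(2) by (simp add: M_def)
  have "card M' > 0"
  proof (cases "card B' = 0")
    case True then show ?thesis using \<open>card M > 0\<close> \<open>card M \<le> card M' + card B'\<close> by simp
  next
    case False
    then show ?thesis using dens by (metis mader_def fact_nonzero gr_zeroI le_zero_eq mult_is_0 nat.simps(3))
  qed
  let ?F = "(\<lambda>y. {y}) ` B'"
  have "\<exists>v U. linkage Q h (clique_pairs h) v U \<and> v ` {..<h} \<subseteq> M' \<and> (\<forall>e\<in>clique_pairs h. U e \<subseteq> \<Union>?F \<union> M')"
  proof (rule linkage_of_dense[OF assms(1) clique_pairs])
    show "finite ?F" "finite M'" using finB' finM by (auto simp: M'_def)
    show "M' \<noteq> {}" using \<open>card M' > 0\<close> by auto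
    show "connected_set Q C" if "C \<in> ?F" for C using that by (auto simp: connected_set_def)
    show "C \<inter> C' = {}" if "C \<in> ?F" "C' \<in> ?F" "C \<noteq> C'" for C C' using that by auto
    show "M' \<inter> \<Union>?F = {}" by (auto simp: M'_def)
    have inj: "inj_on (\<lambda>y. {y}) X" for X :: "'a set" by (auto simp: inj_on_def)
    show "?c \<le> card {C\<in>?F. touches Q x C}" if "x \<in> M'" for x
    proof -
      have "{C\<in>?F. touches Q x C} = (\<lambda>y. {y}) ` {y\<in>B'. (x, y) \<in> Q}" by (auto simp: touches_def)
      then show ?thesis using that card_image[OF inj] by (simp add: M'_def M_def)
    qed
    show "Suc h * fact (card (clique_pairs h)) * card ?F \<le> card M'"
      using dens card_image[OF inj] by (simp add: mader_def)
  qed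
  then obtain v U where vU: "linkage Q h (clique_pairs h) v U" "v ` {..<h} \<subseteq> M'"
    "\<forall>e\<in>clique_pairs h. U e \<subseteq> \<Union>?F \<union> M'" by blast
  have "\<Union>?F \<union> M' \<subseteq> N" "M' \<subseteq> N" using B'(1) by (auto simp: M'_def M_def)
  then show ?thesis using vU by (meson order_trans)
qed

text \<open>Expands the auxiliary edges of \<open>Q\<close> to the sets of \<open>F\<close> that
  realise them. A set \<open>C\<close> stands for the single pair \<open>g C\<close>, which
  determines where it goes.\<close>

lemma linkage_realize:
  assumes "sym E" and L: "linkage Q h W v U" "v ` {..<h} \<subseteq> N" "\<forall>e\<in>W. U e \<subseteq> N" "W \<subseteq> {..<h} \<times> {..<h}"
    and F: "\<And>C. C \<in> F \<Longrightarrow> connected_set E C" "\<And>C C'. C \<in> F \<Longrightarrow> C' \<in> F \<Longrightarrow> C \<noteq> C' \<Longrightarrow> C \<inter> C' = {}"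
    and NF: "N \<inter> \<Union>F = {}"
    and Q: "\<And>x y. (x, y) \<in> Q \<Longrightarrow> \<exists>C\<in>F. g C = {x, y}"
    and g: "\<And>C x. C \<in> F \<Longrightarrow> x \<in> g C \<Longrightarrow> touches E x C"
  shows "\<exists>U. linkage E h W v U"
proof -
  \<comment> \<open>A realising set is added only if its pair meets \<open>U e\<close> and otherwise
    consists of branch vertices. As the sets \<open>U e\<close> are disjoint and avoid branch
    vertices, no set is assigned to two edges.\<close>
  define V where "V e = U e \<union> \<Union>{C\<in>F. g C \<inter> U e \<noteq> {} \<and> g C \<subseteq> U e \<union> v ` {..<h}}" for e
  note L' = L(1)[unfolded linkage_def]
  have con: "connected_set E (V e)" if e: "e \<in> W" for e
  proof -
    have conU: "connected_set Q (U e)" using L' e by blast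
    then obtain c where c: "c \<in> U e" by (auto simp: connected_set_def)
    have sub: "U e \<subseteq> V e" by (auto simp: V_def)
    have inC: "(x, y) \<in> (E \<inter> V e \<times> V e)\<^sup>*"
      if "C \<in> F" "g C \<inter> U e \<noteq> {}" "g C \<subseteq> U e \<union> v ` {..<h}" "x \<in> g C \<inter> U e" "y \<in> C" for C x y
    proof (rule touches_rtrancl[OF F(1)[OF that(1)] _ _ g[OF that(1)] that(5)])
      show "C \<subseteq> V e" using that unfolding V_def by blast
      show "x \<in> V e" "x \<in> g C" using that sub by auto
    qed
    have step: "(x, y) \<in> (E \<inter> V e \<times> V e)\<^sup>*" if xy: "(x, y) \<in> Q \<inter> U e \<times> U e" for x y
    proof -
      obtain C where C: "C \<in> F" "g C = {x, y}" using Q xy by blast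
      obtain z where z: "z \<in> C" using F(1)[OF C(1)] by (auto simp: connected_set_def)
      have "(x, z) \<in> (E \<inter> V e \<times> V e)\<^sup>*" "(y, z) \<in> (E \<inter> V e \<times> V e)\<^sup>*"
        using xy C z by (auto intro!: inC[of C])
      then show ?thesis using sym_restrict_rtrancl[OF assms(1)] by (meson rtrancl_trans)
    qed
    have U: "(x, y) \<in> (E \<inter> V e \<times> V e)\<^sup>*" if "x \<in> U e" "y \<in> U e" for x y
    proof -
      have "(x, y) \<in> (Q \<inter> U e \<times> U e)\<^sup>*" using conU that by (auto simp: connected_set_def)
      then show ?thesis
      proof induction
        case (step y z)
        then show ?case using \<open>\<And>x y. (x, y) \<in> Q \<inter> U e \<times> U e \<Longrightarrow> (x, y) \<in> (E \<inter> V e \<times> V e)\<^sup>*\<close>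
          by (meson rtrancl_trans)
      qed simp
    qed
    show ?thesis
    proof (rule connected_setI_hub[OF assms(1)])
      show "c \<in> V e" using c sub by blast
      fix u assume "u \<in> V e"
      then consider "u \<in> U e" | C where "C \<in> F" "g C \<inter> U e \<noteq> {}" "g C \<subseteq> U e \<union> v ` {..<h}" "u \<in> C"
        unfolding V_def by blast
      then show "(c, u) \<in> (E \<inter> V e \<times> V e)\<^sup>*"
      proof cases
        case 1 then show ?thesis using U c by blast
      next
        case 2
        then obtain x where "x \<in> g C \<inter> U e" by blast
        then show ?thesis using U[OF c, of x] inC[OF 2(1-3) _ 2(4)] by (meson IntD2 rtrancl_trans)
      qed
    qed
  qed
  have touch: "touches E (v i) (V e)" if e: "e \<in> W" "i < h" "touches Q (v i) (U e)" for e i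
  proof -
    obtain u where u: "u \<in> U e" "(v i, u) \<in> Q" using e by (auto simp: touches_def)
    then obtain C where C: "C \<in> F" "g C = {v i, u}" using Q by blast
    then have "C \<subseteq> V e" using u e unfolding V_def by blast
    moreover have "touches E (v i) C" using g[OF C(1)] C(2) by blast
    ultimately show ?thesis unfolding touches_def by blast
  qed
  have NC: "x \<notin> C" if "x \<in> N" "C \<in> F" for x C using NF that by blast
  have avoid: "V e \<inter> v ` {..<h} = {}" if e: "e \<in> W" for e
  proof -
    have "U e \<inter> v ` {..<h} = {}" using L' e by blast
    then show ?thesis using NC L(2) unfolding V_def by blast
  qed
  have dis: "V e \<inter> V e' = {}" if e: "e \<in> W" "e' \<in> W" "e \<noteq> e'" for e e'
  proof (rule ccontr)
    assume "V e \<inter> V e' \<noteq> {}"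
    then obtain x where x: "x \<in> V e" "x \<in> V e'" by blast
    have Ue: "U e \<inter> U e' = {}" "U e' \<inter> v ` {..<h} = {}" using L' e by blast+
    have UN: "U e \<subseteq> N" "U e' \<subseteq> N" using L(3) e by blast+
    show False
    proof (cases "x \<in> N")
      case True
      then have "x \<in> U e" "x \<in> U e'" using x NC unfolding V_def by blast+
      then show False using Ue by blast
    next
      case False
      then obtain C C' where C: "C \<in> F" "x \<in> C" "g C \<subseteq> U e \<union> v ` {..<h}" "C' \<in> F" "x \<in> C'" "g C' \<inter> U e' \<noteq> {}"
        using x UN unfolding V_def by blast
      then have "C = C'" using F(2) by blast
      then show False using C Ue by blast
    qed
  qed
  have "linkage E h W v V"
    unfolding linkage_def
  proof (intro conjI ballI impI)
    show "inj_on v {..<h}" using L' by blast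
    fix e assume e: "e \<in> W"
    then have i: "fst e < h" "snd e < h" using L(4) by auto
    show "connected_set E (V e)" "V e \<inter> v ` {..<h} = {}" using con avoid e by auto
    show "touches E (v (fst e)) (V e)" "touches E (v (snd e)) (V e)"
      using touch[OF e] i L' e by auto
    fix e' assume "e' \<in> W" "e \<noteq> e'"
    then show "V e \<inter> V e' = {}" using dis e by blast
  qed
  then show ?thesis by blast
qed

lemma inj_on_clique_pairs:
  assumes "inj_on v {..<h}" "e \<in> clique_pairs h" "e' \<in> clique_pairs h" "{v (fst e), v (snd e)} = {v (fst e'), v (snd e')}"
  shows "e = e'"
proof -
  obtain i j i' j' where e: "e = (i, j)" "e' = (i', j')" by (metis surj_pair)
  have ij: "i < j" "j < h" "i' < j'" "j' < h" using assms(2,3) e by (auto simp: clique_pairs_def)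
  then have eq: "(v i = v i') = (i = i')" "(v j = v j') = (j = j')" "(v i = v j') = (i = j')" "(v j = v i') = (j = i')"
    using assms(1) by (auto simp: inj_on_eq_iff)
  have "v i = v i' \<and> v j = v j' \<or> v i = v j' \<and> v j = v i'" using assms(4) e by (simp add: doubleton_eq_iff)
  then show ?thesis using eq ij e by auto
qed

text \<open>Otherwise every set has at least \<open>h\<close> neighbours in \<open>N\<close>. For up
  to \<open>edge_density h * card N\<close> sets, a thinned family meets the ratio for Mader's
  argument directly; beyond that, the sets provide enough edges on \<open>N\<close> to force a
  linkage there.\<close>

lemma few_neighbours:
  assumes "sym E" "finite F" "finite N" "N \<noteq> {}"
    and F: "\<And>C. C \<in> F \<Longrightarrow> connected_set E C" "\<And>C C'. C \<in> F \<Longrightarrow> C' \<in> F \<Longrightarrow> C \<noteq> C' \<Longrightarrow> C \<inter> C' = {}" "N \<inter> \<Union>F = {}"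
    and deg: "\<And>x. x \<in> N \<Longrightarrow> high_deg h \<le> card {C\<in>F. touches E x C}"
    and no_link: "\<not> (\<exists>v U. linkage E h (clique_pairs h) v U)"
  shows "\<exists>C\<in>F. card {x\<in>N. touches E x C} < h"
proof (rule ccontr)
  assume "\<not> ?thesis"
  then have many: "\<And>C. C \<in> F \<Longrightarrow> h \<le> card {x\<in>N. touches E x C}" by (meson not_less)
  let ?d = "edge_density h"
  show False
  proof (cases "card F \<le> ?d * card N")
    case True
    obtain F' where F': "F' \<subseteq> F"
      "Suc (mader h) * card F' \<le> card {x\<in>N. Suc (card (clique_pairs h)) \<le> card {C\<in>F'. touches E x C}}"
      "card N \<le> 2 * card {x\<in>N. Suc (card (clique_pairs h)) \<le> card {C\<in>F'. touches E x C}}"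
      using sparse_cover_mader[OF assms(2,3) True edge_density_pos, of h "touches E"] deg
      unfolding high_deg_def by blast
    define M where "M = {x\<in>N. Suc (card (clique_pairs h)) \<le> card {C\<in>F'. touches E x C}}"
    have "card N > 0" using assms by (simp add: card_gt_0_iff)
    then have "card M > 0" using F'(3) unfolding M_def[symmetric] by linarith
    have "mader h * card F' \<le> card M" using F'(2) unfolding M_def[symmetric] by simp
    have "\<exists>v U. linkage E h (clique_pairs h) v U \<and> v ` {..<h} \<subseteq> M \<and> (\<forall>e\<in>clique_pairs h. U e \<subseteq> \<Union>F' \<union> M)"
    proof (rule linkage_of_dense[OF assms(1) clique_pairs])
      show "finite F'" using F'(1) assms(2) by (rule finite_subset)
      show "finite M" using assms(3) by (simp add: M_def)
      show "M \<noteq> {}" using \<open>card M > 0\<close> by auto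
      show "connected_set E C" if "C \<in> F'" for C using that F'(1) F(1) by blast
      show "C \<inter> C' = {}" if "C \<in> F'" "C' \<in> F'" "C \<noteq> C'" for C C' using that F'(1) F(2) by (meson subsetD)
      show "M \<inter> \<Union>F' = {}" using F(3) F'(1) by (auto simp: M_def)
      show "Suc (card (clique_pairs h)) \<le> card {C\<in>F'. touches E x C}" if "x \<in> M" for x using that by (simp add: M_def)
      show "Suc h * fact (card (clique_pairs h)) * card F' \<le> card M"
        using \<open>mader h * card F' \<le> card M\<close> unfolding mader_def .
    qed
    then show False using no_link by blast
  next
    case big: False
    \<comment> \<open>Let distinct sets realise distinct edges on \<open>N\<close>, as many as possible. The neighbourhood of an
      unused set is a clique; if all sets are used, the graph of these edges is dense.\<close>
    define good where "good g F' \<longleftrightarrow> F' \<subseteq> F \<and> inj_on g F' \<and> (\<forall>C\<in>F'. card (g C) = 2 \<and> g C \<subseteq> {x\<in>N. touches E x C})"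
      for g :: "'a set \<Rightarrow> 'a set" and F'
    have "\<exists>g. good g {}" by (simp add: good_def)
    moreover have "\<forall>F'. (\<exists>g. good g F') \<longrightarrow> card F' < Suc (card F)"
      using assms(2) by (auto simp: good_def card_mono less_Suc_eq_le)
    ultimately obtain F' where "\<exists>g. good g F'" and max: "\<And>F''. \<exists>g. good g F'' \<Longrightarrow> card F'' \<le> card F'"
      using ex_has_greatest_nat[of "\<lambda>F'. \<exists>g. good g F'" "{}" card] by blast
    then obtain g where g: "good g F'" by blast
    have sub: "F' \<subseteq> F" and inj: "inj_on g F'" using g by (auto simp: good_def)
    have gC: "card (g C) = 2" "g C \<subseteq> {x\<in>N. touches E x C}" if "C \<in> F'" for C using g that by (auto simp: good_def)
    show False
    proof (cases "F' = F")
      case False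
      then obtain C where C: "C \<in> F" "C \<notin> F'" using sub by blast
      \<comment> \<open>If no used set joined \<open>x\<close> and \<open>y\<close>, then
        \<open>C\<close> could be added with this pair, against maximality. So any \<open>h\<close>
        neighbours of \<open>C\<close> are pairwise linked by single sets.\<close>
      have used: "\<exists>C'\<in>F'. g C' = {x, y}" if xy: "x \<in> N" "touches E x C" "y \<in> N" "touches E y C" "x \<noteq> y" for x y
      proof (rule ccontr)
        assume non: "\<not> ?thesis"
        have "good (g(C := {x, y})) (insert C F')"
          unfolding good_def
        proof (intro conjI ballI)
          show "insert C F' \<subseteq> F" using C sub by blast
          show "inj_on (g(C := {x, y})) (insert C F')" using inj non C(2) by (auto simp: inj_on_def)
          fix D assume D: "D \<in> insert C F'"
          show "card ((g(C := {x, y})) D) = 2" using D gC(1) C(2) xy by auto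
          show "(g(C := {x, y})) D \<subseteq> {z\<in>N. touches E z D}"
          proof (cases "D = C")
            case True then show ?thesis using xy by auto
          next
            case False then show ?thesis using D gC(2)[of D] by auto
          qed
        qed
        then have "card (insert C F') \<le> card F'" using max by blast
        then show False using C(2) sub assms(2) by (simp add: finite_subset)
      qed
      obtain v where v: "inj_on v {..<h}" "v ` {..<h} \<subseteq> {x\<in>N. touches E x C}"
        using card_le_inj[of "{..<h}" "{x\<in>N. touches E x C}"] many[OF C(1)] assms(3) by auto
      have ex: "\<exists>C'\<in>F'. g C' = {v (fst e), v (snd e)}" if "e \<in> clique_pairs h" for e
      proof (rule used)
        have lt: "fst e < snd e" "snd e < h" using that by (auto simp: clique_pairs_def)
        then show "v (fst e) \<noteq> v (snd e)" using v(1) by (auto simp: inj_on_eq_iff)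
        show "v (fst e) \<in> N" "touches E (v (fst e)) C" "v (snd e) \<in> N" "touches E (v (snd e)) C"
          using subsetD[OF v(2) imageI[of "fst e"]] subsetD[OF v(2) imageI[of "snd e"]] lt by auto
      qed
      then obtain U where U: "\<And>e. e \<in> clique_pairs h \<Longrightarrow> U e \<in> F' \<and> g (U e) = {v (fst e), v (snd e)}" by metis
      have "linkage E h (clique_pairs h) v U"
        unfolding linkage_def
      proof (intro conjI ballI impI)
        show "inj_on v {..<h}" by fact
        fix e assume e: "e \<in> clique_pairs h"
        then have UF: "U e \<in> F" using U sub by blast
        then show "connected_set E (U e)" by (rule F(1))
        show "touches E (v (fst e)) (U e)" "touches E (v (snd e)) (U e)" using U[OF e] gC(2)[of "U e"] by auto
        have "v ` {..<h} \<subseteq> N" using v(2) by blast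
        then show "U e \<inter> v ` {..<h} = {}" using F(3) UF by blast
        fix e' assume e': "e' \<in> clique_pairs h" "e \<noteq> e'"
        have "U e \<noteq> U e'"
        proof
          assume "U e = U e'"
          then have "{v (fst e), v (snd e)} = {v (fst e'), v (snd e')}" using U[OF e] U[OF e'(1)] by metis
          then show False using inj_on_clique_pairs[OF v(1) e e'(1)] e'(2) by blast
        qed
        then show "U e \<inter> U e' = {}" using F(2) UF U[OF e'(1)] sub by blast
      qed
      then show False using no_link by blast
    next
      case True
      \<comment> \<open>A smallest vertex set spanning more than \<open>?d\<close> edges per vertex
        has minimum degree at least \<open>?d\<close>, since deleting a vertex of smaller degree
        would keep the excess.\<close>
      define P where "P X \<longleftrightarrow> X \<subseteq> N \<and> ?d * card X < card {C\<in>F. g C \<subseteq> X}" for X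
      have "{C\<in>F. g C \<subseteq> N} = F" using gC(2) True by blast
      then have "P N" using big by (simp add: P_def)
      then obtain N1 where N1: "P N1" and min: "\<And>X. P X \<Longrightarrow> card N1 \<le> card X"
        using ex_has_least_nat[of P N card] by blast
      have N1N: "N1 \<subseteq> N" using N1 by (simp add: P_def)
      have finN1: "finite N1" using N1N assms(3) finite_subset by blast
      have "N1 \<noteq> {}"
      proof
        assume "N1 = {}"
        then have "{C\<in>F. g C \<subseteq> N1} = {}" using gC(1) True by force
        then have "card {C\<in>F. g C \<subseteq> N1} = 0" by (simp only: card.empty)
        then show False using N1 by (simp add: P_def)
      qed
      define Q where "Q = {(x, y). \<exists>C\<in>F. g C = {x, y}}"
      have symQ: "sym Q" by (auto simp: Q_def sym_def insert_commute)
      have "?d \<le> card {y\<in>N1. (x, y) \<in> Q}" if x: "x \<in> N1" for x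
      proof -
        have cx: "card (N1 - {x}) < card N1" using x finN1 by (rule card_Diff1_less[rotated])
        then have "\<not> P (N1 - {x})" using min by (meson not_less)
        then have "card {C\<in>F. g C \<subseteq> N1 - {x}} \<le> ?d * card (N1 - {x})" using N1N by (auto simp: P_def)
        moreover have "?d * card N1 = ?d * card (N1 - {x}) + ?d"
          using x finN1 by (metis card.remove mult_Suc_right add.commute)
        moreover have "{C\<in>F. g C \<subseteq> N1} = {C\<in>F. g C \<subseteq> N1 - {x}} \<union> {C\<in>F. g C \<subseteq> N1 \<and> x \<in> g C}" by blast
        then have "card {C\<in>F. g C \<subseteq> N1} \<le> card {C\<in>F. g C \<subseteq> N1 - {x}} + card {C\<in>F. g C \<subseteq> N1 \<and> x \<in> g C}"
          by (metis (lifting) card_Un_le)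
        ultimately have "?d \<le> card {C\<in>F. g C \<subseteq> N1 \<and> x \<in> g C}" using N1 unfolding P_def by linarith
        also have "\<dots> = card (g ` {C\<in>F. g C \<subseteq> N1 \<and> x \<in> g C})"
          using inj True by (intro card_image[symmetric]) (auto simp: inj_on_def)
        also have "\<dots> \<le> card ((\<lambda>y. {x, y}) ` {y\<in>N1. (x, y) \<in> Q})"
        proof (rule card_mono)
          show "finite ((\<lambda>y. {x, y}) ` {y\<in>N1. (x, y) \<in> Q})" using finN1 by simp
          show "g ` {C\<in>F. g C \<subseteq> N1 \<and> x \<in> g C} \<subseteq> (\<lambda>y. {x, y}) ` {y\<in>N1. (x, y) \<in> Q}"
          proof (rule image_subsetI)
            fix C assume C: "C \<in> {C\<in>F. g C \<subseteq> N1 \<and> x \<in> g C}"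
            then have "card (g C) = 2" using gC(1) True by blast
            then obtain a b where ab: "g C = {a, b}" by (auto simp: card_2_iff)
            then obtain y where "g C = {x, y}" using C by auto
            then show "g C \<in> (\<lambda>y. {x, y}) ` {y\<in>N1. (x, y) \<in> Q}" using C by (auto simp: Q_def)
          qed
        qed
        also have "\<dots> \<le> card {y\<in>N1. (x, y) \<in> Q}" using finN1 by (intro card_image_le) simp
        finally show ?thesis .
      qed
      then obtain v U where vU: "linkage Q h (clique_pairs h) v U" "v ` {..<h} \<subseteq> N1" "\<forall>e\<in>clique_pairs h. U e \<subseteq> N1"
        using linkage_of_min_degree[OF symQ finN1 \<open>N1 \<noteq> {}\<close>] by blast
      have "v ` {..<h} \<subseteq> N" "\<forall>e\<in>clique_pairs h. U e \<subseteq> N" using vU(2,3) N1N by (meson order_trans)+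
      then have "\<exists>U. linkage E h (clique_pairs h) v U"
      proof (rule linkage_realize[OF assms(1) vU(1) _ _ clique_pairs(2) F(1) F(2) F(3)])
        show "\<exists>C\<in>F. g C = {x, y}" if "(x, y) \<in> Q" for x y using that by (simp add: Q_def)
        show "touches E x C" if "C \<in> F" "x \<in> g C" for C x using gC(2)[of C] that True by blast
      qed
      then show False using no_link by blast
    qed
  qed
qed

section \<open>Extracting a subdivided clique from a linkage\<close>

section \<open>From linkages to topological minors\<close>

text \<open>Both directions of each edge, because \<open>subdivision_pair\<close> works on
  bidirected graphs.\<close>

fun chain_edges :: "'a list \<Rightarrow> 'a rel" where
  "chain_edges (x # y # zs) = {(x, y), (y, x)} \<union> chain_edges (y # zs)"
| "chain_edges _ = {}"

lemma rtrancl_distinct_path: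
  assumes "(a, b) \<in> R\<^sup>*"
  shows "\<exists>xs. distinct (a # xs) \<and> last (a # xs) = b \<and> successively (\<lambda>x y. (x, y) \<in> R) (a # xs)"
  using assms
proof (induction rule: converse_rtrancl_induct)
  case base
  show ?case by (rule exI[of _ "[]"]) simp
next
  case (step a c)
  then obtain xs where xs: "distinct (c # xs)" "last (c # xs) = b" "successively (\<lambda>x y. (x, y) \<in> R) (c # xs)" by blast
  show ?case
  proof (cases "a \<in> set (c # xs)")
    case True
    then obtain ys zs where yz: "c # xs = ys @ a # zs" by (meson split_list)
    have "distinct (a # zs)" "last (a # zs) = b" using xs(1,2) unfolding yz by auto
    moreover have "successively (\<lambda>x y. (x, y) \<in> R) (a # zs)"
      using xs(3) unfolding yz by (simp add: successively_append_iff)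
    ultimately show ?thesis by blast
  next
    case False
    then show ?thesis using xs step(1) by (intro exI[of _ "c # xs"]) auto
  qed
qed

lemma chain_edges_subset:
  assumes "sym E" "successively (\<lambda>x y. (x, y) \<in> E) xs" shows "chain_edges xs \<subseteq> E"
  using assms(2) by (induction xs rule: chain_edges.induct) (use assms(1) in \<open>auto simp: sym_def\<close>)

lemma chain_edges_interior:
  assumes "(a, b) \<in> chain_edges (u # ws @ [v])" "ws \<noteq> []" shows "a \<in> set ws \<or> b \<in> set ws"
  using assms
proof (induction ws arbitrary: u)
  case (Cons w ws)
  show ?case
  proof (cases "ws = []")
    case True then show ?thesis using Cons.prems(1) by auto
  next
    case False then show ?thesis using Cons by auto
  qed
qed simp

lemma connected_set_path:
  assumes "sym E" "connected_set E U" "touches E u U" "touches E v U"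
  shows "\<exists>ws. ws \<noteq> [] \<and> distinct ws \<and> set ws \<subseteq> U \<and> chain_edges (u # ws @ [v]) \<subseteq> E"
proof -
  obtain a b where ab: "a \<in> U" "(u, a) \<in> E" "b \<in> U" "(v, b) \<in> E" using assms by (auto simp: touches_def)
  have "(a, b) \<in> (E \<inter> U \<times> U)\<^sup>*" using assms(2) ab by (auto simp: connected_set_def)
  then obtain xs where xs: "distinct (a # xs)" "last (a # xs) = b" "successively (\<lambda>x y. (x, y) \<in> E \<inter> U \<times> U) (a # xs)"
    using rtrancl_distinct_path[of a b "E \<inter> U \<times> U"] by metis
  have sub: "set (a # xs) \<subseteq> U" using xs(3) ab(1)
    by (induction xs arbitrary: a) auto
  have s: "successively (\<lambda>x y. (x, y) \<in> E) (a # xs)" using xs(3) by (rule successively_mono) auto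
  have "(b, v) \<in> E" using ab assms(1) by (auto simp: sym_def)
  then have "successively (\<lambda>x y. (x, y) \<in> E) (u # (a # xs) @ [v])"
    using s xs(2) ab(2) by (simp only: append_Cons successively.simps)
      (simp add: successively_append_iff flip: append_Cons)
  then have "chain_edges (u # (a # xs) @ [v]) \<subseteq> E" by (rule chain_edges_subset[OF assms(1)])
  then show ?thesis using xs(1) sub by blast
qed

text \<open>A single subdivision inserts one vertex: put the first interior vertex \<open>w\<close>
  on the edge, then continue with the edge from \<open>w\<close> to \<open>v\<close>.\<close>

lemma subdivision_pair_path:
  assumes "subdivision_pair K H" "(u, v) \<in> parcs H" "distinct ws" "ws \<noteq> []" "set ws \<inter> pverts H = {}"
  shows "subdivision_pair K \<lparr>pverts = pverts H \<union> set ws,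
    parcs = parcs H - {(u, v), (v, u)} \<union> chain_edges (u # ws @ [v])\<rparr>"
  using assms
proof (induction ws arbitrary: u H)
  case (Cons w ws)
  interpret H: pair_bidirected_digraph H using Cons.prems(1) by (rule bidirected_digraphI_subdivision)
  have uv: "u \<noteq> v" using Cons.prems(2) H.no_loops' by blast
  have w: "w \<notin> pverts H" using Cons.prems by auto
  have fresh: "(w, x) \<notin> parcs H" "(x, w) \<notin> parcs H" for x
    using w H.wellformed' by blast+
  let ?H = "subdivide H (u, v) w"
  have sd: "subdivision_pair K ?H" by (rule subdivision_pair_divide[OF Cons.prems(2) w Cons.prems(1)])
  show ?case
  proof (cases "ws = []")
    case True
    have "\<lparr>pverts = pverts H \<union> set (w # ws), parcs = parcs H - {(u, v), (v, u)} \<union> chain_edges (u # (w # ws) @ [v])\<rparr> = ?H"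
      using True by (auto simp: subdivide.simps)
    then show ?thesis using sd by (simp only:)
  next
    case False
    have "subdivision_pair K \<lparr>pverts = pverts ?H \<union> set ws,
      parcs = parcs ?H - {(w, v), (v, w)} \<union> chain_edges (w # ws @ [v])\<rparr>"
    proof (rule Cons.IH[OF sd])
      show "(w, v) \<in> parcs ?H" by simp
      show "distinct ws" "ws \<noteq> []" "set ws \<inter> pverts ?H = {}" using Cons.prems False by auto
    qed
    moreover have "pverts ?H \<union> set ws = pverts H \<union> set (w # ws)" by auto
    moreover have "parcs ?H - {(w, v), (v, w)} \<union> chain_edges (w # ws @ [v])
      = parcs H - {(u, v), (v, u)} \<union> chain_edges (u # (w # ws) @ [v])"
      using uv fresh by auto
    ultimately show ?thesis by (simp only:)
  qed
qed simp

text \<open>The complete graph is taken on the branch vertices themselves, so its edges can be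
  subdivided one after the other with vertices of the host graph and without renaming.\<close>

lemma subdivision_of_linkage:
  fixes v :: "nat \<Rightarrow> 'a"
  assumes "sym E" and L: "linkage E h (clique_pairs h) v U"
  shows "\<exists>K S. K\<^bsub>h\<^esub> (with_proj K) \<and> subdivision_pair K S \<and> pverts S \<subseteq> v ` {..<h} \<union> (\<Union>e\<in>clique_pairs h. U e) \<and>
    v ` {..<h} \<subseteq> pverts S \<and> parcs S \<subseteq> E"
proof -
  have inj: "inj_on v {..<h}" using L by (simp add: linkage_def)
  have "\<exists>ws. ws \<noteq> [] \<and> distinct ws \<and> set ws \<subseteq> U e \<and> chain_edges (v (fst e) # ws @ [v (snd e)]) \<subseteq> E"
    if "e \<in> clique_pairs h" for e
    using L that by (intro connected_set_path[OF assms(1)]) (auto simp: linkage_def)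
  then obtain ws where ws: "\<And>e. e \<in> clique_pairs h \<Longrightarrow> ws e \<noteq> [] \<and> distinct (ws e) \<and> set (ws e) \<subseteq> U e
    \<and> chain_edges (v (fst e) # ws e @ [v (snd e)]) \<subseteq> E" by metis
  have dis: "set (ws e) \<inter> set (ws e') = {}" if "e \<in> clique_pairs h" "e' \<in> clique_pairs h" "e \<noteq> e'" for e e'
  proof -
    have "U e \<inter> U e' = {}" using L that by (simp add: linkage_def)
    then show ?thesis using ws that by blast
  qed
  have av: "v i \<notin> set (ws e)" if "e \<in> clique_pairs h" "i < h" for e i
  proof -
    have "U e \<inter> v ` {..<h} = {}" using L that by (simp add: linkage_def)
    then show ?thesis using ws that by blast
  qed
  let ?C = "{(a, b). (a, b) \<in> v ` {..<h} \<times> v ` {..<h} \<and> a \<noteq> b}"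
  define ch where "ch e = chain_edges (v (fst e) # ws e @ [v (snd e)])" for e
  define re where "re e = {(v (fst e), v (snd e)), (v (snd e), v (fst e))}" for e
  \<comment> \<open>The graph after the edges in \<open>W\<close> have been replaced by their paths;
    it leads from \<open>K\<close> to the required subgraph.\<close>
  define G where "G W = \<lparr>pverts = v ` {..<h} \<union> (\<Union>e\<in>W. set (ws e)), parcs = ?C - (\<Union>e\<in>W. re e) \<union> (\<Union>e\<in>W. ch e)\<rparr>" for W
  define K where "K = \<lparr>pverts = v ` {..<h}, parcs = ?C\<rparr>"
  have K: "K\<^bsub>h\<^esub> (with_proj K)"
    unfolding complete_digraph_pair_def using card_image[OF inj] by (simp add: K_def)
  interpret K: pair_graph K using K by (rule pair_graphI_complete)
  have sd: "subdivision_pair K (G W)" if "finite W" "W \<subseteq> clique_pairs h" for W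
    using that
  proof (induction W rule: finite_induct)
    case empty
    have "G {} = K" by (simp add: G_def K_def)
    then show ?case using subdivision_pair_base[of K] K.pair_bidirected_digraph_axioms by simp
  next
    case (insert e W)
    have e: "e \<in> clique_pairs h" and W: "W \<subseteq> clique_pairs h" using insert.prems by auto
    have lt: "fst e < h" "snd e < h" "fst e \<noteq> snd e" using e by (auto simp: clique_pairs_def)
    have neq: "v (fst e) \<noteq> v (snd e)" using inj lt by (auto simp: inj_on_eq_iff)
    have notre: "re e' \<inter> re e = {}" if "e' \<in> W" for e'
    proof (rule ccontr)
      assume "re e' \<inter> re e \<noteq> {}"
      then have "{v (fst e'), v (snd e')} = {v (fst e), v (snd e)}" by (auto simp: re_def)
      then have "e' = e" using inj_on_clique_pairs[OF inj, of e' e] that W e by blast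
      then show False using that insert.hyps by blast
    qed
    have notch: "re e \<inter> ch e' = {}" if "e' \<in> W" for e'
    proof -
      have e': "e' \<in> clique_pairs h" using that W by blast
      show ?thesis using chain_edges_interior[of _ _ "v (fst e')" "ws e'" "v (snd e')"] ws[OF e'] av[OF e' lt(1)] av[OF e' lt(2)]
        by (auto simp: re_def ch_def)
    qed
    \<comment> \<open>The edge is still present, since earlier replacements removed only other pairs
      of branch vertices.\<close>
    have "(v (fst e), v (snd e)) \<in> parcs (G W)"
    proof -
      have "(v (fst e), v (snd e)) \<in> ?C" using lt neq by auto
      moreover have "(v (fst e), v (snd e)) \<in> re e" by (simp add: re_def)
      ultimately show ?thesis using notre by (auto simp: G_def)
    qed
    moreover have "set (ws e) \<inter> pverts (G W) = {}"
    proof -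
      have "set (ws e) \<inter> set (ws e') = {}" if "e' \<in> W" for e' using dis[OF e, of e'] that W insert.hyps by blast
      moreover have "set (ws e) \<inter> v ` {..<h} = {}" using av[OF e] by blast
      ultimately show ?thesis by (simp add: G_def Int_Un_distrib Int_UN_distrib)
    qed
    ultimately have "subdivision_pair K \<lparr>pverts = pverts (G W) \<union> set (ws e),
        parcs = parcs (G W) - {(v (fst e), v (snd e)), (v (snd e), v (fst e))} \<union> ch e\<rparr>"
      unfolding ch_def using ws[OF e] insert.IH[OF W] by (intro subdivision_pair_path) auto
    moreover have "\<lparr>pverts = pverts (G W) \<union> set (ws e),
        parcs = parcs (G W) - {(v (fst e), v (snd e)), (v (snd e), v (fst e))} \<union> ch e\<rparr> = G (insert e W)"
    proof -
      have "parcs (G W) - re e \<union> ch e = ?C - (\<Union>e\<in>insert e W. re e) \<union> (\<Union>e\<in>insert e W. ch e)"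
        using notch by (auto simp: G_def)
      moreover have "pverts (G W) \<union> set (ws e) = v ` {..<h} \<union> (\<Union>e\<in>insert e W. set (ws e))" by (auto simp: G_def)
      ultimately show ?thesis by (simp only: G_def re_def)
    qed
    ultimately show ?case by (simp only:)
  qed
  have "?C \<subseteq> (\<Union>e\<in>clique_pairs h. re e)"
  proof
    fix p assume "p \<in> ?C"
    then obtain i j where ij: "p = (v i, v j)" "i < h" "j < h" "i \<noteq> j" by auto
    then have "(i, j) \<in> clique_pairs h \<or> (j, i) \<in> clique_pairs h" by (auto simp: clique_pairs_def)
    then show "p \<in> (\<Union>e\<in>clique_pairs h. re e)" using ij(1) by (force simp: re_def)
  qed
  moreover have "ch e \<subseteq> E" if "e \<in> clique_pairs h" for e using ws[OF that] unfolding ch_def by blast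
  ultimately have "parcs (G (clique_pairs h)) \<subseteq> E" unfolding G_def by (simp only: pair_pre_digraph.simps) blast
  moreover have "pverts (G (clique_pairs h)) \<subseteq> v ` {..<h} \<union> (\<Union>e\<in>clique_pairs h. U e)"
  proof -
    have "set (ws e) \<subseteq> U e" if "e \<in> clique_pairs h" for e using ws[OF that] by blast
    then show ?thesis unfolding G_def by (simp only: pair_pre_digraph.simps) blast
  qed
  moreover have "v ` {..<h} \<subseteq> pverts (G (clique_pairs h))" by (simp add: G_def)
  ultimately show ?thesis using K sd[OF clique_pairs(1) order_refl] by blast
qed

lemma digraph_iso_refl: "wf_digraph G \<Longrightarrow> digraph_iso G G"
  unfolding digraph_iso_def
  by (rule exI[of _ "\<lparr>iso_verts = id, iso_arcs = id, head = head G, tail = tail G\<rparr>"])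
    (auto simp: pre_digraph.digraph_isomorphism_def app_iso_def)

lemma no_linkage_if_excludes_topological_clique:
  fixes D :: "nat pair_pre_digraph"
  assumes wf: "pair_wf_digraph D" and ne: "pverts D \<noteq> {}" and ex: "excludes_topological_clique h D"
  shows "\<not> (\<exists>v U. linkage (parcs D \<union> (parcs D)\<inverse>) h (clique_pairs h) v U)"
proof
  let ?E = "parcs D \<union> (parcs D)\<inverse>"
  assume "\<exists>v U. linkage ?E h (clique_pairs h) v U"
  then obtain v U where L: "linkage ?E h (clique_pairs h) v U" by blast
  interpret D: pair_wf_digraph D by fact
  have symE: "sym ?E" by (auto simp: sym_def)
  have Ev: "a \<in> pverts D" "b \<in> pverts D" if "(a, b) \<in> ?E" for a b using that D.wellformed' by auto
  have "\<exists>v'. linkage ?E h (clique_pairs h) v' U \<and> v' ` {..<h} \<subseteq> pverts D"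
  \<comment> \<open>Branch vertices lie in the graph because each touches some \<open>U e\<close>.
    For \<open>h = 1\<close> there is no pair and the branch vertex of a linkage is arbitrary, so it
    is replaced by some vertex of \<open>D\<close>.\<close>
  proof (cases "h = 1")
    case True
    obtain r where "r \<in> pverts D" using ne by blast
    then show ?thesis using True by (intro exI[of _ "\<lambda>_. r"]) (auto simp: linkage_def clique_pairs_def inj_on_def)
  next
    case False
    have "v i \<in> pverts D" if i: "i < h" for i
    proof -
      define j where "j = (if i = 0 then 1 else 0 :: nat)"
      have j: "j < h" "j \<noteq> i" using i False by (auto simp: j_def)
      have "touches ?E (v i) (U (min i j, max i j))"
      proof -
        have "(min i j, max i j) \<in> clique_pairs h" using i j by (auto simp: clique_pairs_def)
        then have "touches ?E (v (min i j)) (U (min i j, max i j))" "touches ?E (v (max i j)) (U (min i j, max i j))"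
          using L by (auto simp: linkage_def)
        then show ?thesis by (cases "i \<le> j") (auto simp: min_def max_def split: if_splits)
      qed
      then show ?thesis using Ev by (auto simp: touches_def)
    qed
    then show ?thesis using L by blast
  qed
  then obtain v' where L': "linkage ?E h (clique_pairs h) v' U" "v' ` {..<h} \<subseteq> pverts D" by blast
  obtain K S where KS: "K\<^bsub>h\<^esub> (with_proj K)" "subdivision_pair K S" "pverts S \<subseteq> v' ` {..<h} \<union> (\<Union>e\<in>clique_pairs h. U e)"
    "v' ` {..<h} \<subseteq> pverts S" "parcs S \<subseteq> ?E"
    using subdivision_of_linkage[OF symE L'(1)] by blast
  have UD: "U e \<subseteq> pverts D" if e: "e \<in> clique_pairs h" for e
  proof
    fix x assume x: "x \<in> U e"
    obtain u where u: "u \<in> U e" "(v' (fst e), u) \<in> ?E" using L'(1) e by (auto simp: linkage_def touches_def)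
    have "(u, x) \<in> (?E \<inter> U e \<times> U e)\<^sup>*" using L'(1) e x u(1) unfolding linkage_def connected_set_def by blast
    then show "x \<in> pverts D"
    proof (cases rule: rtranclE)
      case base then show ?thesis using Ev u(2) by blast
    next
      case (step y) then show ?thesis using Ev by blast
    qed
  qed
  interpret S: pair_bidirected_digraph S using KS(2) by (rule bidirected_digraphI_subdivision)
  have parcs: "parcs (mk_symmetric (with_proj D)) = ?E" by (auto simp: parcs_mk_symmetric)
  have pverts: "pverts (mk_symmetric (with_proj D)) = pverts D" by (simp add: mk_symmetric_def)
  have "pverts S \<subseteq> pverts D" using KS(3) L'(2) UD by blast
  moreover have "wf_digraph (with_proj (mk_symmetric (with_proj D)))"
    using D.wf_digraph_axioms Ev unfolding wf_digraph_wp_iff by (auto intro!: pair_wf_digraph.intro simp: parcs pverts)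
  ultimately have "subgraph (with_proj S) (with_proj (mk_symmetric (with_proj D)))"
    unfolding subgraph_def using KS(5) S.wf_digraph_axioms by (simp add: parcs pverts compatible_def)
  then have "topological_minor (with_proj K) (with_proj (mk_symmetric (with_proj D)))"
    unfolding topological_minor_def using KS(2) digraph_iso_refl[OF S.wf_digraph_axioms] by blast
  then show False using ex KS(1) unfolding excludes_topological_clique_def by blast
qed

section \<open>Branching over heavy dominators and inference over target subsets\<close>

section \<open>The search\<close>

text \<open>\<open>R v b\<close> reads as domination and later becomes \<open>zreach\<close>;
  \<open>Bs\<close> are the component representatives, \<open>Ns\<close> the nonterminals and
  \<open>Y\<close> the vertices chosen so far. In the definitions below, \<open>X\<close> holds the
  excluded vertices.\<close>

definition undom :: "(nat \<Rightarrow> nat \<Rightarrow> bool) \<Rightarrow> nat list \<Rightarrow> nat list \<Rightarrow> nat list" where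
  "undom R Bs Y = filter (\<lambda>b. \<not> (\<exists>y\<in>set Y. R y b)) Bs"

definition high :: "(nat \<Rightarrow> nat \<Rightarrow> bool) \<Rightarrow> nat list \<Rightarrow> nat list \<Rightarrow> nat \<Rightarrow> nat list \<Rightarrow> nat list \<Rightarrow> nat list" where
  "high R Ns Bs c Y X = filter (\<lambda>v. v \<notin> set X \<and> c \<le> length (filter (R v) (undom R Bs Y))) Ns"

definition preds :: "(nat \<Rightarrow> nat \<Rightarrow> bool) \<Rightarrow> nat list \<Rightarrow> nat list \<Rightarrow> nat \<Rightarrow> nat list \<Rightarrow> nat list \<Rightarrow> nat \<Rightarrow> nat list" where
  "preds R Ns Bs c Y X b = filter (\<lambda>v. R v b) (high R Ns Bs c Y X)"

definition choices :: "(nat \<Rightarrow> nat \<Rightarrow> bool) \<Rightarrow> nat list \<Rightarrow> nat list \<Rightarrow> nat \<Rightarrow> nat \<Rightarrow> nat list \<Rightarrow> nat list \<Rightarrow> nat list" where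
  "choices R Ns Bs c h Y X =
     filter (\<lambda>b. preds R Ns Bs c Y X b \<noteq> [] \<and> length (preds R Ns Bs c Y X b) < h) (undom R Bs Y)"

text \<open>A state that admits no choice is copied, so the list after \<open>m\<close> rounds also
  contains the branches that ended earlier.\<close>

definition expand :: "(nat \<Rightarrow> nat \<Rightarrow> bool) \<Rightarrow> nat list \<Rightarrow> nat list \<Rightarrow> nat \<Rightarrow> nat \<Rightarrow> nat list \<times> nat list \<Rightarrow> (nat list \<times> nat list) list" where
  "expand R Ns Bs c h st = (case st of (Y, X) \<Rightarrow> (case choices R Ns Bs c h Y X of [] \<Rightarrow> [(Y, X)]
     | b # bs \<Rightarrow> (Y, preds R Ns Bs c Y X b @ X) # map (\<lambda>v. (v # Y, X)) (preds R Ns Bs c Y X b)))"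

definition states :: "(nat \<Rightarrow> nat \<Rightarrow> bool) \<Rightarrow> nat list \<Rightarrow> nat list \<Rightarrow> nat \<Rightarrow> nat \<Rightarrow> nat \<Rightarrow> (nat list \<times> nat list) list" where
  "states R Ns Bs c h m = ((\<lambda>ss. concat (map (expand R Ns Bs c h) ss)) ^^ m) [([], [])]"

text \<open>The fact \<open>(v, X, j)\<close> states that \<open>j\<close> further vertices, each reached from \<open>v\<close>, suffice to cover the
  targets in \<open>X\<close>. A target in \<open>T\<close> has to be reached, any other target has to be one of the vertices itself.\<close>

type_synonym fact = "nat \<times> nat list \<times> nat"

definition covers :: "(nat \<Rightarrow> nat \<Rightarrow> bool) \<Rightarrow> nat set \<Rightarrow> nat \<Rightarrow> nat \<Rightarrow> bool" where
  "covers R T v z \<longleftrightarrow> z \<in> T \<and> R v z \<or> v = z"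

definition base_fact :: "(nat \<Rightarrow> nat \<Rightarrow> bool) \<Rightarrow> nat set \<Rightarrow> nat list \<Rightarrow> fact \<Rightarrow> bool" where
  "base_fact R T Z u \<longleftrightarrow> (case u of (v, X, j) \<Rightarrow> j = 0 \<and> (\<forall>z\<in>set Z. z \<in> set X \<longleftrightarrow> covers R T v z))"

text \<open>The Dreyfus--Wagner step: a tree at \<open>v\<close> and a tree at its successor
  \<open>w\<close> are put together, and \<open>w\<close> itself accounts for the \<open>Suc\<close>
  in the cost.\<close>

definition joins :: "(nat \<Rightarrow> nat \<Rightarrow> bool) \<Rightarrow> nat list \<Rightarrow> nat list \<Rightarrow> fact \<Rightarrow> fact \<Rightarrow> fact \<Rightarrow> bool" where
  "joins R Ns Z a b u \<longleftrightarrow> (case a of (v1, X1, i) \<Rightarrow> case b of (w, X2, j) \<Rightarrow> case u of (v, X, l) \<Rightarrow>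
     v = v1 \<and> w \<in> set Ns \<and> R v w \<and> l = Suc (i + j) \<and> (\<forall>z\<in>set Z. z \<in> set X \<longleftrightarrow> z \<in> set X1 \<or> z \<in> set X2))"

text \<open>Target sets are represented by subsequences of \<open>Z\<close>, so that the facts form
  a list of single exponential length.\<close>

definition universe :: "nat list \<Rightarrow> nat list \<Rightarrow> nat \<Rightarrow> fact list" where
  "universe vs Z k = concat (map (\<lambda>v. concat (map (\<lambda>X. map (\<lambda>j. (v, X, j)) [0..<Suc k]) (subseqs Z))) vs)"

definition infer :: "(nat \<Rightarrow> nat \<Rightarrow> bool) \<Rightarrow> nat set \<Rightarrow> nat list \<Rightarrow> nat \<Rightarrow> nat \<Rightarrow> nat list \<Rightarrow> fact list \<Rightarrow> fact list" where
  "infer R T Ns r k Z L = filter (\<lambda>u. base_fact R T Z u \<or> (\<exists>a\<in>set L. \<exists>b\<in>set L. joins R Ns Z a b u)) (universe (r # Ns) Z k)"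

text \<open>Base facts take one round and every unit of cost at most one more, hence
  \<open>Suc k\<close> rounds.\<close>

definition reaches_all :: "(nat \<Rightarrow> nat \<Rightarrow> bool) \<Rightarrow> nat set \<Rightarrow> nat list \<Rightarrow> nat \<Rightarrow> nat \<Rightarrow> nat list \<Rightarrow> bool" where
  "reaches_all R T Ns r k Z \<longleftrightarrow>
     (\<exists>u\<in>set ((infer R T Ns r k Z ^^ Suc k) []). fst u = r \<and> (\<forall>z\<in>set Z. z \<in> set (fst (snd u))))"

text \<open>The length test keeps the number of target subsets at \<open>2 ^ (Suc c * k)\<close> or
  less. That \<open>Suc c * k\<close> rounds suffice is due to
  \<open>consistent_bound\<close>.\<close>

definition search :: "(nat \<Rightarrow> nat \<Rightarrow> bool) \<Rightarrow> nat set \<Rightarrow> nat list \<Rightarrow> nat list \<Rightarrow> nat \<Rightarrow> nat \<Rightarrow> nat \<Rightarrow> nat \<Rightarrow> bool" where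
  "search R T Ns Bs r c h k \<longleftrightarrow> (\<exists>(Y, X)\<in>set (states R Ns Bs c h (Suc c * k)).
     length (Y @ undom R Bs Y) \<le> Suc c * k \<and> reaches_all R T Ns r k (Y @ undom R Bs Y))"

definition via :: "(nat \<Rightarrow> nat \<Rightarrow> bool) \<Rightarrow> nat set \<Rightarrow> nat rel" where
  "via R S = {(x, y). R x y \<and> y \<in> S}"

lemma via_mono: "S \<subseteq> S' \<Longrightarrow> (via R S)\<^sup>* \<subseteq> (via R S')\<^sup>*"
  by (rule rtrancl_mono) (auto simp: via_def)

lemma filter_in_subseqs: "filter P xs \<in> set (subseqs xs)"
  by (induction xs) (auto simp: Let_def)

lemma universe_iff: "(v, X, j) \<in> set (universe vs Z k) \<longleftrightarrow> v \<in> set vs \<and> X \<in> set (subseqs Z) \<and> j \<le> k"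
  by (force simp: universe_def simp del: upt_Suc)

lemma infer_mono: "set L \<subseteq> set L' \<Longrightarrow> set (infer R T Ns r k Z L) \<subseteq> set (infer R T Ns r k Z L')"
  by (auto simp: infer_def)

lemma infer_power_mono:
  assumes "m \<le> m'"
  shows "set ((infer R T Ns r k Z ^^ m) []) \<subseteq> set ((infer R T Ns r k Z ^^ m') [])"
proof -
  have "set ((infer R T Ns r k Z ^^ m) []) \<subseteq> set ((infer R T Ns r k Z ^^ Suc m) [])" for m
    by (induction m) (auto dest: infer_mono[THEN subsetD, rotated])
  then show ?thesis using assms by (rule lift_Suc_mono_le)
qed

text \<open>For a join, take \<open>w\<close> together with the sets of both premises. These may
  overlap, which only lowers the cardinality.\<close>

lemma infer_sound:
  assumes "(v, X, j) \<in> set ((infer R T Ns r k Z ^^ m) [])"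
  shows "\<exists>S. finite S \<and> S \<subseteq> set Ns \<and> card S \<le> j \<and> (\<forall>s\<in>S. (v, s) \<in> (via R S)\<^sup>*) \<and>
    (\<forall>z\<in>set Z. z \<in> set X \<longrightarrow> (\<exists>s\<in>insert v S. covers R T s z))"
  using assms
proof (induction m arbitrary: v X j)
  case (Suc m)
  let ?L = "(infer R T Ns r k Z ^^ m) []"
  have "base_fact R T Z (v, X, j) \<or> (\<exists>a\<in>set ?L. \<exists>b\<in>set ?L. joins R Ns Z a b (v, X, j))"
    using Suc.prems by (simp add: infer_def[of R T Ns r k Z "(infer R T Ns r k Z ^^ m) []"])
  then show ?case
  proof
    assume "base_fact R T Z (v, X, j)"
    then show ?thesis by (intro exI[of _ "{}"]) (auto simp: base_fact_def)
  next
    assume "\<exists>a\<in>set ?L. \<exists>b\<in>set ?L. joins R Ns Z a b (v, X, j)"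
    then obtain X1 i w X2 i' where a: "(v, X1, i) \<in> set ?L" "(w, X2, i') \<in> set ?L"
      and J: "w \<in> set Ns" "R v w" "j = Suc (i + i')" "\<forall>z\<in>set Z. z \<in> set X \<longleftrightarrow> z \<in> set X1 \<or> z \<in> set X2"
      by (auto simp: joins_def)
    obtain S1 where S1: "finite S1" "S1 \<subseteq> set Ns" "card S1 \<le> i" "\<forall>s\<in>S1. (v, s) \<in> (via R S1)\<^sup>*"
      "\<forall>z\<in>set Z. z \<in> set X1 \<longrightarrow> (\<exists>s\<in>insert v S1. covers R T s z)" using Suc.IH[OF a(1)] by blast
    obtain S2 where S2: "finite S2" "S2 \<subseteq> set Ns" "card S2 \<le> i'" "\<forall>s\<in>S2. (w, s) \<in> (via R S2)\<^sup>*"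
      "\<forall>z\<in>set Z. z \<in> set X2 \<longrightarrow> (\<exists>s\<in>insert w S2. covers R T s z)" using Suc.IH[OF a(2)] by blast
    let ?S = "insert w (S1 \<union> S2)"
    have "card ?S \<le> Suc (card S1 + card S2)" using S1(1) S2(1)
      by (metis Suc_le_mono card_Un_le card_insert_le_m1 card_insert_if finite_Un le_SucI le_trans)
    then have "card ?S \<le> j" using S1(3) S2(3) J(3) by linarith
    moreover have "(v, s) \<in> (via R ?S)\<^sup>*" if "s \<in> ?S" for s
    proof -
      have vw: "(v, w) \<in> via R ?S" using J by (simp add: via_def)
      have "s = w \<or> s \<in> S1 \<or> s \<in> S2" using that by blast
      then consider "s = w" | "s \<in> S1" | "s \<in> S2" by blast
      then show ?thesis
      proof cases
        case 1 then show ?thesis using vw by blast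
      next
        case 2 then show ?thesis using S1(4) via_mono[of S1 ?S R] by blast
      next
        case 3
        then have "(w, s) \<in> (via R ?S)\<^sup>*" using S2(4) via_mono[of S2 ?S R] by blast
        then show ?thesis using vw by (rule converse_rtrancl_into_rtrancl[rotated])
      qed
    qed
    moreover have "\<forall>z\<in>set Z. z \<in> set X \<longrightarrow> (\<exists>s\<in>insert v ?S. covers R T s z)"
      using S1(5) S2(5) J(4) by blast
    ultimately show ?thesis using S1(1,2) S2(1,2) J(1) by (intro exI[of _ ?S]) auto
  qed
qed simp

text \<open>No tree is built: pick a first step from \<open>v\<close> to some \<open>w\<close> in
  \<open>S\<close>, give \<open>w\<close> everything it reaches inside \<open>S\<close>, and leave
  the rest to \<open>v\<close>. A path that enters the part of \<open>w\<close> never leaves it, so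
  the rest is reached from \<open>v\<close> outside that part. Both parts are smaller.\<close>

lemma infer_complete:
  assumes "finite S" "S \<subseteq> set Ns" "v \<in> insert r (set Ns)" "v \<notin> S" "card S \<le> k" "\<forall>s\<in>S. (v, s) \<in> (via R S)\<^sup>*"
  shows "\<exists>X. (v, X, card S) \<in> set ((infer R T Ns r k Z ^^ Suc (card S)) []) \<and>
    (\<forall>z\<in>set Z. z \<in> set X \<longleftrightarrow> (\<exists>s\<in>insert v S. covers R T s z))"
  using assms
proof (induction "card S" arbitrary: S v rule: less_induct)
  case less
  show ?case
  proof (cases "S = {}")
    case True
    let ?X = "filter (covers R T v) Z"
    have "(v, ?X, 0) \<in> set (infer R T Ns r k Z [])"
      using less.prems filter_in_subseqs by (auto simp: infer_def universe_iff base_fact_def)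
    then show ?thesis using True by (intro exI[of _ ?X]) auto
  next
    case False
    then obtain s where s: "s \<in> S" by blast
    then have "(v, s) \<in> (via R S)\<^sup>*" "v \<noteq> s" using less.prems by auto
    then obtain w where w: "R v w" "w \<in> S" by (auto elim: converse_rtranclE simp: via_def)
    define S2 where "S2 = {x\<in>S. (w, x) \<in> (via R S)\<^sup>*}"
    define S1 where "S1 = S - S2"
    define S3 where "S3 = S2 - {w}"
    have wS2: "w \<in> S2" using w by (simp add: S2_def)
    have fin: "finite S1" "finite S2" "finite S3" using less.prems(1) by (auto simp: S1_def S2_def S3_def)
    have r1: "x \<in> S2 \<or> (v, x) \<in> (via R S1)\<^sup>*" if "(v, x) \<in> (via R S)\<^sup>*" for x
      using that
    proof (induction rule: rtrancl_induct)
      case (step y x)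
      have x: "R y x" "x \<in> S" using step.hyps(2) by (auto simp: via_def)
      show ?case
      proof (cases "y \<in> S2 \<or> x \<in> S2")
        case True
        then show ?thesis using x step.hyps(2) by (auto simp: S2_def intro: rtrancl_into_rtrancl)
      next
        case False
        then have "(v, y) \<in> (via R S1)\<^sup>*" "(y, x) \<in> via R S1" using step.IH x by (auto simp: via_def S1_def)
        then show ?thesis by (meson rtrancl_into_rtrancl)
      qed
    qed simp
    have r3: "x = w \<or> (w, x) \<in> (via R S3)\<^sup>*" if "(w, x) \<in> (via R S)\<^sup>*" for x
      using that
    proof (induction rule: rtrancl_induct)
      case (step y x)
      have x: "R y x" "x \<in> S" using step.hyps(2) by (auto simp: via_def)
      have "(w, x) \<in> (via R S)\<^sup>*" using step.hyps by (rule rtrancl_into_rtrancl)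
      then have "x = w \<or> (y, x) \<in> via R S3" using x by (auto simp: via_def S3_def S2_def)
      moreover have "(w, y) \<in> (via R S3)\<^sup>*" using step.IH by blast
      ultimately show ?case by (meson rtrancl_into_rtrancl)
    qed simp
    have cS: "card S = card S1 + card S2" unfolding S1_def
      using less.prems(1) by (simp add: S2_def card_Diff_subset card_mono)
    have cS2: "card S2 = Suc (card S3)" unfolding S3_def using fin(2) wS2 by (rule card.remove)
    have "\<exists>X. (v, X, card S1) \<in> set ((infer R T Ns r k Z ^^ Suc (card S1)) []) \<and>
      (\<forall>z\<in>set Z. z \<in> set X \<longleftrightarrow> (\<exists>s\<in>insert v S1. covers R T s z))"
    proof (rule less.hyps)
      show "card S1 < card S" using cS cS2 by linarith
      show "\<forall>s\<in>S1. (v, s) \<in> (via R S1)\<^sup>*" using r1 less.prems(6) by (auto simp: S1_def)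
    qed (use less.prems fin cS in \<open>auto simp: S1_def\<close>)
    then obtain X1 where X1: "(v, X1, card S1) \<in> set ((infer R T Ns r k Z ^^ Suc (card S1)) [])"
      "\<forall>z\<in>set Z. z \<in> set X1 \<longleftrightarrow> (\<exists>s\<in>insert v S1. covers R T s z)" by blast
    have "\<exists>X. (w, X, card S3) \<in> set ((infer R T Ns r k Z ^^ Suc (card S3)) []) \<and>
      (\<forall>z\<in>set Z. z \<in> set X \<longleftrightarrow> (\<exists>s\<in>insert w S3. covers R T s z))"
    proof (rule less.hyps)
      show "card S3 < card S" using cS cS2 by linarith
      show "\<forall>s\<in>S3. (w, s) \<in> (via R S3)\<^sup>*" using r3 by (auto simp: S3_def S2_def)
      show "w \<in> insert r (set Ns)" using w less.prems(2) by blast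
      show "card S3 \<le> k" using cS cS2 less.prems(5) by linarith
    qed (use less.prems fin in \<open>auto simp: S3_def S2_def\<close>)
    then obtain X2 where X2: "(w, X2, card S3) \<in> set ((infer R T Ns r k Z ^^ Suc (card S3)) [])"
      "\<forall>z\<in>set Z. z \<in> set X2 \<longleftrightarrow> (\<exists>s\<in>insert w S3. covers R T s z)" by blast
    let ?L = "(infer R T Ns r k Z ^^ card S) []"
    have L: "(v, X1, card S1) \<in> set ?L" "(w, X2, card S3) \<in> set ?L"
      using X1(1) X2(1) cS cS2 infer_power_mono[of "Suc (card S1)" "card S" R T Ns r k Z]
        infer_power_mono[of "Suc (card S3)" "card S" R T Ns r k Z] by auto
    let ?X = "filter (\<lambda>z. \<exists>s\<in>insert v S. covers R T s z) Z"
    have "insert v S = insert v S1 \<union> insert w S3" using wS2 by (auto simp: S1_def S3_def S2_def)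
    then have "joins R Ns Z (v, X1, card S1) (w, X2, card S3) (v, ?X, card S)"
      using w less.prems(2) cS cS2 X1(2) X2(2) by (auto simp: joins_def)
    moreover have "(v, ?X, card S) \<in> set (universe (r # Ns) Z k)"
      using less.prems filter_in_subseqs by (auto simp: universe_iff)
    ultimately have "(v, ?X, card S) \<in> set (infer R T Ns r k Z ?L)" using L by (auto simp: infer_def)
    then show ?thesis by (intro exI[of _ ?X]) auto
  qed
qed

text \<open>What the search uses of the graph. By \<open>root\<close>, every target depends on a
  vertex of the solution. The bound \<open>sparse\<close> concerns arbitrary subfamilies because
  targets and candidates disappear during the branching.\<close>

locale steiner_search =
  fixes R :: "nat \<Rightarrow> nat \<Rightarrow> bool" and T :: "nat set" and Ns Bs :: "nat list" and r c h :: nat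
  assumes dist: "distinct Ns" "distinct Bs"
    and parts: "r \<notin> set Ns" "r \<notin> T" "set Bs \<subseteq> T" "set Ns \<inter> T = {}"
    and root: "\<And>b. b \<in> set Bs \<Longrightarrow> \<not> R r b"
    and c_pos: "c > 0"
    and sparse: "\<And>F N. F \<subseteq> set Bs \<Longrightarrow> N \<subseteq> set Ns \<Longrightarrow> N \<noteq> {} \<Longrightarrow> (\<And>x. x \<in> N \<Longrightarrow> c \<le> card {b\<in>F. R x b})
      \<Longrightarrow> \<exists>b\<in>F. card {x\<in>N. R x b} < h"
begin

abbreviation "undom' \<equiv> undom R Bs"
abbreviation "high' \<equiv> high R Ns Bs c"
abbreviation "preds' \<equiv> preds R Ns Bs c"
abbreviation "choices' \<equiv> choices R Ns Bs c h"
abbreviation "expand' \<equiv> expand R Ns Bs c h"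
abbreviation "states' \<equiv> states R Ns Bs c h"

definition steiner :: "nat set \<Rightarrow> bool" where
  "steiner S \<longleftrightarrow> (\<forall>b\<in>set Bs. \<exists>s. (r, s) \<in> (via R S)\<^sup>* \<and> R s b)"

lemma length_filter_undom: "length (filter (R v) (undom' Y)) = card {b\<in>set (undom' Y). R v b}"
  using dist(2) by (simp add: distinct_card[symmetric] undom_def)

lemma high_empty_if_no_choices:
  assumes "choices' Y X = []"
  shows "high' Y X = []"
proof (rule ccontr)
  let ?N = "set (high' Y X)"
  \<comment> \<open>Targets without a high dominator are left out, so that the target supplied by
    \<open>sparse\<close> has a predecessor to branch on.\<close>
  let ?F = "{b\<in>set (undom' Y). \<exists>v\<in>?N. R v b}"
  assume "high' Y X \<noteq> []"
  have "\<exists>b\<in>?F. card {x\<in>?N. R x b} < h"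
  proof (rule sparse)
    show "?F \<subseteq> set Bs" by (auto simp: undom_def)
    show "?N \<subseteq> set Ns" by (auto simp: high_def)
    show "?N \<noteq> {}" using \<open>high' Y X \<noteq> []\<close> by simp
    fix x assume x: "x \<in> ?N"
    then have "{b\<in>?F. R x b} = {b\<in>set (undom' Y). R x b}" by auto
    then show "c \<le> card {b\<in>?F. R x b}" using x length_filter_undom by (simp add: high_def)
  qed
  then obtain b where b: "b \<in> ?F" "card {x\<in>?N. R x b} < h" by blast
  have "length (preds' Y X b) = card {x\<in>?N. R x b}"
    using dist(1) by (simp add: distinct_card[symmetric] preds_def high_def)
  moreover have "preds' Y X b \<noteq> []" using b(1) by (auto simp: preds_def filter_empty_conv)
  ultimately have "b \<in> set (choices' Y X)" using b by (simp add: choices_def)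
  then show False using assms by simp
qed

lemma states_in_Ns: "(Y, X) \<in> set (states' m) \<Longrightarrow> set Y \<subseteq> set Ns"
proof (induction m arbitrary: Y X)
  case (Suc m)
  obtain Y' X' where st: "(Y', X') \<in> set (states' m)" "(Y, X) \<in> set (expand' (Y', X'))"
    using Suc.prems by (auto simp: states_def)
  have "set (preds' Y' X' b) \<subseteq> set Ns" for b by (auto simp: preds_def high_def)
  then show ?case using Suc.IH[OF st(1)] st(2) by (fastforce simp: expand_def split: list.splits)
qed (simp add: states_def)

text \<open>The chosen vertices are targets of the final inference and, being nonterminals, can be
  covered only by themselves. So they lie in \<open>S\<close> and dominate what the branching
  considered done.\<close>

lemma search_sound:
  assumes "search R T Ns Bs r c h k"
  shows "\<exists>S. S \<subseteq> set Ns \<and> card S \<le> k \<and> steiner S"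
proof -
  obtain Y X where YX: "(Y, X) \<in> set (states' (Suc c * k))" "reaches_all R T Ns r k (Y @ undom' Y)"
    using assms by (auto simp: search_def)
  let ?Z = "Y @ undom' Y"
  obtain X' j where u: "(r, X', j) \<in> set ((infer R T Ns r k ?Z ^^ Suc k) [])" "\<forall>z\<in>set ?Z. z \<in> set X'"
    using YX(2) unfolding reaches_all_def by fastforce
  have "j \<le> k" using u(1) by (simp add: infer_def universe_iff)
  obtain S where S: "S \<subseteq> set Ns" "card S \<le> j" "\<forall>s\<in>S. (r, s) \<in> (via R S)\<^sup>*"
    "\<forall>z\<in>set ?Z. \<exists>s\<in>insert r S. covers R T s z"
    using infer_sound[OF u(1)] u(2) by blast
  have YN: "set Y \<subseteq> set Ns" using YX(1) by (rule states_in_Ns)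
  have reach: "(r, s) \<in> (via R S)\<^sup>*" if "s \<in> insert r S" for s using S(3) that by blast
  have YS: "set Y \<subseteq> S"
  proof
    fix y assume y: "y \<in> set Y"
    then obtain s where "s \<in> insert r S" "covers R T s y" using S(4) by auto
    moreover have "y \<in> set Ns" "y \<notin> T" "y \<noteq> r" using y YN parts by auto
    ultimately show "y \<in> S" by (auto simp: covers_def)
  qed
  have "\<exists>s. (r, s) \<in> (via R S)\<^sup>* \<and> R s b" if b: "b \<in> set Bs" for b
  proof (cases "b \<in> set (undom' Y)")
    case True
    then obtain s where s: "s \<in> insert r S" "covers R T s b" using S(4) by auto
    have "b \<in> T" using b parts by blast
    then have "s \<noteq> b" using s(1) S(1) parts by auto
    then have "R s b" using s(2) by (simp add: covers_def)
    then show ?thesis using reach[OF s(1)] by blast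
  next
    case False
    then obtain y where "y \<in> set Y" "R y b" using b by (auto simp: undom_def)
    then show ?thesis using reach YS by blast
  qed
  then show ?thesis using S(1,2) \<open>j \<le> k\<close> unfolding steiner_def by (meson order_trans)
qed

text \<open>The ghost set \<open>M\<close> collects the targets whose high predecessors have all been excluded.\<close>

definition consistent :: "nat set \<Rightarrow> nat list \<Rightarrow> nat list \<Rightarrow> nat set \<Rightarrow> bool" where
  "consistent S Y X M \<longleftrightarrow> distinct Y \<and> set Y \<subseteq> S \<and> S \<inter> set X = {} \<and> M \<subseteq> set Bs \<and>
     (\<forall>b\<in>M. \<forall>x\<in>set (high' Y X). \<not> R x b) \<and>
     (\<forall>w\<in>S. (\<exists>b\<in>M. R w b) \<longrightarrow> card {b\<in>M \<union> set (undom' Y). R w b} < c)"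

context
  fixes S k
  assumes S: "S \<subseteq> set Ns" "card S \<le> k" "steiner S"
begin

lemma finite_S: "finite S" using S(1) finite_subset by blast

lemma dominated: "b \<in> set Bs \<Longrightarrow> \<exists>w\<in>S. R w b"
proof -
  assume b: "b \<in> set Bs"
  then obtain s where s: "(r, s) \<in> (via R S)\<^sup>*" "R s b" using S(3) by (auto simp: steiner_def)
  then have "s \<noteq> r" using root[OF b] by auto
  then have "s \<in> S" using s(1) by (auto elim: rtranclE simp: via_def)
  then show ?thesis using s(2) by blast
qed

lemma card_dominated:
  assumes "M \<subseteq> set Bs" "\<And>w. w \<in> S \<Longrightarrow> card {b\<in>M. R w b} \<le> c"
  shows "card M \<le> c * k"
proof -
  have finM: "finite M" using assms(1) finite_subset by blast
  have "M \<subseteq> (\<Union>w\<in>S. {b\<in>M. R w b})" using dominated assms(1) by blast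
  then have "card M \<le> card (\<Union>w\<in>S. {b\<in>M. R w b})" using finite_S finM by (intro card_mono) auto
  also have "\<dots> \<le> (\<Sum>w\<in>S. card {b\<in>M. R w b})" by (rule card_UN_le[OF finite_S])
  also have "\<dots> \<le> (\<Sum>w\<in>S. c)" using assms(2) by (rule sum_mono)
  also have "\<dots> = c * card S" by simp
  also have "\<dots> \<le> c * k" using S(2) by (rule mult_le_mono2)
  finally show ?thesis .
qed

text \<open>\<open>S\<close> accounts for both summands: it contains \<open>Y\<close>, and its
  vertices together dominate all of \<open>M\<close> while each of them dominates fewer than
  \<open>c\<close> of its elements.\<close>

lemma consistent_bound:
  assumes "consistent S Y X M"
  shows "length Y + card M \<le> Suc c * k"
proof -
  have "length Y = card (set Y)" using assms by (simp add: consistent_def distinct_card)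
  also have "\<dots> \<le> card S" using assms finite_S by (intro card_mono) (auto simp: consistent_def)
  finally have "length Y \<le> k" using S(2) by simp
  moreover have "card M \<le> c * k"
  proof (rule card_dominated)
    show "M \<subseteq> set Bs" using assms by (simp add: consistent_def)
    fix w assume w: "w \<in> S"
    show "card {b\<in>M. R w b} \<le> c"
    proof (cases "\<exists>b\<in>M. R w b")
      case True
      have "finite M" using assms finite_subset by (auto simp: consistent_def)
      then have "card {b\<in>M. R w b} \<le> card {b\<in>M \<union> set (undom' Y). R w b}" by (intro card_mono) auto
      moreover have "card {b\<in>M \<union> set (undom' Y). R w b} < c" using assms w True by (simp add: consistent_def)
      ultimately show ?thesis by linarith
    next
      case False
      then have "{b\<in>M. R w b} = {}" by blast
      then have "card {b\<in>M. R w b} = 0" by (simp only: card.empty)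
      then show ?thesis by simp
    qed
  qed
  ultimately show ?thesis by simp
qed

text \<open>Follow the branch that agrees with \<open>S\<close>. If \<open>S\<close> contains one of
  the high predecessors, that vertex is chosen and \<open>Y\<close> grows; if not, all of them may
  be excluded and \<open>b\<close> enters the ghost set. Either way the bounded measure grows by
  one.\<close>

lemma consistent_step:
  assumes con: "consistent S Y X M" and ch: "choices' Y X = b # bs"
  shows "\<exists>Y' X' M'. (Y', X') \<in> set (expand' (Y, X)) \<and> consistent S Y' X' M' \<and>
    length Y' + card M' = Suc (length Y + card M)"
proof -
  let ?P = "preds' Y X b" and ?H = "high' Y X" and ?F = "undom' Y"
  have "b \<in> set (choices' Y X)" using ch by simp
  then have bF: "b \<in> set ?F" and Pne: "?P \<noteq> []" by (auto simp: choices_def)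
  have P: "x \<in> set ?P \<longleftrightarrow> x \<in> set ?H \<and> R x b" for x by (auto simp: preds_def)
  have conD: "distinct Y" "set Y \<subseteq> S" "S \<inter> set X = {}" "M \<subseteq> set Bs"
    "\<And>b x. b \<in> M \<Longrightarrow> x \<in> set ?H \<Longrightarrow> \<not> R x b"
    "\<And>w. w \<in> S \<Longrightarrow> \<exists>b\<in>M. R w b \<Longrightarrow> card {b\<in>M \<union> set ?F. R w b} < c"
    using con by (auto simp: consistent_def)
  have finM: "finite M" using conD(4) finite_subset by blast
  show ?thesis
  proof (cases "\<exists>x\<in>set ?P. x \<in> S")
    case True
    then obtain x where x: "x \<in> set ?P" "x \<in> S" by blast
    have xH: "x \<in> set ?H" using x P by blast
    \<comment> \<open>A chosen vertex dominates nothing undominated, so with \<open>c > 0\<close> it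
      is not high.\<close>
    have "x \<notin> set Y"
    proof
      assume "x \<in> set Y"
      then have "filter (R x) ?F = []" by (auto simp: undom_def filter_empty_conv)
      then show False using xH c_pos by (simp add: high_def)
    qed
    have Fsub: "set (undom' (x # Y)) \<subseteq> set ?F" by (auto simp: undom_def)
    have Hsub: "set (high' (x # Y) X) \<subseteq> set ?H"
    proof -
      have "card {b\<in>set (undom' (x # Y)). R v b} \<le> card {b\<in>set ?F. R v b}" for v
        using Fsub by (intro card_mono) auto
      then show ?thesis by (auto simp: high_def length_filter_undom intro: order_trans)
    qed
    have "consistent S (x # Y) X M"
      unfolding consistent_def
    proof (intro conjI ballI impI)
      show "distinct (x # Y)" "set (x # Y) \<subseteq> S" "S \<inter> set X = {}" "M \<subseteq> set Bs"
        using conD \<open>x \<notin> set Y\<close> x by auto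
      show "\<not> R y b'" if "b' \<in> M" "y \<in> set (high' (x # Y) X)" for b' y using conD(5) Hsub that by blast
      fix w assume w: "w \<in> S" "\<exists>b\<in>M. R w b"
      have "card {b\<in>M \<union> set (undom' (x # Y)). R w b} \<le> card {b\<in>M \<union> set ?F. R w b}"
        using Fsub finM by (intro card_mono) auto
      then show "card {b\<in>M \<union> set (undom' (x # Y)). R w b} < c" using conD(6)[OF w] by linarith
    qed
    moreover have "(x # Y, X) \<in> set (expand' (Y, X))" using ch x by (simp add: expand_def)
    ultimately show ?thesis by (intro exI[of _ "x # Y"] exI[of _ X] exI[of _ M]) simp
  next
    case False
    \<comment> \<open>\<open>b\<close> still has a high predecessor, unlike the members of
      \<open>M\<close>.\<close>
    obtain x0 where "x0 \<in> set ?P" using Pne by (meson last_in_set)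
    then have bM: "b \<notin> M" using conD(5) P by blast
    have Hsub: "set (high' Y (?P @ X)) \<subseteq> set ?H - set ?P" by (auto simp: high_def)
    have "consistent S Y (?P @ X) (insert b M)"
      unfolding consistent_def
    proof (intro conjI ballI impI)
      show "distinct Y" "set Y \<subseteq> S" "S \<inter> set (?P @ X) = {}" "insert b M \<subseteq> set Bs"
        using conD False bF by (auto simp: undom_def)
      show "\<not> R y b'" if "b' \<in> insert b M" "y \<in> set (high' Y (?P @ X))" for b' y
        using conD(5) Hsub P that by blast
      fix w assume w: "w \<in> S" "\<exists>a\<in>insert b M. R w a"
      show "card {a\<in>insert b M \<union> set ?F. R w a} < c"
      proof (cases "\<exists>b\<in>M. R w b")
        case True
        have "insert b M \<union> set ?F = M \<union> set ?F" using bF by blast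
        then show ?thesis using conD(6)[OF w(1) True] by (simp only:)
      next
        \<comment> \<open>A vertex of \<open>S\<close> that dominates \<open>b\<close> is neither a
          high predecessor of \<open>b\<close> nor excluded, hence light. This gives the bound
          \<open>c\<close> at the moment when it first dominates a ghost target.\<close>
        case none: False
        then have "R w b" using w by blast
        then have "w \<notin> set ?H" using False w P by blast
        moreover have "w \<in> set Ns" "w \<notin> set X" using w S(1) conD(3) by auto
        ultimately have "card {b\<in>set ?F. R w b} < c" by (simp add: high_def length_filter_undom)
        moreover have "{a\<in>insert b M \<union> set ?F. R w a} = {b\<in>set ?F. R w b}" using none bF by blast
        ultimately show ?thesis by (simp only:)
      qed
    qed
    moreover have "(Y, ?P @ X) \<in> set (expand' (Y, X))" using ch by (simp add: expand_def)
    moreover have "card (insert b M) = Suc (card M)" using finM bM by simp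
    ultimately show ?thesis by (intro exI[of _ Y] exI[of _ "?P @ X"] exI[of _ "insert b M"]) simp
  qed
qed

lemma states_consistent:
  "\<exists>Y X M. (Y, X) \<in> set (states' m) \<and> consistent S Y X M \<and>
     (choices' Y X = [] \<or> length Y + card M = m)"
proof (induction m)
  case 0
  have "consistent S [] [] {}" by (simp add: consistent_def)
  then show ?case by (intro exI[of _ "[]"] exI[of _ "{}"]) (simp add: states_def)
next
  case (Suc m)
  then obtain Y X M where YX: "(Y, X) \<in> set (states' m)" "consistent S Y X M"
    "choices' Y X = [] \<or> length Y + card M = m" by blast
  have in_next: "(Y', X') \<in> set (states' (Suc m))" if "(Y', X') \<in> set (expand' (Y, X))" for Y' X'
    using YX(1) that by (auto simp: states_def)
  show ?case
  proof (cases "choices' Y X")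
    case Nil
    then have "(Y, X) \<in> set (expand' (Y, X))" by (simp add: expand_def)
    then show ?thesis using in_next YX(2) Nil by blast
  next
    case (Cons b bs)
    then have "length Y + card M = m" using YX(3) by simp
    then show ?thesis using consistent_step[OF YX(2) Cons] in_next by metis
  qed
qed

text \<open>Another step after \<open>Suc c * k\<close> rounds would violate
  \<open>consistent_bound\<close>, so the consistent state is finished. Then no vertex is high, each
  vertex of \<open>S\<close> dominates at most \<open>c\<close> open targets, and the length test
  succeeds.\<close>

lemma search_complete_reachable:
  assumes reach: "\<forall>s\<in>S. (r, s) \<in> (via R S)\<^sup>*"
  shows "search R T Ns Bs r c h k"
proof -
  obtain Y X M where YX: "(Y, X) \<in> set (states' (Suc c * k))" "consistent S Y X M"
    "choices' Y X = [] \<or> length Y + card M = Suc c * k" using states_consistent by blast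
  have "choices' Y X = []"
  proof (rule ccontr)
    assume ne: "choices' Y X \<noteq> []"
    then obtain b bs where "choices' Y X = b # bs" by (meson neq_Nil_conv)
    then obtain Y' X' M' where "consistent S Y' X' M'" "length Y' + card M' = Suc (Suc c * k)"
      using consistent_step[OF YX(2)] YX(3) ne by metis
    then show False using consistent_bound by force
  qed
  then have noH: "high' Y X = []" by (rule high_empty_if_no_choices)
  let ?F = "undom' Y"
  have YS: "set Y \<subseteq> S" "distinct Y" "S \<inter> set X = {}" using YX(2) by (auto simp: consistent_def)
  have "card (set ?F) \<le> c * k"
  proof (rule card_dominated)
    show "set ?F \<subseteq> set Bs" by (auto simp: undom_def)
    fix w assume w: "w \<in> S"
    then have "w \<in> set Ns" "w \<notin> set X" using S(1) YS by auto
    moreover have "w \<notin> set (high' Y X)" using noH by simp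
    ultimately show "card {b\<in>set ?F. R w b} \<le> c" by (simp add: high_def length_filter_undom)
  qed
  moreover have "distinct ?F" using dist(2) by (simp add: undom_def)
  then have "length ?F = card (set ?F)" by (simp only: distinct_card)
  moreover have "length Y \<le> k" using S(2) YS(1,2) finite_S
    by (metis card_mono distinct_card le_trans)
  ultimately have len: "length (Y @ ?F) \<le> Suc c * k" by simp
  have "r \<notin> S" using S(1) parts by blast
  then obtain Z where Z: "(r, Z, card S) \<in> set ((infer R T Ns r k (Y @ ?F) ^^ Suc (card S)) [])"
    "\<forall>z\<in>set (Y @ ?F). z \<in> set Z \<longleftrightarrow> (\<exists>s\<in>insert r S. covers R T s z)"
    using infer_complete[OF finite_S S(1), of r r k R T "Y @ ?F"] S(2) reach by blast
  have "\<forall>z\<in>set (Y @ ?F). z \<in> set Z"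
  proof
    fix z assume z: "z \<in> set (Y @ ?F)"
    have "\<exists>s\<in>insert r S. covers R T s z"
    proof (cases "z \<in> set Y")
      case True then show ?thesis using YS(1) by (auto simp: covers_def)
    next
      case False
      then have "z \<in> set Bs" using z by (auto simp: undom_def)
      then show ?thesis using dominated parts(3) by (auto simp: covers_def)
    qed
    then show "z \<in> set Z" using Z(2) z by blast
  qed
  moreover have "(r, Z, card S) \<in> set ((infer R T Ns r k (Y @ ?F) ^^ Suc k) [])"
    using Z(1) infer_power_mono[of "Suc (card S)" "Suc k" R T Ns r k "Y @ ?F"] S(2) by auto
  ultimately have "reaches_all R T Ns r k (Y @ ?F)" unfolding reaches_all_def by force
  then show ?thesis using YX(1) len unfolding search_def by blast
qed

end

lemma search_correct: "search R T Ns Bs r c h k \<longleftrightarrow> (\<exists>S. S \<subseteq> set Ns \<and> card S \<le> k \<and> steiner S)"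
proof
  assume "\<exists>S. S \<subseteq> set Ns \<and> card S \<le> k \<and> steiner S"
  then obtain S where S: "S \<subseteq> set Ns" "card S \<le> k" "steiner S" by blast
  \<comment> \<open>Unreachable vertices are dropped, since the inference finds only sets that are
    reached from \<open>r\<close>.\<close>
  define S' where "S' = {s\<in>S. (r, s) \<in> (via R S)\<^sup>*}"
  have r: "(r, s) \<in> (via R S')\<^sup>*" if "(r, s) \<in> (via R S)\<^sup>*" for s
    using that
  proof (induction rule: rtrancl_induct)
    case (step y x)
    then have "(r, x) \<in> (via R S)\<^sup>*" by (meson rtrancl_into_rtrancl)
    then have "(y, x) \<in> via R S'" using step.hyps(2) by (auto simp: via_def S'_def)
    then show ?case using step.IH by (meson rtrancl_into_rtrancl)
  qed simp
  have "S' \<subseteq> set Ns" using S(1) by (auto simp: S'_def)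
  moreover have "finite S" using S(1) finite_subset by blast
  then have "card S' \<le> k" using S(2) card_mono[of S S'] by (auto simp: S'_def)
  moreover have "steiner S'" using S(3) r by (auto simp: steiner_def)
  moreover have "\<forall>s\<in>S'. (r, s) \<in> (via R S')\<^sup>*" using r by (auto simp: S'_def)
  ultimately show "search R T Ns Bs r c h k" by (rule search_complete_reachable)
qed (rule search_sound)

end

section \<open>Reducing the problem to dominating source components\<close>

section \<open>Source components\<close>

text \<open>Reachability by paths all of whose inner vertices are terminals, that is, paths free of charge.\<close>

definition zreach :: "nat rel \<Rightarrow> nat set \<Rightarrow> nat \<Rightarrow> nat \<Rightarrow> bool" where
  "zreach A T x y \<longleftrightarrow> (x, y) \<in> A O {(a, b) \<in> A. a \<in> T}\<^sup>*"

text \<open>The strongly connected components of the terminals that no other terminal enters and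
  that the root does not enter for free, each represented by its least vertex.\<close>

definition source_reps :: "nat rel \<Rightarrow> nat set \<Rightarrow> nat \<Rightarrow> nat \<Rightarrow> nat list" where
  "source_reps A T r n = filter (\<lambda>b. b \<in> T \<and> \<not> zreach A T r b \<and>
     (\<forall>t\<in>T. zreach A T t b \<longrightarrow> zreach A T b t \<and> b \<le> t)) [0..<n]"

definition nonterminals :: "nat set \<Rightarrow> nat \<Rightarrow> nat \<Rightarrow> nat list" where
  "nonterminals T r n = filter (\<lambda>v. v \<notin> T \<and> v \<noteq> r) [0..<n]"

lemma zreach_arc: "(x, y) \<in> A \<Longrightarrow> zreach A T x y"
  by (auto simp: zreach_def)

lemma zreach_step: "zreach A T x t \<Longrightarrow> t \<in> T \<Longrightarrow> (t, y) \<in> A \<Longrightarrow> zreach A T x y"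
  unfolding zreach_def by (blast intro: rtrancl_into_rtrancl)

lemma zreach_induct [consumes 1, case_names arc step]:
  assumes "zreach A T x y" "\<And>y. (x, y) \<in> A \<Longrightarrow> P y"
    "\<And>t y. zreach A T x t \<Longrightarrow> t \<in> T \<Longrightarrow> (t, y) \<in> A \<Longrightarrow> P t \<Longrightarrow> P y"
  shows "P y"
proof -
  obtain z where z: "(x, z) \<in> A" "(z, y) \<in> {(a, b) \<in> A. a \<in> T}\<^sup>*" using assms(1) by (auto simp: zreach_def)
  have "zreach A T x y \<and> P y" using z(2)
  proof (induction rule: rtrancl_induct)
    case base then show ?case using z(1) assms(2) zreach_arc by blast
  next
    case (step y w) then show ?case using assms(3) zreach_step by blast
  qed
  then show ?thesis by blast
qed

lemma zreach_trans:
  assumes "zreach A T x t" "t \<in> T" "zreach A T t y" shows "zreach A T x y"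
  using assms(3) by (induction rule: zreach_induct) (use assms in \<open>auto intro: zreach_step\<close>)

locale terminal_digraph =
  fixes n :: nat and A :: "nat rel" and r :: nat and T :: "nat set"
  assumes arcs: "A \<subseteq> {..<n} \<times> {..<n}" and root: "r < n" and terminals: "T \<subseteq> {..<n} - {r}"
begin

abbreviation "Z \<equiv> zreach A T"
abbreviation "Bs \<equiv> source_reps A T r n"
abbreviation "Ns \<equiv> nonterminals T r n"

lemma finite_T: "finite T" using terminals finite_subset by blast

lemma Bs_iff: "b \<in> set Bs \<longleftrightarrow> b \<in> T \<and> \<not> Z r b \<and> (\<forall>t\<in>T. Z t b \<longrightarrow> Z b t \<and> b \<le> t)"
  using terminals by (auto simp: source_reps_def)

lemma Ns_iff: "v \<in> set Ns \<longleftrightarrow> v \<in> {..<n} - (T \<union> {r})"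
  by (auto simp: nonterminals_def)

text \<open>Among the ancestor sets of terminals leading to \<open>t\<close>, a smallest one is a
  source component: all its members have the same ancestors. Its least element is the
  representative, unless the root reaches it for free.\<close>

lemma source_reaches:
  assumes t: "t \<in> T"
  shows "Z r t \<or> (\<exists>b\<in>set Bs. b = t \<or> Z b t)"
proof -
  define Anc where "Anc t = insert t {t'\<in>T. Z t' t}" for t
  have finAnc: "finite (Anc t)" for t using finite_T by (simp add: Anc_def)
  have Anc_mono: "Anc a \<subseteq> Anc b" if "a \<in> Anc b" "a \<in> T" for a b
    using that by (auto simp: Anc_def intro: zreach_trans)
  obtain t0 where t0: "t0 \<in> T" "t0 \<in> Anc t" and min: "\<And>t'. t' \<in> T \<Longrightarrow> t' \<in> Anc t \<Longrightarrow> card (Anc t0) \<le> card (Anc t')"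
    using ex_has_least_nat[of "\<lambda>t'. t' \<in> T \<and> t' \<in> Anc t" t "\<lambda>t'. card (Anc t')"] t by (auto simp: Anc_def)
  have AncT: "Anc t0 \<subseteq> T" using t0(1) by (auto simp: Anc_def)
  define b where "b = Min (Anc t0)"
  have bA: "b \<in> Anc t0" unfolding b_def using finAnc[of t0] by (intro Min_in) (auto simp: Anc_def)
  have bT: "b \<in> T" using bA AncT by blast
  have eq: "Anc a = Anc t0" if "a \<in> Anc t0" for a
  proof (rule card_seteq[OF finAnc])
    have a: "a \<in> T" using that AncT by blast
    show "Anc a \<subseteq> Anc t0" using Anc_mono that a by blast
    have "a \<in> Anc t" using Anc_mono[OF t0(2,1)] that by blast
    then show "card (Anc t0) \<le> card (Anc a)" using min a by blast
  qed
  have bt: "b = t \<or> Z b t" using bA Anc_mono[OF t0(2,1)] by (auto simp: Anc_def)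
  show ?thesis
  proof (cases "Z r b")
    case True
    then show ?thesis using bt bT by (auto intro: zreach_trans)
  next
    case False
    have "Z b t' \<and> b \<le> t'" if t': "t' \<in> T" "Z t' b" for t'
    proof -
      have "t' \<in> Anc b" using t' by (simp add: Anc_def)
      then have t'A: "t' \<in> Anc t0" using eq[OF bA] by blast
      then have "b \<in> Anc t'" using eq bA by blast
      then have "Z b t'" using t' by (auto simp: Anc_def)
      moreover have "b \<le> t'" unfolding b_def using finAnc t'A by (rule Min_le)
      ultimately show ?thesis ..
    qed
    then have "b \<in> set Bs" using bT False by (simp add: Bs_iff)
    then show ?thesis using bt by blast
  qed
qed

text \<open>A path in the induced graph is cut at its nonterminals; the pieces are free and become
  steps of \<open>via\<close>. Conversely, free paths between vertices of \<open>W\<close> stay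
  inside \<open>W\<close>, and \<open>source_reaches\<close> leads from the representatives to all
  other terminals.\<close>

lemma reach_iff_via:
  assumes S: "S \<subseteq> {..<n} - (T \<union> {r})"
  defines "W \<equiv> S \<union> T \<union> {r}"
  shows "(\<forall>t\<in>T. (r, t) \<in> (A \<inter> W \<times> W)\<^sup>*) \<longleftrightarrow> (\<forall>b\<in>set Bs. \<exists>s. (r, s) \<in> (via Z S)\<^sup>* \<and> Z s b)"
proof
  assume L: "\<forall>t\<in>T. (r, t) \<in> (A \<inter> W \<times> W)\<^sup>*"
  show "\<forall>b\<in>set Bs. \<exists>s. (r, s) \<in> (via Z S)\<^sup>* \<and> Z s b"
  proof
    fix b assume b: "b \<in> set Bs"
    then have bT: "b \<in> T" by (simp add: Bs_iff)
    \<comment> \<open>The witness \<open>s\<close> is the last vertex outside \<open>T\<close> that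
      precedes \<open>x\<close>, starting with \<open>r\<close>.\<close>
    have "\<exists>s\<in>insert r S. (r, s) \<in> (via Z S)\<^sup>* \<and> (x = s \<or> Z s x)" if "(r, x) \<in> (A \<inter> W \<times> W)\<^sup>*" for x
      using that
    proof (induction rule: rtrancl_induct)
      case (step y x)
      then obtain s where s: "s \<in> insert r S" "(r, s) \<in> (via Z S)\<^sup>*" "y = s \<or> Z s y" by blast
      have yx: "(y, x) \<in> A" "y \<in> W" using step.hyps by auto
      show ?case
      proof (cases "y \<in> T")
        case True
        then have "y \<noteq> s" using s(1) S terminals by blast
        then have "Z s x" using s(3) True yx by (blast intro: zreach_step)
        then show ?thesis using s by blast
      next
        case False
        then have "y \<in> insert r S" using yx by (auto simp: W_def)
        moreover have "(r, y) \<in> (via Z S)\<^sup>*"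
        proof (cases "y = r \<or> y = s")
          case True then show ?thesis using s(2) by auto
        next
          case False
          then have "(s, y) \<in> via Z S" using s(3) \<open>y \<in> insert r S\<close> by (auto simp: via_def)
          then show ?thesis using s(2) by (meson rtrancl_into_rtrancl)
        qed
        moreover have "Z y x" using yx by (blast intro: zreach_arc)
        ultimately show ?thesis by blast
      qed
    qed auto
    then obtain s where "s \<in> insert r S" "(r, s) \<in> (via Z S)\<^sup>*" "b = s \<or> Z s b" using L bT by blast
    moreover have "b \<notin> insert r S" using bT S terminals by blast
    ultimately show "\<exists>s. (r, s) \<in> (via Z S)\<^sup>* \<and> Z s b" by blast
  qed
next
  assume Rt: "\<forall>b\<in>set Bs. \<exists>s. (r, s) \<in> (via Z S)\<^sup>* \<and> Z s b"
  have Zr: "(x, y) \<in> (A \<inter> W \<times> W)\<^sup>*" if "Z x y" "x \<in> W" "y \<in> W" for x y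
  proof -
    have "y \<in> W \<longrightarrow> (x, y) \<in> (A \<inter> W \<times> W)\<^sup>*" using that(1)
    proof (induction rule: zreach_induct)
      case (arc y) then show ?case using that(2) by auto
    next
      case (step t y)
      then have "t \<in> W" by (auto simp: W_def)
      then show ?case using step by (auto intro: rtrancl_into_rtrancl)
    qed
    then show ?thesis using that(3) by blast
  qed
  have viaW: "s \<in> W \<and> (r, s) \<in> (A \<inter> W \<times> W)\<^sup>*" if "(r, s) \<in> (via Z S)\<^sup>*" for s
    using that
  proof (induction rule: rtrancl_induct)
    case base then show ?case by (simp add: W_def)
  next
    case (step y x)
    then have "Z y x" "x \<in> W" by (auto simp: via_def W_def)
    then show ?case using step.IH Zr by (meson rtrancl_trans)
  qed
  show "\<forall>t\<in>T. (r, t) \<in> (A \<inter> W \<times> W)\<^sup>*"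
  proof
    fix t assume t: "t \<in> T"
    have TW: "T \<subseteq> W" "r \<in> W" by (auto simp: W_def)
    from source_reaches[OF t] show "(r, t) \<in> (A \<inter> W \<times> W)\<^sup>*"
    proof
      assume "Z r t" then show ?thesis using Zr TW t by blast
    next
      assume "\<exists>b\<in>set Bs. b = t \<or> Z b t"
      then obtain b where b: "b \<in> set Bs" "b = t \<or> Z b t" by blast
      then have bT: "b \<in> T" by (simp add: Bs_iff)
      obtain s where "(r, s) \<in> (via Z S)\<^sup>*" "Z s b" using Rt b(1) by blast
      then have "(r, b) \<in> (A \<inter> W \<times> W)\<^sup>*" using viaW Zr TW bT by (meson rtrancl_trans subsetD)
      moreover have "(b, t) \<in> (A \<inter> W \<times> W)\<^sup>*" using b(2) Zr TW bT t by blast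
      ultimately show ?thesis by (rule rtrancl_trans)
    qed
  qed
qed

text \<open>The case \<open>t = b\<close> is listed separately since \<open>zreach\<close> needs at
  least one arc, and a component with a single vertex may have none.\<close>

definition scc :: "nat \<Rightarrow> nat set" where
  "scc b = {t\<in>T. t = b \<or> Z b t \<and> Z t b}"

text \<open>Every vertex on a free path from \<open>b\<close> to a member leads back to
  \<open>b\<close> through that member, so the path stays in the component.\<close>

lemma scc_connected:
  assumes b: "b \<in> set Bs"
  shows "connected_set (A \<union> A\<inverse>) (scc b)"
proof (rule connected_setI_hub)
  let ?E = "A \<union> A\<inverse>"
  have bT: "b \<in> T" using b by (simp add: Bs_iff)
  show "sym ?E" by (auto simp: sym_def)
  show bc: "b \<in> scc b" using bT by (simp add: scc_def)
  fix u assume u: "u \<in> scc b"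
  show "(b, u) \<in> (?E \<inter> scc b \<times> scc b)\<^sup>*"
  proof (cases "u = b")
    case False
    then have "Z b u" using u by (simp add: scc_def)
    then have "u \<in> scc b \<longrightarrow> (b, u) \<in> (?E \<inter> scc b \<times> scc b)\<^sup>*"
    proof (induction rule: zreach_induct)
      case (arc y) then show ?case using bc by auto
    next
      case (step t y)
      show ?case
      proof
        assume y: "y \<in> scc b"
        have "Z t y" using step by (blast intro: zreach_arc)
        then have "Z t b" using y by (auto simp: scc_def intro: zreach_trans)
        then have t: "t \<in> scc b" using step by (simp add: scc_def)
        then show "(b, y) \<in> (?E \<inter> scc b \<times> scc b)\<^sup>*" using step y by (auto intro: rtrancl_into_rtrancl)
      qed
    qed
    then show ?thesis using u by blast
  qed simp
qed

lemma scc_disjoint: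
  assumes "b \<in> set Bs" "b' \<in> set Bs" "scc b \<inter> scc b' \<noteq> {}" shows "b = b'"
proof -
  obtain t where t: "t \<in> scc b" "t \<in> scc b'" using assms(3) by blast
  have bT: "b \<in> T" "b' \<in> T" using assms by (auto simp: Bs_iff)
  have "b = b' \<or> Z b b' \<and> Z b' b" using t by (auto simp: scc_def intro: zreach_trans)
  then show ?thesis using assms(1,2) bT by (auto simp: Bs_iff intro: antisym)
qed

text \<open>The vertex after \<open>x\<close> on a free path to \<open>b\<close> is \<open>b\<close>
  or a terminal that reaches \<open>b\<close>; as no terminal enters the component from outside, it
  belongs to it.\<close>

lemma scc_touches:
  assumes b: "b \<in> set Bs" and x: "Z x b"
  shows "touches (A \<union> A\<inverse>) x (scc b)"
proof -
  have bT: "b \<in> T" using b by (simp add: Bs_iff)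
  have "\<exists>t. (x, t) \<in> A \<and> (t = y \<or> t \<in> T \<and> Z t y)" if "Z x y" for y
    using that
  proof (induction rule: zreach_induct)
    case (step t y)
    then show ?case by (blast intro: zreach_step zreach_arc)
  qed blast
  then obtain t where t: "(x, t) \<in> A" "t = b \<or> t \<in> T \<and> Z t b" using x by blast
  then have "t \<in> scc b" using b bT by (auto simp: scc_def Bs_iff)
  then show ?thesis using t(1) by (auto simp: touches_def)
qed

text \<open>Adjacency to a component ignores directions and is weaker than domination. Both uses go
  the right way: it only raises the degrees of \<open>N\<close>, and few adjacent vertices means few
  dominators.\<close>

lemma sparse_sources:
  assumes no_link: "\<not> (\<exists>v U. linkage (A \<union> A\<inverse>) h (clique_pairs h) v U)"
    and F: "F \<subseteq> set Bs" and N: "N \<subseteq> set Ns" "N \<noteq> {}" and deg: "\<And>x. x \<in> N \<Longrightarrow> high_deg h \<le> card {b\<in>F. Z x b}"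
  shows "\<exists>b\<in>F. card {x\<in>N. Z x b} < h"
proof -
  let ?E = "A \<union> A\<inverse>"
  have finF: "finite F" and finN: "finite N" using F N finite_subset by blast+
  have inj: "inj_on scc F"
  proof (rule inj_onI)
    fix b b' assume b: "b \<in> F" "b' \<in> F" "scc b = scc b'"
    have "b \<in> scc b" using b(1) F by (auto simp: scc_def Bs_iff)
    then have "scc b \<inter> scc b' \<noteq> {}" using b(3) by blast
    then show "b = b'" using scc_disjoint b(1,2) F by blast
  qed
  have "\<exists>C\<in>scc ` F. card {x\<in>N. touches ?E x C} < h"
  proof (rule few_neighbours[OF _ _ finN N(2) _ _ _ _ no_link])
    show "sym ?E" by (auto simp: sym_def)
    show "finite (scc ` F)" using finF by simp
    show "connected_set ?E C" if "C \<in> scc ` F" for C using that F scc_connected by blast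
    show "C \<inter> C' = {}" if "C \<in> scc ` F" "C' \<in> scc ` F" "C \<noteq> C'" for C C' using that F scc_disjoint by blast
    show "N \<inter> \<Union>(scc ` F) = {}" using N(1) by (auto simp: scc_def Ns_iff)
    fix x assume x: "x \<in> N"
    have "card {b\<in>F. Z x b} = card (scc ` {b\<in>F. Z x b})"
      using inj by (intro card_image[symmetric]) (auto simp: inj_on_def)
    also have "\<dots> \<le> card {C\<in>scc ` F. touches ?E x C}"
      using finF F scc_touches by (intro card_mono) auto
    finally show "high_deg h \<le> card {C\<in>scc ` F. touches ?E x C}" using deg[OF x] by linarith
  qed
  then obtain b where b: "b \<in> F" "card {x\<in>N. touches ?E x (scc b)} < h" by blast
  have "card {x\<in>N. Z x b} \<le> card {x\<in>N. touches ?E x (scc b)}"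
    using finN F b(1) scc_touches by (intro card_mono) auto
  then show ?thesis using b by (meson le_less_trans)
qed

end

definition solve :: "nat \<Rightarrow> nat \<Rightarrow> nat rel \<Rightarrow> nat \<Rightarrow> nat set \<Rightarrow> nat \<Rightarrow> bool" where
  "solve h n A r T k = search (zreach A T) T (nonterminals T r n) (source_reps A T r n) r (high_deg h) h k"

lemma terminal_digraph_instance: "dst_instance n D r T \<Longrightarrow> terminal_digraph n (parcs D) r T"
proof -
  assume d: "dst_instance n D r T"
  then interpret D: pair_fin_digraph D by (simp add: dst_instance_def)
  show ?thesis using d D.wellformed' by unfold_locales (auto simp: dst_instance_def)
qed

lemma dst_solvable_iff_via:
  assumes d: "dst_instance n D r T"
  shows "dst_solvable D r T k \<longleftrightarrow> (\<exists>S\<subseteq>set (nonterminals T r n). card S \<le> k \<and>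
    (\<forall>b\<in>set (source_reps (parcs D) T r n). \<exists>s. (r, s) \<in> (via (zreach (parcs D) T) S)\<^sup>* \<and> zreach (parcs D) T s b))"
proof -
  interpret D: pair_fin_digraph D using d by (simp add: dst_instance_def)
  interpret terminal_digraph n "parcs D" r T using d by (rule terminal_digraph_instance)
  have V: "pverts D = {..<n}" using d by (simp add: dst_instance_def)
  have "(\<exists>p. pre_digraph.apath (with_proj D \<restriction> W) r p t) \<longleftrightarrow> (r, t) \<in> (parcs D \<inter> W \<times> W)\<^sup>*" if W: "r \<in> W" for W t
  proof -
    interpret H: wf_digraph "with_proj D \<restriction> W" by (rule D.wellformed_induce_subgraph)
    have "arcs_ends (with_proj D \<restriction> W) = parcs D \<inter> W \<times> W"
      by (auto simp: arcs_ends_conv)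
    then show ?thesis using H.reachable_apath[of r t] H.reachable_conv'[of r t] W by simp
  qed
  moreover have "set (nonterminals T r n) = {..<n} - (T \<union> {r})" using Ns_iff by blast
  ultimately show ?thesis using reach_iff_via unfolding dst_solvable_def V by (simp cong: conj_cong)
qed

lemma solve_correct:
  assumes d: "dst_instance n D r T" and ex: "excludes_topological_clique h D"
  shows "solve h n (parcs D) r T k \<longleftrightarrow> dst_solvable D r T k"
proof -
  interpret D: pair_fin_digraph D using d by (simp add: dst_instance_def)
  interpret terminal_digraph n "parcs D" r T using d by (rule terminal_digraph_instance)
  have "pverts D \<noteq> {}" using d by (auto simp: dst_instance_def)
  then have nl: "\<not> (\<exists>v U. linkage (parcs D \<union> (parcs D)\<inverse>) h (clique_pairs h) v U)"
    using no_linkage_if_excludes_topological_clique[OF D.pair_wf_digraph_axioms _ ex] by blast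
  interpret steiner_search Z T Ns Bs r "high_deg h" h
  proof
    show "distinct Ns" "distinct Bs" by (simp_all add: nonterminals_def source_reps_def)
    show "r \<notin> set Ns" "set Ns \<inter> T = {}" by (auto simp: Ns_iff)
    show "r \<notin> T" using terminals by blast
    show "set Bs \<subseteq> T" by (auto simp: Bs_iff)
    show "\<not> Z r b" if "b \<in> set Bs" for b using that by (simp add: Bs_iff)
    show "0 < high_deg h" by (rule high_deg_pos)
    show "\<exists>b\<in>F. card {x\<in>N. Z x b} < h" if "F \<subseteq> set Bs" "N \<subseteq> set Ns" "N \<noteq> {}" "\<And>x. x \<in> N \<Longrightarrow> high_deg h \<le> card {b\<in>F. Z x b}" for F N
      by (rule sparse_sources[OF nl that(1,2,3,4)])
  qed
  show ?thesis unfolding solve_def search_correct dst_solvable_iff_via[OF d] steiner_def by blast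
qed

text \<open>Without budget only the root can dominate, and it dominates no representative. The
  separate program for budget \<open>0\<close> rests on this test.\<close>

lemma dst_solvable_0: "dst_instance n D r T \<Longrightarrow> dst_solvable D r T 0 \<longleftrightarrow> source_reps (parcs D) T r n = []"
proof -
  assume d: "dst_instance n D r T"
  interpret terminal_digraph n "parcs D" r T using d by (rule terminal_digraph_instance)
  have "S = {}" if "S \<subseteq> set Ns" "card S \<le> 0" for S using that finite_subset by fastforce
  moreover have "via Z {} = {}" by (auto simp: via_def)
  moreover have "\<not> Z r b" if "b \<in> set Bs" for b using that by (simp add: Bs_iff)
  moreover have "(\<forall>b\<in>set Bs. False) \<longleftrightarrow> Bs = []" by simp
  ultimately show ?thesis unfolding dst_solvable_iff_via[OF d]
    by (metis (no_types, lifting) card.empty empty_subsetI le_refl list.set_intros(1) neq_Nil_conv rtrancl_empty pair_in_Id_conv empty_iff list.set(1))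
qed

text \<open>\<open>k\<close> is given in binary and may be exponential in the input size, so the
  program counts up to the minimum instead.\<close>

lemma dst_solvable_min:
  assumes d: "dst_instance n D r T"
  shows "dst_solvable D r T (min k n) \<longleftrightarrow> dst_solvable D r T k"
proof -
  have "card S \<le> n" if "S \<subseteq> set (nonterminals T r n)" for S
  proof -
    have "S \<subseteq> {..<n}" using that by (auto simp: nonterminals_def)
    then show ?thesis using card_mono[of "{..<n}" S] by simp
  qed
  then show ?thesis unfolding dst_solvable_iff_via[OF d] by auto
qed

section \<open>Loop expressions, their cost and their compilation\<close>

section \<open>A language with bounded loops\<close>

text \<open>Loops run over the right spine of a value. All running times are polynomial in a bound \<open>M\<close> on the
  lengths of these spines, whence no cost semantics is needed.\<close>

datatype hexpr =
    HVar nat (\<open>$_\<close> [1000] 1000)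
  | HLeaf
  | HNode hexpr hexpr
  | HLeft hexpr
  | HRight hexpr
  | HIf hexpr hexpr hexpr
  | HCall hexpr "hexpr list"
  | HFold hexpr hexpr hexpr

fun vlist :: "val \<Rightarrow> val list" where
  "vlist Leaf = []"
| "vlist (Node x xs) = x # vlist xs"

primrec sem :: "val list \<Rightarrow> hexpr \<Rightarrow> val" where
  "sem env (HVar i) = env ! i"
| "sem env HLeaf = Leaf"
| "sem env (HNode a b) = Node (sem env a) (sem env b)"
| "sem env (HLeft a) = left (sem env a)"
| "sem env (HRight a) = right (sem env a)"
| "sem env (HIf c a b) = (if sem env c = Leaf then sem env b else sem env a)"
| "sem env (HCall b as) = sem (map (\<lambda>a. sem env a) as) b"
| "sem env (HFold l i b) = fold (\<lambda>x acc. sem (env @ [x, acc]) b) (vlist (sem env l)) (sem env i)"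

text \<open>Restricts only what is really evaluated: the branch taken and the accumulator values
  that occur. Loop lengths are all that has to be bounded, as no other cost depends on the size of
  values.\<close>

fun fits :: "nat \<Rightarrow> val list \<Rightarrow> hexpr \<Rightarrow> bool" where
  "fits M env (HVar i) = (i < length env)"
| "fits M env HLeaf = True"
| "fits M env (HNode a b) = (fits M env a \<and> fits M env b)"
| "fits M env (HLeft a) = fits M env a"
| "fits M env (HRight a) = fits M env a"
| "fits M env (HIf c a b) = (fits M env c \<and> (if sem env c = Leaf then fits M env b else fits M env a))"
| "fits M env (HCall b as) = ((\<forall>a\<in>set as. fits M env a) \<and> fits M (map (sem env) as) b)"
| "fits M env (HFold l i b) = (fits M env l \<and> fits M env i \<and> length (vlist (sem env l)) \<le> M \<and>
     (\<forall>ys x zs. vlist (sem env l) = ys @ x # zs \<longrightarrow>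
        fits M (env @ [x, fold (\<lambda>x acc. sem (env @ [x, acc]) b) ys (sem env i)]) b))"

text \<open>In a loop, \<open>M + 1\<close> includes the final test on the empty list, and
  \<open>2 * n\<close> is the price of passing the variables in scope to the body and to the next
  round.\<close>

fun bnd :: "hexpr \<Rightarrow> nat \<Rightarrow> nat \<Rightarrow> nat" where
  "bnd (HVar i) n M = 1"
| "bnd HLeaf n M = 1"
| "bnd (HNode a b) n M = bnd a n M + bnd b n M + 1"
| "bnd (HLeft a) n M = bnd a n M + 1"
| "bnd (HRight a) n M = bnd a n M + 1"
| "bnd (HIf c a b) n M = bnd c n M + bnd a n M + bnd b n M + 1"
| "bnd (HCall b as) n M = sum_list (map (\<lambda>a. bnd a n M) as) + bnd b (length as) M + 1"
| "bnd (HFold l i b) n M = bnd l n M + bnd i n M + n + 1 + (M + 1) * (bnd b (n + 2) M + 2 * n + 10)"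

definition polybounded :: "(nat \<Rightarrow> nat) \<Rightarrow> bool" where
  "polybounded f \<longleftrightarrow> (\<exists>K d. \<forall>M. f M \<le> K * (M + 1) ^ d)"

lemma polybounded_const: "polybounded (\<lambda>M. c)"
  unfolding polybounded_def by (rule exI[of _ c], rule exI[of _ 0]) simp

lemma polybounded_Suc: "polybounded (\<lambda>M. M + 1)"
  unfolding polybounded_def by (rule exI[of _ 1], rule exI[of _ 1]) simp

lemma polybounded_add:
  assumes "polybounded f" "polybounded g" shows "polybounded (\<lambda>M. f M + g M)"
proof -
  obtain K d K' d' where f: "\<And>M. f M \<le> K * (M + 1) ^ d" and g: "\<And>M. g M \<le> K' * (M + 1) ^ d'"
    using assms by (auto simp: polybounded_def)
  have "f M + g M \<le> (K + K') * (M + 1) ^ (d + d')" for M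
  proof -
    have "K * (M + 1) ^ d \<le> K * (M + 1) ^ (d + d')" "K' * (M + 1) ^ d' \<le> K' * (M + 1) ^ (d + d')"
      by (intro mult_le_mono2 power_increasing; simp)+
    then show ?thesis using f[of M] g[of M] by (simp only: distrib_right)
  qed
  then show ?thesis unfolding polybounded_def by blast
qed

lemma polybounded_mult:
  assumes "polybounded f" "polybounded g" shows "polybounded (\<lambda>M. f M * g M)"
proof -
  obtain K d K' d' where f: "\<And>M. f M \<le> K * (M + 1) ^ d" and g: "\<And>M. g M \<le> K' * (M + 1) ^ d'"
    using assms by (auto simp: polybounded_def)
  have "f M * g M \<le> (K * K') * (M + 1) ^ (d + d')" for M
    using mult_le_mono[OF f[of M] g[of M]] by (simp only: power_add mult_ac)
  then show ?thesis unfolding polybounded_def by blast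
qed

lemma polybounded_sum_list:
  "(\<And>a. a \<in> set as \<Longrightarrow> polybounded (f a)) \<Longrightarrow> polybounded (\<lambda>M. sum_list (map (\<lambda>a. f a M) as))"
  by (induction as) (auto intro: polybounded_add polybounded_const)

lemma bnd_abs:
  "bnd (HVar j) n = (\<lambda>M. 1)"
  "bnd HLeaf n = (\<lambda>M. 1)"
  "bnd (HNode a b) n = (\<lambda>M. bnd a n M + bnd b n M + 1)"
  "bnd (HLeft a) n = (\<lambda>M. bnd a n M + 1)"
  "bnd (HRight a) n = (\<lambda>M. bnd a n M + 1)"
  "bnd (HIf c a b) n = (\<lambda>M. bnd c n M + bnd a n M + bnd b n M + 1)"
  "bnd (HCall b as) n = (\<lambda>M. sum_list (map (\<lambda>a. bnd a n M) as) + bnd b (length as) M + 1)"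
  "bnd (HFold l i b) n = (\<lambda>M. bnd l n M + bnd i n M + n + 1 + (M + 1) * (bnd b (n + 2) M + 2 * n + 10))"
  by auto

lemma polybounded_bnd: "polybounded (bnd e n)"
proof (induction e arbitrary: n)
  case (HCall b as)
  show ?case unfolding bnd_abs
    by (intro polybounded_add polybounded_sum_list polybounded_const HCall.IH)
next
  case (HFold l i b)
  show ?case unfolding bnd_abs
    by (intro polybounded_add polybounded_mult polybounded_Suc polybounded_const HFold.IH)
qed (unfold bnd_abs, (intro polybounded_add polybounded_const; assumption?)+)

text \<open>The code depends only on the length of the program in front of it, so that the entry point, which
  has to come first, may refer to code that follows.\<close>

definition compiled :: "nat \<Rightarrow> nat \<Rightarrow> hexpr \<Rightarrow> expr \<Rightarrow> expr list \<Rightarrow> bool" where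
  "compiled l n e e' fs \<longleftrightarrow> (\<forall>P ext env M. length P = l \<longrightarrow> length env = n \<longrightarrow> fits M env e \<longrightarrow>
     (\<exists>t\<le>bnd e n M. eval (P @ fs @ ext) env e' (sem env e) t))"

lemma compiledI:
  "(\<And>P ext env M. length P = l \<Longrightarrow> length env = n \<Longrightarrow> fits M env e \<Longrightarrow>
     \<exists>t\<le>bnd e n M. eval (P @ fs @ ext) env e' (sem env e) t) \<Longrightarrow> compiled l n e e' fs"
  unfolding compiled_def by blast

lemma compiledD:
  "compiled l n e e' fs \<Longrightarrow> length P = l \<Longrightarrow> length env = n \<Longrightarrow> fits M env e \<Longrightarrow>
     \<exists>t\<le>bnd e n M. eval (P @ fs @ ext) env e' (sem env e) t"
  unfolding compiled_def by blast

lemma evals_append: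
  assumes "evals P env es vs s" "evals P env es' vs' s'"
  shows "evals P env (es @ es') (vs @ vs') (s + s')"
  using assms(1)
proof (induction es arbitrary: vs s)
  case Nil then show ?case using assms(2) by (auto elim: evals_NilE)
next
  case (Cons e es)
  from Cons.prems obtain v w p q where "vs = v # w" "s = p + q" "eval P env e v p" "evals P env es w q"
    by (auto elim: evals_ConsE)
  then show ?case using Cons.IH[of w q] evals_Cons[of P env e v p "es @ es'" "w @ vs'" "q + s'"] by (simp add: add.assoc)
qed

lemma evals_vars: "n \<le> length env \<Longrightarrow> evals P env (map EVar [0..<n]) (take n env) n"
proof (induction n)
  case 0 then show ?case by (simp add: evals_Nil)
next
  case (Suc n)
  have "evals P env [EVar n] [env ! n] (1 + 0)" using Suc.prems by (intro evals_Cons eval_var evals_Nil) simp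
  then have "evals P env (map EVar [0..<n] @ [EVar n]) (take n env @ [env ! n]) (n + (1 + 0))"
    using Suc by (intro evals_append) simp_all
  then show ?case using Suc.prems by (simp add: take_Suc_conv_app_nth)
qed

lemma evals_vars2:
  assumes "eval P env a v s" "eval P env b w t" "n \<le> length env"
  shows "evals P env (map EVar [0..<n] @ [a, b]) (take n env @ [v, w]) (n + (s + t))"
proof -
  have "evals P env [a, b] [v, w] (s + (t + 0))" using assms by (intro evals_Cons evals_Nil)
  then show ?thesis using evals_append[OF evals_vars[OF assms(3)]] by fastforce
qed

lemma compiled_args:
  assumes "\<And>a l. a \<in> set as \<Longrightarrow> \<exists>e fs. compiled l n a e fs"
  shows "\<exists>es fs. \<forall>P ext env M. length P = l \<longrightarrow> length env = n \<longrightarrow> (\<forall>a\<in>set as. fits M env a) \<longrightarrow>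
     (\<exists>t\<le>sum_list (map (\<lambda>a. bnd a n M) as). evals (P @ fs @ ext) env es (map (sem env) as) t)"
  using assms
proof (induction as arbitrary: l)
  case Nil
  show ?case by (rule exI[of _ "[]"], rule exI[of _ "[]"]) (auto intro: evals_Nil)
next
  case (Cons a as)
  obtain e fs where e: "compiled l n a e fs" using Cons.prems by (meson list.set_intros(1))
  obtain es gs where es: "\<And>P ext env M. length P = l + length fs \<Longrightarrow> length env = n \<Longrightarrow> \<forall>a\<in>set as. fits M env a \<Longrightarrow>
     \<exists>t\<le>sum_list (map (\<lambda>a. bnd a n M) as). evals (P @ gs @ ext) env es (map (sem env) as) t"
    using Cons.IH[of "l + length fs"] Cons.prems by (meson list.set_intros(2))
  show ?case
  proof (rule exI[of _ "e # es"], rule exI[of _ "fs @ gs"], intro allI impI)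
    fix P ext :: program and env :: "val list" and M
    assume l: "length P = l" and h: "length env = n" "\<forall>a\<in>set (a # as). fits M env a"
    then have "fits M env a" by simp
    then obtain t where t: "t \<le> bnd a n M" "eval (P @ fs @ (gs @ ext)) env e (sem env a) t" using compiledD[OF e l h(1)] by blast
    obtain s where s: "s \<le> sum_list (map (\<lambda>a. bnd a n M) as)" "evals ((P @ fs) @ gs @ ext) env es (map (sem env) as) s"
      using es[of "P @ fs" env M ext] l h by auto
    have "evals (P @ (fs @ gs) @ ext) env (e # es) (map (sem env) (a # as)) (t + s)"
      using t(2) s(2) by (simp add: evals_Cons)
    then show "\<exists>t\<le>sum_list (map (\<lambda>a. bnd a n M) (a # as)). evals (P @ (fs @ gs) @ ext) env (e # es) (map (sem env) (a # as)) t"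
      using t(1) s(1) by (intro exI[of _ "t + s"]) simp
  qed
qed

text \<open>Variable \<open>n\<close> holds the rest of the list and \<open>Suc n\<close> the
  accumulator; \<open>g\<close> is the body, and \<open>f\<close> calls itself on the tail. The body
  is assumed to work only on accumulators that occur, which is what \<open>fits\<close>
  provides.\<close>

lemma eval_fold_loop:
  fixes env :: "val list"
  assumes n: "length env = n"
    and f: "f < length P" "P ! f = EIf (EVar n) (ECall f (map EVar [0..<n] @ [ERight (EVar n),
        ECall g (map EVar [0..<n] @ [ELeft (EVar n), EVar (Suc n)])])) (EVar (Suc n))"
    and g: "g < length P"
    and body: "\<And>ys x zs. vlist l = ys @ x # zs \<Longrightarrow>
      \<exists>t\<le>B. eval P (env @ [x, fold F ys a]) (P ! g) (F x (fold F ys a)) t"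
  shows "\<exists>t\<le>(length (vlist l) + 1) * (B + 2 * n + 10). eval P (env @ [l, a]) (P ! f) (fold F (vlist l) a) t"
  using body
proof (induction l arbitrary: a)
  case Leaf
  have "eval P (env @ [Leaf, a]) (EVar n) Leaf 1" using n eval_var[of n "env @ [Leaf, a]" P] by (simp add: nth_append)
  moreover have "eval P (env @ [Leaf, a]) (EVar (Suc n)) a 1" using n eval_var[of "Suc n" "env @ [Leaf, a]" P] by (simp add: nth_append)
  ultimately have "eval P (env @ [Leaf, a]) (P ! f) a (1 + 1 + 1)" unfolding f(2) by (rule eval_if_leaf)
  then show ?case by (intro exI[of _ "1 + 1 + 1"]) simp
next
  case (Node x l)
  let ?env = "env @ [Node x l, a]"
  have v1: "eval P ?env (EVar n) (Node x l) 1" using n eval_var[of n ?env P] by (simp add: nth_append)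
  have v2: "eval P ?env (EVar (Suc n)) a 1" using n eval_var[of "Suc n" ?env P] by (simp add: nth_append)
  obtain t where t: "t \<le> B" "eval P (env @ [x, a]) (P ! g) (F x a) t"
    using Node.prems[of "[]" x "vlist l"] by auto
  have "eval P ?env (ELeft (EVar n)) x (1 + 1)" using eval_left[OF v1] by simp
  then have "evals P ?env (map EVar [0..<n] @ [ELeft (EVar n), EVar (Suc n)]) (env @ [x, a]) (n + (1 + 1 + 1))"
    using evals_vars2[OF _ v2, of _ _ _ n] n by fastforce
  then have c: "eval P ?env (ECall g (map EVar [0..<n] @ [ELeft (EVar n), EVar (Suc n)])) (F x a) ((n + (1 + 1 + 1)) + t + 1)"
    using t(2) by (rule eval_call[OF g])
  have "eval P ?env (ERight (EVar n)) l (1 + 1)" using eval_right[OF v1] by simp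
  then have args: "evals P ?env (map EVar [0..<n] @ [ERight (EVar n), ECall g (map EVar [0..<n] @ [ELeft (EVar n), EVar (Suc n)])])
      (env @ [l, F x a]) (n + (1 + 1 + ((n + (1 + 1 + 1)) + t + 1)))"
    using evals_vars2[OF _ c, of _ _ _ n] n by fastforce
  have "\<exists>t\<le>B. eval P (env @ [y, fold F ys (F x a)]) (P ! g) (F y (fold F ys (F x a))) t" if "vlist l = ys @ y # zs" for ys y zs
    using Node.prems[of "x # ys" y zs] that by simp
  then obtain s where s: "s \<le> (length (vlist l) + 1) * (B + 2 * n + 10)"
    "eval P (env @ [l, F x a]) (P ! f) (fold F (vlist l) (F x a)) s"
    using Node.IH(2) by blast
  have "eval P ?env (P ! f) (fold F (vlist l) (F x a)) (1 + ((n + (1 + 1 + ((n + (1 + 1 + 1)) + t + 1))) + s + 1) + 1)"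
    unfolding f(2) by (rule eval_if_node[OF v1 eval_call[OF f(1) args s(2)]])
  moreover have "1 + ((n + (1 + 1 + ((n + (1 + 1 + 1)) + t + 1))) + s + 1) + 1 \<le> (length (vlist (Node x l)) + 1) * (B + 2 * n + 10)"
    using s(1) t(1) by simp
  ultimately show ?case by fastforce
qed

lemma compiled_node:
  assumes a: "compiled l n a a' fs" and b: "compiled (l + length fs) n b b' gs"
  shows "compiled l n (HNode a b) (ENode a' b') (fs @ gs)"
proof (rule compiledI)
  fix P ext :: program and env M assume h: "length P = l" "length env = n" "fits M env (HNode a b)"
  obtain s where s: "s \<le> bnd a n M" "eval (P @ fs @ (gs @ ext)) env a' (sem env a) s"
    using compiledD[OF a h(1,2), of M "gs @ ext"] h(3) by auto
  obtain t where t: "t \<le> bnd b n M" "eval ((P @ fs) @ gs @ ext) env b' (sem env b) t"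
    using compiledD[OF b, of "P @ fs" env M ext] h by auto
  show "\<exists>t\<le>bnd (HNode a b) n M. eval (P @ (fs @ gs) @ ext) env (ENode a' b') (sem env (HNode a b)) t"
    using s t by (intro exI[of _ "s + t + 1"]) (simp add: eval_node[simplified])
qed

lemma compiled_left:
  assumes "compiled l n a a' fs" shows "compiled l n (HLeft a) (ELeft a') fs"
proof (rule compiledI)
  fix P ext :: program and env M assume h: "length P = l" "length env = n" "fits M env (HLeft a)"
  obtain t where t: "t \<le> bnd a n M" "eval (P @ fs @ ext) env a' (sem env a) t"
    using compiledD[OF assms h(1,2), of M ext] h(3) by auto
  show "\<exists>t\<le>bnd (HLeft a) n M. eval (P @ fs @ ext) env (ELeft a') (sem env (HLeft a)) t"
    using t(1) eval_left[OF t(2)] by (intro exI[of _ "t + 1"]) simp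
qed

lemma compiled_right:
  assumes "compiled l n a a' fs" shows "compiled l n (HRight a) (ERight a') fs"
proof (rule compiledI)
  fix P ext :: program and env M assume h: "length P = l" "length env = n" "fits M env (HRight a)"
  obtain t where t: "t \<le> bnd a n M" "eval (P @ fs @ ext) env a' (sem env a) t"
    using compiledD[OF assms h(1,2), of M ext] h(3) by auto
  show "\<exists>t\<le>bnd (HRight a) n M. eval (P @ fs @ ext) env (ERight a') (sem env (HRight a)) t"
    using t(1) eval_right[OF t(2)] by (intro exI[of _ "t + 1"]) simp
qed

lemma compiled_if:
  assumes c: "compiled l n c c' es" and a: "compiled (l + length es) n a a' fs" and b: "compiled (l + length es + length fs) n b b' gs"
  shows "compiled l n (HIf c a b) (EIf c' a' b') (es @ fs @ gs)"
proof (rule compiledI)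
  fix P ext :: program and env M assume h: "length P = l" "length env = n" "fits M env (HIf c a b)"
  let ?P = "P @ (es @ fs @ gs) @ ext"
  obtain s where s: "s \<le> bnd c n M" "eval (P @ es @ (fs @ gs @ ext)) env c' (sem env c) s"
    using compiledD[OF c h(1,2), of M "fs @ gs @ ext"] h(3) by auto
  show "\<exists>t\<le>bnd (HIf c a b) n M. eval ?P env (EIf c' a' b') (sem env (HIf c a b)) t"
  proof (cases "sem env c")
    case Leaf
    obtain t where t: "t \<le> bnd b n M" "eval ((P @ es @ fs) @ gs @ ext) env b' (sem env b) t"
      using compiledD[OF b, of "P @ es @ fs" env M ext] h Leaf by auto
    show ?thesis using s t Leaf eval_if_leaf[of ?P env c' s b' "sem env b" t a']
      by (intro exI[of _ "s + t + 1"]) simp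
  next
    case (Node x y)
    obtain t where t: "t \<le> bnd a n M" "eval ((P @ es) @ fs @ (gs @ ext)) env a' (sem env a) t"
      using compiledD[OF a, of "P @ es" env M "gs @ ext"] h Node by auto
    show ?thesis using s t Node eval_if_node[of ?P env c' x y s a' "sem env a" t b']
      by (intro exI[of _ "s + t + 1"]) simp
  qed
qed

lemma compiled_call:
  assumes a: "\<And>P ext env M. length P = l \<Longrightarrow> length env = n \<Longrightarrow> \<forall>a\<in>set as. fits M env a \<Longrightarrow>
      \<exists>t\<le>sum_list (map (\<lambda>a. bnd a n M) as). evals (P @ fs @ ext) env es (map (sem env) as) t"
    and b: "compiled (l + length fs) (length as) b b' gs"
  shows "compiled l n (HCall b as) (ECall (l + length fs + length gs) es) (fs @ gs @ [b'])"
proof (rule compiledI)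
  fix P ext :: program and env M assume h: "length P = l" "length env = n" "fits M env (HCall b as)"
  let ?P = "P @ (fs @ gs @ [b']) @ ext" and ?i = "l + length fs + length gs"
  obtain s where s: "s \<le> sum_list (map (\<lambda>a. bnd a n M) as)" "evals (P @ fs @ (gs @ [b'] @ ext)) env es (map (sem env) as) s"
    using a[OF h(1,2), of M "gs @ [b'] @ ext"] h(3) by auto
  obtain t where t: "t \<le> bnd b (length as) M" "eval ((P @ fs) @ gs @ ([b'] @ ext)) (map (sem env) as) b' (sem (map (sem env) as) b) t"
    using compiledD[OF b, of "P @ fs" "map (sem env) as" M "[b'] @ ext"] h by auto
  have i: "?i < length ?P" "?P ! ?i = b'" using h by (simp_all add: nth_append)
  have "eval ?P env (ECall ?i es) (sem (map (sem env) as) b) (s + t + 1)"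
    using s(2) t(2) i by (intro eval_call[OF i(1)]) simp_all
  then show "\<exists>t\<le>bnd (HCall b as) n M. eval ?P env (ECall ?i es) (sem env (HCall b as)) t"
    using s(1) t(1) by (intro exI[of _ "s + t + 1"]) simp
qed

text \<open>Two functions follow the code of the parts: the body at index \<open>g\<close> and the
  loop at \<open>Suc g\<close>, which calls the body and itself.\<close>

lemma compiled_fold:
  assumes a: "compiled l n a a' es" and i: "compiled (l + length es) n i i' fs"
    and b: "compiled (l + length es + length fs) (n + 2) b b' gs"
  defines "g \<equiv> l + length es + length fs + length gs"
  defines "loop \<equiv> EIf (EVar n) (ECall (Suc g) (map EVar [0..<n] @ [ERight (EVar n),
      ECall g (map EVar [0..<n] @ [ELeft (EVar n), EVar (Suc n)])])) (EVar (Suc n))"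
  shows "compiled l n (HFold a i b) (ECall (Suc g) (map EVar [0..<n] @ [a', i'])) (es @ fs @ gs @ [b', loop])"
proof (rule compiledI)
  fix P ext :: program and env M assume h: "length P = l" "length env = n" "fits M env (HFold a i b)"
  let ?P = "P @ (es @ fs @ gs @ [b', loop]) @ ext" and ?F = "\<lambda>x acc. sem (env @ [x, acc]) b"
  let ?B = "bnd b (n + 2) M" and ?l = "vlist (sem env a)"
  obtain s where s: "s \<le> bnd a n M" "eval (P @ es @ (fs @ gs @ [b', loop] @ ext)) env a' (sem env a) s"
    using compiledD[OF a h(1,2), of M "fs @ gs @ [b', loop] @ ext"] h(3) by auto
  obtain t where t: "t \<le> bnd i n M" "eval ((P @ es) @ fs @ (gs @ [b', loop] @ ext)) env i' (sem env i) t"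
    using compiledD[OF i, of "P @ es" env M "gs @ [b', loop] @ ext"] h by auto
  have f: "Suc g < length ?P" "?P ! Suc g = loop" and g: "g < length ?P" "?P ! g = b'"
    using h by (simp_all add: nth_append g_def)
  have body: "\<exists>t\<le>?B. eval ?P (env @ [x, fold ?F ys (sem env i)]) (?P ! g) (?F x (fold ?F ys (sem env i))) t"
    if "?l = ys @ x # zs" for ys x zs
  proof -
    let ?e = "env @ [x, fold ?F ys (sem env i)]"
    have "fits M ?e b" using h(3) that by simp
    then obtain t where "t \<le> ?B" "eval ((P @ es @ fs) @ gs @ ([b', loop] @ ext)) ?e b' (sem ?e b) t"
      using compiledD[OF b, of "P @ es @ fs" ?e M "[b', loop] @ ext"] h(1,2) by auto
    then show ?thesis unfolding g(2) by auto
  qed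
  have "\<exists>t\<le>(length ?l + 1) * (?B + 2 * n + 10). eval ?P (env @ [sem env a, sem env i]) (?P ! Suc g) (fold ?F ?l (sem env i)) t"
    by (rule eval_fold_loop[OF h(2) f(1) trans[OF f(2) meta_eq_to_obj_eq[OF loop_def]] g(1) body])
  then obtain u where u: "u \<le> (length ?l + 1) * (?B + 2 * n + 10)"
    "eval ?P (env @ [sem env a, sem env i]) (?P ! Suc g) (fold ?F ?l (sem env i)) u" by blast
  have "evals ?P env (map EVar [0..<n] @ [a', i']) (take n env @ [sem env a, sem env i]) (n + (s + t))"
    using s(2) t(2) h(2) by (intro evals_vars2) simp_all
  then have "eval ?P env (ECall (Suc g) (map EVar [0..<n] @ [a', i'])) (fold ?F ?l (sem env i)) (n + (s + t) + u + 1)"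
    using u(2) h(2) by (intro eval_call[OF f(1)]) simp_all
  moreover have "(length ?l + 1) * (?B + 2 * n + 10) \<le> (M + 1) * (?B + 2 * n + 10)"
    using h(3) by (intro mult_le_mono1) simp
  then have "n + (s + t) + u + 1 \<le> bnd (HFold a i b) n M" unfolding bnd.simps using s(1) t(1) u(1) by linarith
  ultimately show "\<exists>t\<le>bnd (HFold a i b) n M. eval ?P env (ECall (Suc g) (map EVar [0..<n] @ [a', i'])) (sem env (HFold a i b)) t"
    unfolding sem.simps by blast
qed

text \<open>Called functions are subterms of the caller, so structural induction covers calls;
  recursion occurs only in the generated loops.\<close>

lemma compiled_exists: "\<exists>e' fs. compiled l n e e' fs"
proof (induction e arbitrary: l n)
  case (HVar i)
  have "compiled l n (HVar i) (EVar i) []" by (rule compiledI) (auto intro: eval_var[simplified])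
  then show ?case by blast
next
  case HLeaf
  have "compiled l n HLeaf ELeaf []" by (rule compiledI) (auto intro: eval_leaf[simplified])
  then show ?case by blast
next
  case (HCall b as)
  then show ?case using compiled_args[of as n l] compiled_call by metis
qed (meson compiled_node compiled_left compiled_right compiled_if compiled_fold)+

section \<open>Evaluation rules for loop expressions on encoded data\<close>

section \<open>Program schemes\<close>

text \<open>Value and side condition in one judgement, whose rules follow the shape of programs:
  correctness and the loop bounds are established together.\<close>

definition runs :: "nat \<Rightarrow> val list \<Rightarrow> hexpr \<Rightarrow> val \<Rightarrow> bool" where
  "runs M env e v \<longleftrightarrow> fits M env e \<and> sem env e = v"

text \<open>Unary, so that a number doubles as a list to loop over and can be compared with the
  length of a list.\<close>

definition enc_nat :: "nat \<Rightarrow> val" where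
  "enc_nat m = enc_list (\<lambda>_. Leaf) (replicate m ())"

abbreviation "enc_nats \<equiv> enc_list enc_nat"

lemma vlist_enc_list [simp]: "vlist (enc_list f xs) = map f xs"
  by (induction xs) auto

lemma enc_list_vlist [simp]: "enc_list (\<lambda>x. x) (vlist v) = v"
  by (induction v) auto

lemma length_vlist_enc_nat [simp]: "length (vlist (enc_nat m)) = m"
  by (simp add: enc_nat_def)

lemma enc_nat_simps: "enc_nat 0 = Leaf" "enc_nat (Suc m) = Node Leaf (enc_nat m)"
  by (simp_all add: enc_nat_def)

lemma enc_nat_eq_Leaf [simp]: "enc_nat m = Leaf \<longleftrightarrow> m = 0"
  by (cases m) (simp_all add: enc_nat_simps)

lemma enc_list_eq_Leaf [simp]: "enc_list f xs = Leaf \<longleftrightarrow> xs = []"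
  by (cases xs) auto

lemma enc_bool_eq_Leaf [simp]: "enc_bool b = Leaf \<longleftrightarrow> \<not> b"
  by (cases b) auto

lemma runs_var: "i < length env \<Longrightarrow> env ! i = v \<Longrightarrow> runs M env (HVar i) v"
  by (simp add: runs_def)

lemma runs_leaf: "runs M env HLeaf Leaf"
  by (simp add: runs_def)

lemma runs_nil: "runs M env HLeaf (enc_list f [])"
  by (simp add: runs_def)

lemma runs_node: "runs M env a v \<Longrightarrow> runs M env b w \<Longrightarrow> runs M env (HNode a b) (Node v w)"
  by (simp add: runs_def)

lemma runs_cons: "runs M env a (f x) \<Longrightarrow> runs M env b (enc_list f xs) \<Longrightarrow> runs M env (HNode a b) (enc_list f (x # xs))"
  by (simp add: runs_def)

lemma runs_left: "runs M env a (Node v w) \<Longrightarrow> runs M env (HLeft a) v"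
  by (auto simp: runs_def)

lemma runs_right: "runs M env a (Node v w) \<Longrightarrow> runs M env (HRight a) w"
  by (auto simp: runs_def)

lemma runs_hd: "runs M env a (enc_nats xs) \<Longrightarrow> xs \<noteq> [] \<Longrightarrow> runs M env (HLeft a) (enc_nat (hd xs))"
  by (cases xs) (auto simp: runs_def)

lemma runs_if_list:
  "runs M env c (enc_list f xs) \<Longrightarrow> (xs \<noteq> [] \<Longrightarrow> runs M env a v) \<Longrightarrow> (xs = [] \<Longrightarrow> runs M env b v) \<Longrightarrow> runs M env (HIf c a b) v"
  by (auto simp: runs_def)

lemma runs_if: "runs M env c (enc_bool P) \<Longrightarrow> (P \<Longrightarrow> runs M env a v) \<Longrightarrow> (\<not> P \<Longrightarrow> runs M env b v) \<Longrightarrow> runs M env (HIf c a b) v"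
  by (auto simp: runs_def)

lemma runs_call1: "runs M env a v \<Longrightarrow> runs M [v] p w \<Longrightarrow> runs M env (HCall p [a]) w"
  by (simp add: runs_def)

lemma runs_call2: "runs M env a v \<Longrightarrow> runs M env b v' \<Longrightarrow> runs M [v, v'] p w \<Longrightarrow> runs M env (HCall p [a, b]) w"
  by (simp add: runs_def)

lemma runs_call3: "runs M env a v \<Longrightarrow> runs M env b v' \<Longrightarrow> runs M env c v'' \<Longrightarrow> runs M [v, v', v''] p w
  \<Longrightarrow> runs M env (HCall p [a, b, c]) w"
  by (simp add: runs_def)

lemma runs_call4: "runs M env a v \<Longrightarrow> runs M env b v' \<Longrightarrow> runs M env c v'' \<Longrightarrow> runs M env d v''' \<Longrightarrow> runs M [v, v', v'', v'''] p w
  \<Longrightarrow> runs M env (HCall p [a, b, c, d]) w"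
  by (simp add: runs_def)

lemma runs_call5: "runs M env a v \<Longrightarrow> runs M env b v' \<Longrightarrow> runs M env c v'' \<Longrightarrow> runs M env d v''' \<Longrightarrow> runs M env e v''''
  \<Longrightarrow> runs M [v, v', v'', v''', v''''] p w \<Longrightarrow> runs M env (HCall p [a, b, c, d, e]) w"
  by (simp add: runs_def)

text \<open>\<open>g\<close> encodes the accumulator, which relates the loop to a fold over HOL
  data; the body is checked only at values reached after a prefix of the list.\<close>

lemma runs_fold:
  assumes l: "runs M env l (enc_list f xs)" and i: "runs M env i (g a)" and len: "length xs \<le> M"
    and b: "\<And>ys x zs. xs = ys @ x # zs \<Longrightarrow> runs M (env @ [f x, g (fold s ys a)]) b (g (s x (fold s ys a)))"
  shows "runs M env (HFold l i b) (g (fold s xs a))"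
proof -
  let ?F = "\<lambda>x acc. sem (env @ [x, acc]) b"
  have pre: "fold ?F (map f ys) (g a) = g (fold s ys a)" if "xs = ys @ zs" for ys zs
    using that
  proof (induction ys arbitrary: zs rule: rev_induct)
    case (snoc y ys)
    then have "fold ?F (map f ys) (g a) = g (fold s ys a)" by simp
    moreover have "?F (f y) (g (fold s ys a)) = g (s y (fold s ys a))"
      using b[of ys y zs] snoc.prems by (simp add: runs_def)
    ultimately show ?case by simp
  qed simp
  have "fits M (env @ [x, fold ?F ys (g a)]) b" if eq: "map f xs = ys @ x # zs" for ys x zs
  proof -
    obtain ys' x' zs' where "xs = ys' @ x' # zs'" "ys = map f ys'" "x = f x'"
      using eq by (auto simp: map_eq_append_conv map_eq_Cons_conv)
    then show ?thesis using b pre[of ys' "x' # zs'"] by (simp add: runs_def)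
  qed
  moreover have "fold ?F (map f xs) (g a) = g (fold s xs a)" using pre[of xs "[]"] by simp
  ultimately show ?thesis using l i len unfolding runs_def fits.simps sem.simps by simp
qed

text \<open>The list serves as a counter; its elements do not influence the result.\<close>

lemma runs_iter:
  assumes l: "runs M env l w" "length (vlist w) = m" "m \<le> M" and i: "runs M env i (g a)"
    and b: "\<And>j x. j < m \<Longrightarrow> runs M (env @ [x, g ((s ^^ j) a)]) b (g (s ((s ^^ j) a)))"
  shows "runs M env (HFold l i b) (g ((s ^^ m) a))"
proof -
  have fp: "fold (\<lambda>_. s) xs a = (s ^^ length xs) a" for xs :: "val list"
    by (induction xs rule: rev_induct) auto
  have "runs M env (HFold l i b) (g (fold (\<lambda>_. s) (vlist w) a))"
  proof (rule runs_fold[where f = "\<lambda>x. x" and g = g and a = a and s = "\<lambda>_. s"])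
    show "runs M env i (g a)" by (rule i)
    show "runs M env l (enc_list (\<lambda>x. x) (vlist w))" using l by simp
    show "length (vlist w) \<le> M" using l by simp
    fix ys x zs assume "vlist w = ys @ x # zs"
    then have "length ys < m" using l(2) by simp
    then show "runs M (env @ [x, g (fold (\<lambda>_. s) ys a)]) b (g (s (fold (\<lambda>_. s) ys a)))" unfolding fp by (rule b)
  qed
  then show ?thesis unfolding fp l(2) .
qed

definition HTrue :: hexpr where "HTrue = HNode HLeaf HLeaf"
definition HNot :: "hexpr \<Rightarrow> hexpr" where "HNot a = HIf a HLeaf HTrue"
definition HAnd :: "hexpr \<Rightarrow> hexpr \<Rightarrow> hexpr" where "HAnd a b = HIf a b HLeaf"
definition HOr :: "hexpr \<Rightarrow> hexpr \<Rightarrow> hexpr" where "HOr a b = HIf a HTrue b"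
definition HIff :: "hexpr \<Rightarrow> hexpr \<Rightarrow> hexpr" where "HIff a b = HIf a b (HNot b)"
definition HNonempty :: "hexpr \<Rightarrow> hexpr" where "HNonempty a = HIf a HTrue HLeaf"

lemma runs_true: "runs M env HTrue (enc_bool True)"
  by (simp add: runs_def HTrue_def)

lemma runs_not: "runs M env a (enc_bool P) \<Longrightarrow> runs M env (HNot a) (enc_bool (\<not> P))"
  by (auto simp: runs_def HNot_def HTrue_def)

lemma runs_and: "runs M env a (enc_bool P) \<Longrightarrow> (P \<Longrightarrow> runs M env b (enc_bool Q)) \<Longrightarrow> runs M env (HAnd a b) (enc_bool (P \<and> Q))"
  by (auto simp: runs_def HAnd_def)

lemma runs_or: "runs M env a (enc_bool P) \<Longrightarrow> (\<not> P \<Longrightarrow> runs M env b (enc_bool Q)) \<Longrightarrow> runs M env (HOr a b) (enc_bool (P \<or> Q))"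
  by (auto simp: runs_def HOr_def HTrue_def)

lemma runs_imp: "runs M env a (enc_bool P) \<Longrightarrow> (P \<Longrightarrow> runs M env b (enc_bool Q)) \<Longrightarrow> runs M env (HOr (HNot a) b) (enc_bool (P \<longrightarrow> Q))"
  by (auto simp: runs_def HOr_def HTrue_def HNot_def)

lemma runs_iff: "runs M env a (enc_bool P) \<Longrightarrow> runs M env b (enc_bool Q) \<Longrightarrow> runs M env (HIff a b) (enc_bool (P \<longleftrightarrow> Q))"
  by (cases P; cases Q) (auto simp: runs_def HIff_def HNot_def HTrue_def)

lemma runs_nonempty: "runs M env a (enc_list f xs) \<Longrightarrow> runs M env (HNonempty a) (enc_bool (xs \<noteq> []))"
  by (auto simp: runs_def HNonempty_def HTrue_def)

lemma runs_is_zero: "runs M env a (enc_nat m) \<Longrightarrow> runs M env (HNot a) (enc_bool (m = 0))"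
  by (auto simp: runs_def HNot_def HTrue_def)

text \<open>In the following abbreviations \<open>n\<close> is the number of variables in scope; a loop body sees the
  current element as variable \<open>n\<close> and the accumulator as variable \<open>Suc n\<close>.\<close>

definition HRev :: "nat \<Rightarrow> hexpr \<Rightarrow> hexpr" where
  "HRev n l = HFold l HLeaf (HNode (HVar n) (HVar (Suc n)))"
definition HMap :: "nat \<Rightarrow> hexpr \<Rightarrow> hexpr \<Rightarrow> hexpr" where
  "HMap n l e = HFold (HRev n l) HLeaf (HNode e (HVar (Suc n)))"
definition HFilter :: "nat \<Rightarrow> hexpr \<Rightarrow> hexpr \<Rightarrow> hexpr" where
  "HFilter n l p = HFold (HRev n l) HLeaf (HIf p (HNode (HVar n) (HVar (Suc n))) (HVar (Suc n)))"
definition HAppend :: "nat \<Rightarrow> hexpr \<Rightarrow> hexpr \<Rightarrow> hexpr" where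
  "HAppend n a b = HFold (HRev n a) b (HNode (HVar n) (HVar (Suc n)))"
definition HConcatMap :: "nat \<Rightarrow> hexpr \<Rightarrow> hexpr \<Rightarrow> hexpr" where
  "HConcatMap n l e = HFold (HRev n l) HLeaf (HAppend (n + 2) e (HVar (Suc n)))"
definition HEx :: "nat \<Rightarrow> hexpr \<Rightarrow> hexpr \<Rightarrow> hexpr" where
  "HEx n l p = HFold l HLeaf (HIf p HTrue (HVar (Suc n)))"
definition HAll :: "nat \<Rightarrow> hexpr \<Rightarrow> hexpr \<Rightarrow> hexpr" where
  "HAll n l p = HNot (HEx n l (HNot p))"
definition HDrop :: "nat \<Rightarrow> hexpr \<Rightarrow> hexpr \<Rightarrow> hexpr" where
  "HDrop n a b = HFold a b (HRight (HVar (Suc n)))"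
definition HLt :: "nat \<Rightarrow> hexpr \<Rightarrow> hexpr \<Rightarrow> hexpr" where
  "HLt n a b = HNonempty (HDrop n a b)"
definition HEq :: "nat \<Rightarrow> hexpr \<Rightarrow> hexpr \<Rightarrow> hexpr" where
  "HEq n a b = HNot (HOr (HLt n a b) (HLt n b a))"

lemma runs_rev:
  assumes "runs M env l (enc_list f xs)" "n = length env" "length xs \<le> M"
  shows "runs M env (HRev n l) (enc_list f (rev xs))"
proof -
  have "runs M env (HRev n l) (enc_list f (fold (#) xs []))"
    unfolding HRev_def using assms
    by (intro runs_fold[OF assms(1)] runs_cons runs_var runs_nil) (auto simp: nth_append)
  then show ?thesis by (simp add: rev_conv_fold)
qed

text \<open>Loops are left folds. Reversing the list beforehand gives right folds, which preserve
  the order in maps, filters and concatenations.\<close>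

lemma runs_foldr:
  assumes "runs M env l (enc_list f xs)" "runs M env i (g a)" "length xs \<le> M" "n = length env"
    and b: "\<And>ys x zs. xs = ys @ x # zs \<Longrightarrow> runs M (env @ [f x, g (foldr s zs a)]) b (g (s x (foldr s zs a)))"
  shows "runs M env (HFold (HRev n l) i b) (g (foldr s xs a))"
proof -
  have "runs M env (HFold (HRev n l) i b) (g (fold s (rev xs) a))"
  proof (rule runs_fold[where f = f and g = g and a = a and s = s])
    show "runs M env (HRev n l) (enc_list f (rev xs))" by (rule runs_rev[OF assms(1,4,3)])
    show "runs M env i (g a)" by (rule assms(2))
    fix ys x zs assume "rev xs = ys @ x # zs"
    then have "xs = rev zs @ x # rev ys" by (metis append.assoc append_Cons append_Nil rev.simps(2) rev_append rev_rev_ident)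
    then show "runs M (env @ [f x, g (fold s ys a)]) b (g (s x (fold s ys a)))"
      using b[of "rev zs" x "rev ys"] by (simp add: foldr_conv_fold)
  qed (use assms in simp)
  then show ?thesis by (simp add: foldr_conv_fold)
qed

lemma runs_map:
  assumes "runs M env l (enc_list f xs)" "n = length env" "length xs \<le> M"
    and "\<And>x acc. x \<in> set xs \<Longrightarrow> runs M (env @ [f x, acc]) e (f' (g x))"
  shows "runs M env (HMap n l e) (enc_list f' (map g xs))"
proof -
  have "runs M env (HMap n l e) (enc_list f' (foldr (\<lambda>x acc. g x # acc) xs []))"
    unfolding HMap_def using assms
    by (intro runs_foldr[OF assms(1)] runs_cons runs_var runs_nil) (auto simp: nth_append)
  moreover have "foldr (\<lambda>x acc. g x # acc) xs [] = map g xs" by (induction xs) auto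
  ultimately show ?thesis by simp
qed

lemma runs_filter:
  assumes "runs M env l (enc_list f xs)" "n = length env" "length xs \<le> M"
    and "\<And>x acc. x \<in> set xs \<Longrightarrow> runs M (env @ [f x, acc]) p (enc_bool (P x))"
  shows "runs M env (HFilter n l p) (enc_list f (filter P xs))"
proof -
  have "runs M env (HFilter n l p) (enc_list f (foldr (\<lambda>x acc. if P x then x # acc else acc) xs []))"
    unfolding HFilter_def
  proof (rule runs_foldr[OF assms(1)])
    fix ys x zs assume xs: "xs = ys @ x # zs"
    let ?acc = "foldr (\<lambda>x acc. if P x then x # acc else acc) zs []"
    show "runs M (env @ [f x, enc_list f ?acc]) (HIf p (HNode (HVar n) (HVar (Suc n))) (HVar (Suc n)))
        (enc_list f (if P x then x # ?acc else ?acc))"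
    proof (rule runs_if[OF assms(4)])
      show "x \<in> set xs" using xs by simp
    qed (use assms(2) in \<open>auto intro!: runs_node runs_var simp: nth_append\<close>)
  qed (use assms in \<open>simp_all add: runs_leaf\<close>)
  moreover have "foldr (\<lambda>x acc. if P x then x # acc else acc) xs [] = filter P xs" by (induction xs) auto
  ultimately show ?thesis by simp
qed

lemma runs_append:
  assumes "runs M env a (enc_list f xs)" "runs M env b (enc_list f ys)" "n = length env" "length xs \<le> M"
  shows "runs M env (HAppend n a b) (enc_list f (xs @ ys))"
proof -
  have "runs M env (HAppend n a b) (enc_list f (foldr (#) xs ys))"
    unfolding HAppend_def using assms
    by (intro runs_foldr[OF assms(1)] runs_cons runs_var) (auto simp: nth_append)
  moreover have "foldr (#) xs ys = xs @ ys" by (induction xs) auto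
  ultimately show ?thesis by simp
qed

lemma runs_concat_map:
  assumes "runs M env l (enc_list f xs)" "n = length env" "length xs \<le> M"
    and "\<And>x acc. x \<in> set xs \<Longrightarrow> runs M (env @ [f x, acc]) e (enc_list f' (g x))" "\<And>x. x \<in> set xs \<Longrightarrow> length (g x) \<le> M"
  shows "runs M env (HConcatMap n l e) (enc_list f' (concat (map g xs)))"
proof -
  have "runs M env (HConcatMap n l e) (enc_list f' (foldr (\<lambda>x acc. g x @ acc) xs []))"
    unfolding HConcatMap_def using assms
    by (intro runs_foldr[OF assms(1)] runs_append runs_var runs_nil) (auto simp: nth_append)
  moreover have "foldr (\<lambda>x acc. g x @ acc) xs [] = concat (map g xs)" by (induction xs) auto
  ultimately show ?thesis by simp
qed

lemma runs_ex:
  assumes "runs M env l (enc_list f xs)" "n = length env" "length xs \<le> M"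
    and "\<And>x acc. x \<in> set xs \<Longrightarrow> runs M (env @ [f x, acc]) p (enc_bool (P x))"
  shows "runs M env (HEx n l p) (enc_bool (\<exists>x\<in>set xs. P x))"
proof -
  have "runs M env (HEx n l p) (enc_bool (fold (\<lambda>x acc. P x \<or> acc) xs False))"
    unfolding HEx_def
  proof (rule runs_fold[OF assms(1)])
    fix ys x zs assume xs: "xs = ys @ x # zs"
    let ?acc = "fold (\<lambda>x acc. P x \<or> acc) ys False"
    show "runs M (env @ [f x, enc_bool ?acc]) (HIf p HTrue (HVar (Suc n))) (enc_bool (P x \<or> ?acc))"
    proof (rule runs_if[OF assms(4)])
      show "x \<in> set xs" using xs by simp
      assume "P x" then show "runs M (env @ [f x, enc_bool ?acc]) HTrue (enc_bool (P x \<or> ?acc))" using runs_true by simp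
    qed (use assms(2) in \<open>auto intro!: runs_var simp: nth_append\<close>)
  qed (use assms in \<open>simp_all add: runs_def\<close>)
  moreover have "fold (\<lambda>x acc. P x \<or> acc) xs b = ((\<exists>x\<in>set xs. P x) \<or> b)" for b by (induction xs arbitrary: b) auto
  ultimately show ?thesis by simp
qed

lemma runs_all:
  assumes "runs M env l (enc_list f xs)" "n = length env" "length xs \<le> M"
    and "\<And>x acc. x \<in> set xs \<Longrightarrow> runs M (env @ [f x, acc]) p (enc_bool (P x))"
  shows "runs M env (HAll n l p) (enc_bool (\<forall>x\<in>set xs. P x))"
proof -
  have "runs M env (HAll n l p) (enc_bool (\<not> (\<exists>x\<in>set xs. \<not> P x)))"
    unfolding HAll_def using assms by (intro runs_not runs_ex) auto
  then show ?thesis by simp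
qed

lemma vlist_drop: "vlist ((right ^^ m) v) = drop m (vlist v)"
proof (induction m arbitrary: v)
  case (Suc m)
  have "vlist (right w) = tl (vlist w)" for w by (cases w) auto
  then show ?case using Suc by (simp add: drop_Suc tl_drop)
qed simp

lemma runs_drop:
  assumes "runs M env a u" "runs M env b w" "n = length env" "length (vlist u) \<le> M"
  shows "runs M env (HDrop n a b) ((right ^^ length (vlist u)) w)"
  unfolding HDrop_def
proof (rule runs_iter[where g = "\<lambda>x. x", OF assms(1) refl assms(4) assms(2)])
  fix j x show "runs M (env @ [x, (right ^^ j) w]) (HRight (HVar (Suc n))) (right ((right ^^ j) w))"
    using assms(3) by (simp add: runs_def nth_append)
qed

lemma runs_nth:
  assumes "runs M env a (enc_nat j)" "runs M env b (enc_list f xs)" "n = length env" "j \<le> M" "j < length xs"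
  shows "runs M env (HLeft (HDrop n a b)) (f (xs ! j))"
proof -
  have "(right ^^ j) (enc_list f xs) = enc_list f (drop j xs)" for j
    by (induction j) (auto simp: drop_Suc tl_drop, metis enc_list.elims list.sel right.simps tl_drop)
  moreover have "drop j xs = xs ! j # drop (Suc j) xs" using assms(5) by (simp add: Cons_nth_drop_Suc)
  ultimately have "(right ^^ length (vlist (enc_nat j))) (enc_list f xs) = Node (f (xs ! j)) (enc_list f (drop (Suc j) xs))" by simp
  then show ?thesis using runs_left runs_drop[OF assms(1,2,3)] assms(4) by (metis length_vlist_enc_nat)
qed

lemma runs_lt:
  assumes "runs M env a u" "runs M env b w" "n = length env" "length (vlist u) = i" "length (vlist w) = j" "i \<le> M"
  shows "runs M env (HLt n a b) (enc_bool (i < j))"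
proof -
  let ?d = "(right ^^ length (vlist u)) w"
  have "runs M env (HDrop n a b) (enc_list (\<lambda>x. x) (vlist ?d))" using runs_drop[OF assms(1-3)] assms by simp
  then have "runs M env (HLt n a b) (enc_bool (vlist ?d \<noteq> []))" unfolding HLt_def by (rule runs_nonempty)
  moreover have "vlist ?d \<noteq> [] \<longleftrightarrow> i < j" using assms(4,5) by (auto simp: vlist_drop)
  ultimately show ?thesis by simp
qed

lemma runs_le:
  assumes "runs M env a u" "runs M env b w" "n = length env" "length (vlist u) = i" "length (vlist w) = j" "j \<le> M"
  shows "runs M env (HNot (HLt n b a)) (enc_bool (i \<le> j))"
  using runs_not[OF runs_lt[OF assms(2,1,3,5,4,6)]] by (simp add: not_less)

lemma runs_eq:
  assumes "runs M env a (enc_nat i)" "runs M env b (enc_nat j)" "n = length env" "i \<le> M" "j \<le> M"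
  shows "runs M env (HEq n a b) (enc_bool (i = j))"
proof -
  have "runs M env (HEq n a b) (enc_bool (\<not> (i < j \<or> j < i)))"
    unfolding HEq_def using assms by (intro runs_not runs_or runs_lt) auto
  moreover have "(\<not> (i < j \<or> j < i)) \<longleftrightarrow> i = j" by auto
  ultimately show ?thesis by simp
qed

definition hmem :: "hexpr \<Rightarrow> hexpr \<Rightarrow> hexpr" where
  "hmem a b = HCall (HEx 2 $1 (HEq 4 $0 $2)) [a, b]"

lemma runs_mem:
  assumes "runs M env a (enc_nat x)" "runs M env b (enc_nats xs)" "length xs \<le> M" "x \<le> M" "\<And>y. y \<in> set xs \<Longrightarrow> y \<le> M"
  shows "runs M env (hmem a b) (enc_bool (x \<in> set xs))"
proof -
  have "runs M env (hmem a b) (enc_bool (\<exists>y\<in>set xs. x = y))"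
    unfolding hmem_def using assms(3-)
    by (intro runs_call2[OF assms(1,2)] runs_ex runs_eq runs_var) auto
  then show ?thesis by simp
qed

text \<open>The accumulator is the descending list built so far, whose head determines the next
  number.\<close>

definition hrange :: "hexpr \<Rightarrow> hexpr" where
  "hrange a = HCall (HRev 1 (HFold $0 HLeaf
     (HIf $2 (HNode (HNode HLeaf (HLeft $2)) $2) (HNode HLeaf HLeaf)))) [a]"

lemma runs_range:
  assumes "runs M env a w" "length (vlist w) = m" "m \<le> M"
  shows "runs M env (hrange a) (enc_nats [0..<m])"
proof -
  define s :: "nat list \<Rightarrow> nat list" where "s = (\<lambda>l. case l of [] \<Rightarrow> [0] | x # _ \<Rightarrow> Suc x # l)"
  have it: "(s ^^ j) [] = rev [0..<j]" for j
  proof (induction j)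
    case (Suc j)
    have "s (rev [0..<j]) = rev [0..<Suc j]" by (cases j) (simp_all add: s_def)
    then show ?case using Suc by simp
  qed simp
  have "runs M [w] (HFold $0 HLeaf
     (HIf $2 (HNode (HNode HLeaf (HLeft $2)) $2) (HNode HLeaf HLeaf))) (enc_nats ((s ^^ m) []))"
  proof (rule runs_iter[OF _ assms(2,3)])
    fix j x
    let ?l = "(s ^^ j) []"
    have "s ?l = (if ?l = [] then [0] else Suc (hd ?l) # ?l)" by (simp add: s_def split: list.splits)
    then show "runs M ([w] @ [x, enc_nats ?l])
      (HIf $2 (HNode (HNode HLeaf (HLeft $2)) $2) (HNode HLeaf HLeaf)) (enc_nats (s ?l))"
      by (intro runs_if_list[where xs = ?l and f = enc_nat])
        (auto intro!: runs_var runs_node runs_leaf runs_hd simp: enc_nat_simps)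
  qed (auto intro: runs_var runs_leaf)
  then have "runs M [w] (HRev 1 (HFold $0 HLeaf
     (HIf $2 (HNode (HNode HLeaf (HLeft $2)) $2) (HNode HLeaf HLeaf)))) (enc_nats (rev (rev [0..<m])))"
    using assms(3) unfolding it by (intro runs_rev) auto
  then show ?thesis unfolding hrange_def using assms(1) by (intro runs_call1) simp_all
qed

section \<open>Programs for the search\<close>

definition hterm where
  "hterm a b = HCall (HLeft (HDrop 2 $1 (HLeft (HRight (HRight $0))))) [a, b]"
definition hisroot where
  "hisroot a b = HCall (HLeft (HDrop 2 $1 (HLeft (HRight $0)))) [a, b]"
definition harc where
  "harc a b c = HCall (HLeft (HDrop 3 $2 (HLeft (HDrop 3 $1 (HLeft $0))))) [a, b, c]"
definition hverts where
  "hverts a = hrange (HLeft (HRight a))"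
definition hroot where
  "hroot a = HCall (HLeft (HFilter 1 (hverts $0) (hisroot $0 $1))) [a]"
definition hnonterms where
  "hnonterms a = HCall (HFilter 1 (hverts $0) (HAnd (HNot (hterm $0 $1)) (HNot (hisroot $0 $1)))) [a]"
definition hstep where
  "hstep a b c = HCall (HFilter 3 (hverts $0) (HOr (harc $0 $1 $3)
     (HEx 5 $2 (HAnd (hterm $0 $5) (harc $0 $5 $3))))) [a, b, c]"
definition hsteps where
  "hsteps a b c = HCall (HFold (HNode HLeaf (hverts $0)) $2 (hstep $0 $1 $4)) [a, b, c]"
text \<open>Calling \<open>hsteps\<close> \<open>n + 1\<close> times yields
  \<open>(n + 1) * (n + 1)\<close> rounds without a list of that length.\<close>

definition hzr where
  "hzr a b c = HCall (hmem $2 (HFold (HNode HLeaf (hverts $0)) HLeaf (hsteps $0 $1 $4))) [a, b, c]"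
definition hsources where
  "hsources a = HCall (HFilter 1 (hverts $0) (HAnd (hterm $0 $1)
     (HAnd (HNot (hzr $0 (hroot $0) $1))
       (HAll 3 (HFilter 3 (hverts $0) (hterm $0 $3))
          (HOr (HNot (hzr $0 $3 $1)) (HAnd (hzr $0 $1 $3) (HNot (HLt 5 $3 $1)))))))) [a]"

definition hdouble where
  "hdouble b c = HCall (HIf $0 (HNode HLeaf (HAppend 2 $1 $1)) (HAppend 2 $1 $1)) [b, c]"
definition hcap where
  "hcap a b = HCall (HIf (HLt 2 $0 $1) $0 $1) [a, b]"
text \<open>Converts the budget from binary to unary, most significant digit first. The cap in each
  step keeps intermediate values below \<open>2 * n + 2\<close>; mapping the vertices to leaves
  gives the unary \<open>n\<close>.\<close>

definition hkmin where
  "hkmin a = HCall (HFold (HRev 1 (HRight (HRight (HRight $0)))) HLeaf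
     (hcap (hdouble $1 $2) (HMap 3 (hverts $0) HLeaf))) [a]"

definition hundom where
  "hundom a b = HCall (HFilter 2 (hsources $0) (HNot (HEx 4 $1 (hzr $0 $4 $2)))) [a, b]"
definition hhigh where
  "hhigh a b c d = HCall (HFilter 4 (hnonterms $0) (HAnd (HNot (hmem $4 $3))
     (HNot (HLt 6 (HFilter 6 (hundom $0 $2) (hzr $0 $4 $6)) $1)))) [a, b, c, d]"
definition hpreds where
  "hpreds a b c d e = HCall (HFilter 5 (hhigh $0 $1 $2 $3) (hzr $0 $5 $4)) [a, b, c, d, e]"
definition hchoices where
  "hchoices a b c d e = HCall (HFilter 5 (hundom $0 $3)
     (HAnd (HNonempty (hpreds $0 $1 $3 $4 $5))
       (HLt 7 (hpreds $0 $1 $3 $4 $5) $2))) [a, b, c, d, e]"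
definition hbranch where
  "hbranch a b c d e = HCall (HNode
     (HNode $2 (HAppend 5 (hpreds $0 $1 $2 $3 $4) $3))
     (HMap 5 (hpreds $0 $1 $2 $3 $4) (HNode (HNode $5 $2) $3))) [a, b, c, d, e]"
definition hexpand where
  "hexpand a b c d = HCall (HIf (hchoices $0 $1 $2 (HLeft $3) (HRight $3))
     (hbranch $0 $1 (HLeft $3) (HRight $3)
       (HLeft (hchoices $0 $1 $2 (HLeft $3) (HRight $3))))
     (HNode $3 HLeaf)) [a, b, c, d]"
definition hstates where
  "hstates a b c d = HCall (HFold $3 (HNode (HNode HLeaf HLeaf) HLeaf)
     (HConcatMap 6 $5 (hexpand $0 $1 $2 $6))) [a, b, c, d]"

definition hcovers where
  "hcovers a b c = HCall (HOr (HAnd (hterm $0 $2) (hzr $0 $1 $2)) (HEq 3 $1 $2)) [a, b, c]"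
definition hbase where
  "hbase a b c = HCall (HAnd (HNot (HRight (HRight $2)))
     (HAll 3 $1 (HIff (hmem $3 (HLeft (HRight $2))) (hcovers $0 (HLeft $2) $3)))) [a, b, c]"
definition hjoins where
  "hjoins a b c d e = HCall (HAnd (HEq 5 (HLeft $4) (HLeft $2))
     (HAnd (hmem (HLeft $3) (hnonterms $0))
     (HAnd (hzr $0 (HLeft $4) (HLeft $3))
     (HAnd (HEq 5 (HRight (HRight $4)) (HNode HLeaf (HAppend 5 (HRight (HRight $2)) (HRight (HRight $3)))))
       (HAll 5 $1 (HIff (hmem $5 (HLeft (HRight $4)))
          (HOr (hmem $5 (HLeft (HRight $2))) (hmem $5 (HLeft (HRight $3))))))))))
     [a, b, c, d, e]"
definition hsubs where
  "hsubs a = HCall (HFold (HRev 1 $0) (HNode HLeaf HLeaf) (HAppend 3 (HMap 3 $2 (HNode $1 $3)) $2)) [a]"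
definition huniv where
  "huniv a b c = HCall (HConcatMap 3 (HNode (hroot $0) (hnonterms $0))
     (HConcatMap 5 (hsubs $1) (HMap 7 (hrange (HNode HLeaf $2)) (HNode $3 (HNode $5 $7))))) [a, b, c]"
definition hinfer where
  "hinfer a b c d = HCall (HFilter 4 (huniv $0 $2 $1) (HOr (hbase $0 $2 $4)
     (HEx 6 $3 (HEx 8 $3 (hjoins $0 $2 $6 $8 $4))))) [a, b, c, d]"
definition hreach where
  "hreach a b c = HCall (HEx 3 (HFold (HNode HLeaf $1) HLeaf (hinfer $0 $1 $2 $4))
     (HAnd (HEq 5 (HLeft $3) (hroot $0)) (HAll 5 $2 (hmem $5 (HLeft (HRight $3)))))) [a, b, c]"
definition hrounds where
  "hrounds a b = HCall (HFold $1 HLeaf (HAppend 4 (HNode HLeaf $0) $3)) [a, b]"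
definition hsearch where
  "hsearch a b c d = HCall (HEx 4 (hstates $0 $1 $2 (hrounds $1 $3))
     (HAnd (HNot (HLt 6 (hrounds $1 $3) (HAppend 6 (HLeft $4) (hundom $0 (HLeft $4)))))
       (hreach $0 $3 (HAppend 6 (HLeft $4) (hundom $0 (HLeft $4)))))) [a, b, c, d]"

section \<open>Evaluation of the graph predicates on an encoded instance\<close>

definition enc_state :: "nat list \<times> nat list \<Rightarrow> val" where
  "enc_state st = Node (enc_nats (fst st)) (enc_nats (snd st))"
definition enc_fact :: "fact \<Rightarrow> val" where
  "enc_fact u = Node (enc_nat (fst u)) (Node (enc_nats (fst (snd u))) (enc_nat (snd (snd u))))"

lemma runs_state:
  "runs M env a (enc_state st) \<Longrightarrow> runs M env (HLeft a) (enc_nats (fst st))"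
  "runs M env a (enc_state st) \<Longrightarrow> runs M env (HRight a) (enc_nats (snd st))"
  by (auto simp: enc_state_def intro: runs_left runs_right)

lemma runs_fact:
  "runs M env a (enc_fact u) \<Longrightarrow> runs M env (HLeft a) (enc_nat (fst u))"
  "runs M env a (enc_fact u) \<Longrightarrow> runs M env (HLeft (HRight a)) (enc_nats (fst (snd u)))"
  "runs M env a (enc_fact u) \<Longrightarrow> runs M env (HRight (HRight a)) (enc_nat (snd (snd u)))"
  by (auto simp: enc_fact_def intro: runs_left runs_right)

lemma runs_plus:
  assumes "runs M env a (enc_nat i)" "runs M env b (enc_nat j)" "n = length env" "i \<le> M"
  shows "runs M env (HAppend n a b) (enc_nat (i + j))"
  using runs_append[OF assms(1)[unfolded enc_nat_def] assms(2)[unfolded enc_nat_def] assms(3)] assms(4)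
  by (simp add: enc_nat_def replicate_add)

lemma runs_Suc: "runs M env a (enc_nat i) \<Longrightarrow> runs M env (HNode HLeaf a) (enc_nat (Suc i))"
  by (auto simp: enc_nat_simps intro: runs_node runs_leaf)

lemma runs_subs:
  assumes "runs M env a (enc_nats Z)" "length Z \<le> M" "2 ^ length Z \<le> M"
  shows "runs M env (hsubs a) (enc_list enc_nats (subseqs Z))"
proof -
  let ?s = "\<lambda>z acc. map ((#) z) acc @ acc"
  have f: "foldr ?s zs [[]] = subseqs zs" for zs :: "nat list" by (induction zs) (auto simp: Let_def)
  have "runs M [enc_nats Z] (HFold (HRev 1 $0) (HNode HLeaf HLeaf) (HAppend 3 (HMap 3 $2 (HNode $1 $3)) $2))
    (enc_list enc_nats (foldr ?s Z [[]]))"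
  proof (rule runs_foldr[where f = enc_nat and g = "enc_list enc_nats"])
    fix ys x zs assume Z: "Z = ys @ x # zs"
    have "length (foldr ?s zs [[]]) = 2 ^ length zs" unfolding f by (rule length_subseqs)
    also have "\<dots> \<le> 2 ^ length Z" unfolding Z by (rule power_increasing) auto
    finally have len: "length (foldr ?s zs [[]]) \<le> M" using assms(3) by linarith
    show "runs M ([enc_nats Z] @ [enc_nat x, enc_list enc_nats (foldr ?s zs [[]])])
       (HAppend 3 (HMap 3 $2 (HNode $1 $3)) $2) (enc_list enc_nats (?s x (foldr ?s zs [[]])))"
      by (rule runs_append, rule runs_map[where f = enc_nats])
        (use len in \<open>auto intro!: runs_node runs_var\<close>)
  qed (use assms in \<open>auto intro!: runs_var runs_node runs_leaf\<close>)
  then show ?thesis unfolding hsubs_def f by (intro runs_call1[OF assms(1)])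
qed

text \<open>Capping after every digit agrees with capping once, because a value that has reached
  \<open>n\<close> stays at least \<open>n\<close> under further digits.\<close>

lemma binary_foldr: "foldr (\<lambda>b a. min n (2 * a + (if b then 1 else 0))) (binary k) 0 = min n k"
proof (induction k rule: binary.induct)
  case (1 m)
  show ?case
  proof (cases "m = 0")
    case True then show ?thesis by (simp add: binary.simps)
  next
    case False
    then have "binary m = odd m # binary (m div 2)" by (subst binary.simps) simp
    moreover have "2 * (m div 2) + (if odd m then 1 else 0) = m" by simp
    ultimately show ?thesis using 1[OF False] by (auto simp: min_def split: if_splits)
  qed
qed

text \<open>\<open>2 * n + 2\<close> leaves room for the doubled counter in \<open>hkmin\<close>,
  for the sum of two costs in \<open>hjoins\<close> and for loops of length
  \<open>n + 1\<close>.\<close>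

locale instance_run = terminal_digraph n A r T for n A r T +
  fixes k M :: nat and inp :: val
  assumes inp: "inp = Node (enc_list (enc_list enc_bool) (map (\<lambda>u. map (\<lambda>v. (u, v) \<in> A) [0..<n]) [0..<n]))
      (Node (enc_list enc_bool (map (\<lambda>v. v = r) [0..<n]))
      (Node (enc_list enc_bool (map (\<lambda>v. v \<in> T) [0..<n])) (enc_list enc_bool (binary k))))"
    and M: "2 * n + 2 \<le> M" "length (binary k) \<le> M"
begin

lemma runs_term:
  assumes "runs M env a inp" "runs M env b (enc_nat v)" "v < n"
  shows "runs M env (hterm a b) (enc_bool (v \<in> T))"
proof -
  let ?t = "map (\<lambda>v. v \<in> T) [0..<n]"
  have "runs M [inp, enc_nat v] (HLeft (HRight (HRight $0))) (enc_list enc_bool ?t)"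
    unfolding inp by (intro runs_left runs_right runs_var) auto
  then have "runs M [inp, enc_nat v] (HLeft (HDrop 2 $1 (HLeft (HRight (HRight $0))))) (enc_bool (?t ! v))"
    using assms(3) M by (intro runs_nth[where f = enc_bool] runs_var) auto
  then show ?thesis unfolding hterm_def using assms by (intro runs_call2[OF assms(1,2)]) simp
qed

lemma runs_isroot:
  assumes "runs M env a inp" "runs M env b (enc_nat v)" "v < n"
  shows "runs M env (hisroot a b) (enc_bool (v = r))"
proof -
  let ?t = "map (\<lambda>v. v = r) [0..<n]"
  have "runs M [inp, enc_nat v] (HLeft (HRight $0)) (enc_list enc_bool ?t)"
    unfolding inp by (intro runs_left runs_right runs_var) auto
  then have "runs M [inp, enc_nat v] (HLeft (HDrop 2 $1 (HLeft (HRight $0)))) (enc_bool (?t ! v))"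
    using assms(3) M by (intro runs_nth[where f = enc_bool] runs_var) auto
  then show ?thesis unfolding hisroot_def using assms by (intro runs_call2[OF assms(1,2)]) simp
qed

lemma runs_arc:
  assumes "runs M env a inp" "runs M env b (enc_nat u)" "runs M env c (enc_nat v)" "u < n" "v < n"
  shows "runs M env (harc a b c) (enc_bool ((u, v) \<in> A))"
proof -
  let ?m = "map (\<lambda>u. map (\<lambda>v. (u, v) \<in> A) [0..<n]) [0..<n]"
  let ?e = "[inp, enc_nat u, enc_nat v]"
  have "runs M ?e (HLeft $0) (enc_list (enc_list enc_bool) ?m)"
    unfolding inp by (intro runs_left runs_var) auto
  then have "runs M ?e (HLeft (HDrop 3 $1 (HLeft $0))) (enc_list enc_bool (?m ! u))"
    using assms(4) M by (intro runs_nth[where f = "enc_list enc_bool"] runs_var) auto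
  then have "runs M ?e (HLeft (HDrop 3 $2 (HLeft (HDrop 3 $1 (HLeft $0))))) (enc_bool (?m ! u ! v))"
    using assms(4,5) M by (intro runs_nth[where f = enc_bool] runs_var) auto
  then show ?thesis unfolding harc_def using assms by (intro runs_call3[OF assms(1,2,3)]) simp
qed

lemma runs_verts: "runs M env a inp \<Longrightarrow> runs M env (hverts a) (enc_nats [0..<n])"
  unfolding hverts_def
proof (rule runs_range)
  assume "runs M env a inp"
  then show "runs M env (HLeft (HRight a)) (enc_list enc_bool (map (\<lambda>v. v = r) [0..<n]))"
    unfolding inp by (intro runs_left runs_right)
qed (use M in auto)

lemma runs_root:
  assumes "runs M env a inp" shows "runs M env (hroot a) (enc_nat r)"
proof -
  have "filter (\<lambda>v. v = r) [0..<n] = [r]"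
  proof -
    have "filter (\<lambda>v. v = r) xs = (if r \<in> set xs then [r] else [])" if "distinct xs" for xs
      using that by (induction xs) auto
    then show ?thesis using root by simp
  qed
  moreover have "runs M [inp] (HFilter 1 (hverts $0) (hisroot $0 $1)) (enc_nats (filter (\<lambda>v. v = r) [0..<n]))"
    using M by (intro runs_filter runs_verts runs_isroot runs_var) auto
  ultimately have "runs M [inp] (HLeft (HFilter 1 (hverts $0) (hisroot $0 $1))) (enc_nat (hd [r]))"
    by (intro runs_hd) simp_all
  then show ?thesis unfolding hroot_def using assms by (intro runs_call1) simp_all
qed

lemma runs_nonterms:
  assumes "runs M env a inp" shows "runs M env (hnonterms a) (enc_nats (nonterminals T r n))"
  unfolding hnonterms_def nonterminals_def using M
  by (intro runs_call1[OF assms] runs_filter runs_verts runs_and runs_not runs_term runs_isroot runs_var) auto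

definition reach_step :: "nat \<Rightarrow> nat list \<Rightarrow> nat list" where
  "reach_step u cur = filter (\<lambda>v. (u, v) \<in> A \<or> (\<exists>t\<in>set cur. t \<in> T \<and> (t, v) \<in> A)) [0..<n]"

lemma runs_step:
  assumes "runs M env a inp" "runs M env b (enc_nat u)" "runs M env c (enc_nats cur)" "u < n" "set cur \<subseteq> {..<n}" "length cur \<le> n"
  shows "runs M env (hstep a b c) (enc_nats (reach_step u cur))"
  unfolding hstep_def reach_step_def using M assms(4-)
  by (intro runs_call3[OF assms(1-3)] runs_filter runs_verts runs_or runs_ex[where f = enc_nat] runs_and runs_arc runs_term runs_var) auto

lemma reach_step_bounds: "set (reach_step u cur) \<subseteq> {..<n}" "length (reach_step u cur) \<le> n"
  by (auto simp: reach_step_def intro: order_trans[OF length_filter_le])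

lemma reach_power_bounds:
  assumes "set cur \<subseteq> {..<n}" "length cur \<le> n"
  shows "set ((reach_step u ^^ j) cur) \<subseteq> {..<n}" "length ((reach_step u ^^ j) cur) \<le> n"
  using assms reach_step_bounds by (induction j) auto

lemma runs_steps:
  assumes "runs M env a inp" "runs M env b (enc_nat u)" "runs M env c (enc_nats cur)" "u < n" "set cur \<subseteq> {..<n}" "length cur \<le> n"
  shows "runs M env (hsteps a b c) (enc_nats ((reach_step u ^^ Suc n) cur))"
  unfolding hsteps_def
proof (rule runs_call3[OF assms(1-3)], rule runs_iter[where g = enc_nats])
  show "runs M [inp, enc_nat u, enc_nats cur] (HNode HLeaf (hverts $0)) (Node Leaf (enc_nats [0..<n]))"
    by (intro runs_node runs_leaf runs_verts runs_var) auto
  show "length (vlist (Node Leaf (enc_nats [0..<n]))) = Suc n" by simp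
  fix j x
  show "runs M ([inp, enc_nat u, enc_nats cur] @ [x, enc_nats ((reach_step u ^^ j) cur)])
     (hstep $0 $1 $4) (enc_nats (reach_step u ((reach_step u ^^ j) cur)))"
    using assms reach_power_bounds by (intro runs_step runs_var) auto
qed (use M in \<open>auto intro: runs_var\<close>)

lemma set_reach_power: "set ((reach_step u ^^ m) []) = {v. \<exists>i<m. (u, v) \<in> A O {(a, b) \<in> A. a \<in> T} ^^ i}"
proof -
  define R where "R = {(a, b) \<in> A. a \<in> T}"
  have "set ((reach_step u ^^ m) []) = {v. \<exists>i<m. (u, v) \<in> A O R ^^ i}"
  proof (induction m)
    case (Suc m)
    have e: "A O R ^^ Suc i = (A O R ^^ i) O R" for i by (simp add: O_assoc)
    have "set ((reach_step u ^^ Suc m) []) = {v. (u, v) \<in> A} \<union> {v. \<exists>t. t \<in> set ((reach_step u ^^ m) []) \<and> (t, v) \<in> R}"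
      using arcs by (auto simp: reach_step_def R_def)
    also have "\<dots> = {v. (u, v) \<in> A O R ^^ 0} \<union> {v. \<exists>i<m. (u, v) \<in> A O R ^^ Suc i}"
      unfolding Suc e by auto
    also have "\<dots> = {v. \<exists>i<Suc m. (u, v) \<in> A O R ^^ i}"
    proof (intro set_eqI iffI)
      fix v assume "v \<in> {v. \<exists>i<Suc m. (u, v) \<in> A O R ^^ i}"
      then obtain i where "i < Suc m" "(u, v) \<in> A O R ^^ i" by blast
      then show "v \<in> {v. (u, v) \<in> A O R ^^ 0} \<union> {v. \<exists>i<m. (u, v) \<in> A O R ^^ Suc i}" by (cases i) auto
    next
      fix v assume "v \<in> {v. (u, v) \<in> A O R ^^ 0} \<union> {v. \<exists>i<m. (u, v) \<in> A O R ^^ Suc i}"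
      then have "(u, v) \<in> A O R ^^ 0 \<or> (\<exists>i<m. (u, v) \<in> A O R ^^ Suc i)" by blast
      then show "v \<in> {v. \<exists>i<Suc m. (u, v) \<in> A O R ^^ i}"
      proof
        assume "(u, v) \<in> A O R ^^ 0"
        then show ?thesis by (intro CollectI exI[of _ 0] conjI) simp_all
      next
        assume "\<exists>i<m. (u, v) \<in> A O R ^^ Suc i"
        then obtain i where "i < m" "(u, v) \<in> A O R ^^ Suc i" by blast
        then show ?thesis by (intro CollectI exI[of _ "Suc i"] conjI) simp_all
      qed
    qed
    finally show ?case .
  qed simp
  then show ?thesis unfolding R_def .
qed

text \<open>A walk in a finite relation can be shortened to at most as many steps as the relation
  has pairs, here at most \<open>n * n\<close>.\<close>

lemma mem_reach_power: "v \<in> set ((reach_step u ^^ (Suc n * Suc n)) []) \<longleftrightarrow> zreach A T u v"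
proof -
  let ?R = "{(a, b) \<in> A. a \<in> T}"
  have sub: "?R \<subseteq> {..<n} \<times> {..<n}" using arcs by blast
  have finR: "finite ?R" using sub by (rule finite_subset) simp
  have "card ?R \<le> n * n" using card_mono[OF _ sub] by simp
  also have "\<dots> < Suc n * Suc n" by simp
  finally have c: "card ?R < Suc n * Suc n" .
  show ?thesis
  proof
    assume "v \<in> set ((reach_step u ^^ (Suc n * Suc n)) [])"
    then obtain i where "(u, v) \<in> A O ?R ^^ i" unfolding set_reach_power by blast
    then obtain w where "(u, w) \<in> A" "(w, v) \<in> ?R ^^ i" by blast
    then show "zreach A T u v" unfolding zreach_def by (blast intro: relpow_imp_rtrancl)
  next
    assume "zreach A T u v"
    then obtain w where w: "(u, w) \<in> A" "(w, v) \<in> ?R\<^sup>*" unfolding zreach_def by blast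
    then obtain i where "i \<le> card ?R" "(w, v) \<in> ?R ^^ i" unfolding rtrancl_finite_eq_relpow[OF finR] by blast
    then show "v \<in> set ((reach_step u ^^ (Suc n * Suc n)) [])" unfolding set_reach_power using w(1) c by (auto intro!: exI[of _ i])
  qed
qed

lemma runs_zr:
  assumes "runs M env a inp" "runs M env b (enc_nat u)" "runs M env c (enc_nat v)" "u < n" "v < n"
  shows "runs M env (hzr a b c) (enc_bool (zreach A T u v))"
proof -
  let ?e = "[inp, enc_nat u, enc_nat v]"
  have b0: "set [] \<subseteq> {..<n}" "length [] \<le> n" by auto
  have pw: "((reach_step u ^^ Suc n) ^^ j) [] = (reach_step u ^^ (Suc n * j)) []" for j by (simp only: funpow_mult)
  have "runs M ?e (HFold (HNode HLeaf (hverts $0)) HLeaf (hsteps $0 $1 $4))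
    (enc_nats (((reach_step u ^^ Suc n) ^^ Suc n) []))"
  proof (rule runs_iter[where g = enc_nats])
    show "runs M ?e (HNode HLeaf (hverts $0)) (Node Leaf (enc_nats [0..<n]))"
      by (intro runs_node runs_leaf runs_verts runs_var) auto
    show "length (vlist (Node Leaf (enc_nats [0..<n]))) = Suc n" by simp
    show "runs M ?e HLeaf (enc_nats [])" by (rule runs_nil)
    show "Suc n \<le> M" using M by simp
    fix j x
    show "runs M (?e @ [x, enc_nats (((reach_step u ^^ Suc n) ^^ j) [])]) (hsteps $0 $1 $4)
      (enc_nats ((reach_step u ^^ Suc n) (((reach_step u ^^ Suc n) ^^ j) [])))"
      unfolding pw using assms(4) reach_power_bounds[OF b0] by (intro runs_steps runs_var) (auto simp del: funpow.simps mult_Suc)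
  qed
  note reach = this
  have "runs M ?e (hmem $2 (HFold (HNode HLeaf (hverts $0)) HLeaf (hsteps $0 $1 $4)))
    (enc_bool (v \<in> set ((reach_step u ^^ (Suc n * Suc n)) [])))"
    unfolding pw
  proof (rule runs_mem)
    note bd = reach_power_bounds[OF b0, where u = u and j = "Suc n * Suc n"]
    show "runs M ?e (HFold (HNode HLeaf (hverts $0)) HLeaf (hsteps $0 $1 $4))
      (enc_nats ((reach_step u ^^ (Suc n * Suc n)) []))" using reach unfolding pw .
    show "length ((reach_step u ^^ (Suc n * Suc n)) []) \<le> M" using bd(2) M(1) by linarith
    show "y \<le> M" if "y \<in> set ((reach_step u ^^ (Suc n * Suc n)) [])" for y using subsetD[OF bd(1) that] M(1) by simp
  qed (use assms(5) M in \<open>auto intro: runs_var\<close>)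
  then show ?thesis unfolding hzr_def mem_reach_power by (intro runs_call3[OF assms(1-3)])
qed

lemma runs_sources:
  assumes "runs M env a inp" shows "runs M env (hsources a) (enc_nats (source_reps A T r n))"
proof -
  have T: "T = set (filter (\<lambda>t. t \<in> T) [0..<n])" using terminals by auto
  \<comment> \<open>The quantifier over \<open>T\<close> becomes one over a list, which a loop can
    enumerate.\<close>
  have eq: "source_reps A T r n = filter (\<lambda>b. b \<in> T \<and> \<not> zreach A T r b \<and>
     (\<forall>t\<in>set (filter (\<lambda>t. t \<in> T) [0..<n]). zreach A T t b \<longrightarrow> zreach A T b t \<and> b \<le> t)) [0..<n]"
    unfolding source_reps_def by (rule filter_cong[OF refl]) (subst T[symmetric], rule refl)
  show ?thesis unfolding hsources_def eq using M root
    by (intro runs_call1[OF assms] runs_filter runs_all[where f = enc_nat] runs_verts runs_and runs_not runs_imp runs_term runs_zr runs_root runs_le runs_var)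
      (auto intro: order_trans[OF length_filter_le])
qed

lemma runs_kmin:
  assumes "runs M env a inp" shows "runs M env (hkmin a) (enc_nat (min n k))"
proof -
  let ?s = "\<lambda>b a. min n (2 * a + (if b then 1 else 0))"
  have "runs M [inp] (HFold (HRev 1 (HRight (HRight (HRight $0)))) HLeaf
     (hcap (hdouble $1 $2) (HMap 3 (hverts $0) HLeaf))) (enc_nat (foldr ?s (binary k) 0))"
  proof (rule runs_foldr[where f = enc_bool])
    show "runs M [inp] (HRight (HRight (HRight $0))) (enc_list enc_bool (binary k))"
      unfolding inp by (intro runs_right runs_var) auto
    show "runs M [inp] HLeaf (enc_nat 0)" by (simp add: enc_nat_simps runs_leaf)
    fix ys b zs assume "binary k = ys @ b # zs"
    define m where "m = foldr ?s zs 0"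
    have m: "m \<le> n" unfolding m_def by (cases zs) auto
    let ?e = "[inp] @ [enc_bool b, enc_nat m]"
    let ?m = "2 * m + (if b then 1 else 0)"
    have d: "runs M ?e (hdouble $1 $2) (enc_nat ?m)"
      unfolding hdouble_def
    proof (rule runs_call2)
      show "runs M ?e $1 (enc_bool b)" "runs M ?e $2 (enc_nat m)" by (auto intro: runs_var)
      have "runs M [enc_bool b, enc_nat m] (HAppend 2 $1 $1) (enc_nat (m + m))"
        using m M by (intro runs_plus runs_var) auto
      then show "runs M [enc_bool b, enc_nat m] (HIf $0 (HNode HLeaf (HAppend 2 $1 $1)) (HAppend 2 $1 $1)) (enc_nat ?m)"
        by (intro runs_if[where P = b] runs_var) (auto dest: runs_Suc simp: mult_2)
    qed
    have "runs M ?e (HMap 3 (hverts $0) HLeaf) (enc_list (\<lambda>_. Leaf) (map (\<lambda>_. ()) [0..<n]))"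
      using M by (intro runs_map[where f = enc_nat] runs_verts runs_var runs_leaf) auto
    then have n: "runs M ?e (HMap 3 (hverts $0) HLeaf) (enc_nat n)" by (simp add: enc_nat_def map_replicate_const)
    show "runs M ?e (hcap (hdouble $1 $2) (HMap 3 (hverts $0) HLeaf)) (enc_nat (?s b m))"
      unfolding hcap_def
    proof (rule runs_call2[OF d n], rule runs_if[where P = "?m < n"])
      show "runs M [enc_nat ?m, enc_nat n] (HLt 2 $0 $1) (enc_bool (?m < n))"
        using m M by (intro runs_lt runs_var) auto
    qed (auto intro!: runs_var simp: min_def)
  qed (use M in auto)
  then show ?thesis unfolding hkmin_def binary_foldr by (intro runs_call1[OF assms])
qed

end

section \<open>Evaluation of the search; definitions by patterns are first restated with
  projections, as programs access components\<close>

lemma expand_alt: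
  "expand R Ns Bs c h st = (let ch = choices R Ns Bs c h (fst st) (snd st) in if ch = [] then [st]
     else (let P = preds R Ns Bs c (fst st) (snd st) (hd ch) in
       (fst st, P @ snd st) # map (\<lambda>v. (v # fst st, snd st)) P))"
  by (cases st) (auto simp: expand_def Let_def split: list.splits)

lemma joins_alt:
  "joins R Ns Z a b u \<longleftrightarrow> fst u = fst a \<and> fst b \<in> set Ns \<and> R (fst u) (fst b) \<and> snd (snd u) = Suc (snd (snd a) + snd (snd b))
     \<and> (\<forall>z\<in>set Z. z \<in> set (fst (snd u)) \<longleftrightarrow> z \<in> set (fst (snd a)) \<or> z \<in> set (fst (snd b)))"
  by (cases a; cases b; cases u) (simp add: joins_def)

lemma base_fact_alt:
  "base_fact R T Z u \<longleftrightarrow> snd (snd u) = 0 \<and> (\<forall>z\<in>set Z. z \<in> set (fst (snd u)) \<longleftrightarrow> covers R T (fst u) z)"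
  by (cases u) (simp add: base_fact_def)

lemma length_universe: "length (universe vs Z k) = length vs * 2 ^ length Z * Suc k"
  by (simp add: universe_def length_concat o_def sum_list_triv length_subseqs algebra_simps del: upt_Suc)

lemma subseqs_bounds: "X \<in> set (subseqs Z) \<Longrightarrow> length X \<le> length Z \<and> set X \<subseteq> set Z"
  by (induction Z arbitrary: X) (auto simp: Let_def, fastforce+)

lemma runs_le_length:
  assumes "runs M env a (enc_nat i)" "runs M env b (enc_nats xs)" "n = length env" "length xs \<le> M"
  shows "runs M env (HNot (HLt n b a)) (enc_bool (i \<le> length xs))"
  by (rule runs_le[OF assms(1,2,3)]) (simp_all add: assms(4))

lemma runs_length_lt:
  assumes "runs M env a (enc_nats xs)" "runs M env b (enc_nat j)" "n = length env" "length xs \<le> M"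
  shows "runs M env (HLt n a b) (enc_bool (length xs < j))"
  by (rule runs_lt[OF assms(1,2,3)]) (simp_all add: assms(4))

text \<open>\<open>K\<close> is the capped budget. The assumptions \<open>branches\<close>,
  \<open>excluded\<close> and \<open>facts\<close> limit the number of search states, the length of
  the exclusion lists and the size of the fact universe.\<close>

locale search_run = instance_run n A r T k M inp for n A r T k M inp +
  fixes c h K :: nat
  assumes K: "K \<le> n" and cM: "Suc c \<le> M" and rounds: "Suc c * K \<le> M" and branches: "Suc h \<le> M" "Suc h ^ (Suc c * K) \<le> M"
    and excluded: "Suc c * K * h \<le> M" and facts: "Suc n * 2 ^ (Suc c * K) * Suc K \<le> M"
begin

abbreviation "undom' \<equiv> undom Z Bs"
abbreviation "high' \<equiv> high Z Ns Bs c"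
abbreviation "preds' \<equiv> preds Z Ns Bs c"
abbreviation "choices' \<equiv> choices Z Ns Bs c h"
abbreviation "expand' \<equiv> expand Z Ns Bs c h"
abbreviation "states' \<equiv> states Z Ns Bs c h"

lemma Bs_bounds: "set Bs \<subseteq> {..<n}" "length Bs \<le> n"
  by (auto simp: source_reps_def intro: order_trans[OF length_filter_le])

lemma Ns_bounds: "set Ns \<subseteq> {..<n}" "length Ns \<le> n"
  by (auto simp: nonterminals_def intro: order_trans[OF length_filter_le])

lemma undom_bounds: "set (undom' Y) \<subseteq> {..<n}" "length (undom' Y) \<le> n"
proof -
  show "set (undom' Y) \<subseteq> {..<n}" using Bs_bounds(1) by (auto simp: undom_def)
  show "length (undom' Y) \<le> n" using length_filter_le Bs_bounds(2) unfolding undom_def by (rule order_trans)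
qed

lemma high_bounds: "set (high' Y X) \<subseteq> {..<n}" "length (high' Y X) \<le> n"
proof -
  show "set (high' Y X) \<subseteq> {..<n}" using Ns_bounds(1) by (auto simp: high_def)
  show "length (high' Y X) \<le> n" using length_filter_le Ns_bounds(2) unfolding high_def by (rule order_trans)
qed

lemma preds_bounds: "set (preds' Y X b) \<subseteq> {..<n}" "length (preds' Y X b) \<le> n"
proof -
  show "set (preds' Y X b) \<subseteq> {..<n}" using high_bounds(1) by (auto simp: preds_def)
  show "length (preds' Y X b) \<le> n" using length_filter_le high_bounds(2) unfolding preds_def by (rule order_trans)
qed

lemma nM: "n \<le> M" "x < n \<Longrightarrow> x \<le> M" using M by auto

lemma runs_undom:
  assumes "runs M env a inp" "runs M env b (enc_nats Y)" "set Y \<subseteq> {..<n}" "length Y \<le> M"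
  shows "runs M env (hundom a b) (enc_nats (undom' Y))"
  unfolding hundom_def undom_def using Bs_bounds nM assms(3,4)
  by (intro runs_call2[OF assms(1,2)] runs_filter runs_sources runs_not runs_ex[where f = enc_nat] runs_zr runs_var) auto

lemma runs_high:
  assumes "runs M env a inp" "runs M env b (enc_nat c)" "runs M env d (enc_nats Y)" "runs M env e (enc_nats X)"
    "set Y \<subseteq> {..<n}" "length Y \<le> M" "set X \<subseteq> {..<n}" "length X \<le> M"
  shows "runs M env (hhigh a b d e) (enc_nats (high' Y X))"
proof -
  have "length (filter P (undom' Y)) \<le> M" for P
    using length_filter_le undom_bounds(2) nM(1) by (meson order_trans)
  then show ?thesis
    unfolding hhigh_def high_def using Ns_bounds undom_bounds[of Y] nM assms(5-)
    by (intro runs_call4[OF assms(1-4)] runs_filter runs_nonterms runs_and runs_not[OF runs_mem] runs_le_length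
        runs_undom runs_zr runs_var) auto
qed

lemma runs_preds:
  assumes "runs M env a inp" "runs M env b (enc_nat c)" "runs M env d (enc_nats Y)" "runs M env e (enc_nats X)"
    "runs M env f (enc_nat v)" "set Y \<subseteq> {..<n}" "length Y \<le> M" "set X \<subseteq> {..<n}" "length X \<le> M" "v < n"
  shows "runs M env (hpreds a b d e f) (enc_nats (preds' Y X v))"
  unfolding hpreds_def preds_def using high_bounds[of Y X] nM assms(6-)
  by (intro runs_call5[OF assms(1-5)] runs_filter runs_high runs_zr runs_var) (auto intro: order_trans)

lemma runs_choices:
  assumes "runs M env a inp" "runs M env b (enc_nat c)" "runs M env d (enc_nat h)" "runs M env e (enc_nats Y)"
    "runs M env f (enc_nats X)" "set Y \<subseteq> {..<n}" "length Y \<le> M" "set X \<subseteq> {..<n}" "length X \<le> M"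
  shows "runs M env (hchoices a b d e f) (enc_nats (choices' Y X))"
proof -
  have "length (preds' Y X v) \<le> M" for v using preds_bounds(2) nM(1) by (meson order_trans)
  then show ?thesis
    unfolding hchoices_def choices_def using undom_bounds[of Y] nM assms(6-)
    by (intro runs_call5[OF assms(1-5)] runs_filter runs_undom runs_and runs_nonempty[where f = enc_nat] runs_length_lt runs_preds runs_var)
      (auto intro: order_trans)
qed

lemma runs_branch:
  assumes "runs M env a inp" "runs M env b (enc_nat c)" "runs M env d (enc_nats Y)" "runs M env e (enc_nats X)"
    "runs M env f (enc_nat v)" "set Y \<subseteq> {..<n}" "length Y \<le> M" "set X \<subseteq> {..<n}" "length X \<le> M" "v < n"
  shows "runs M env (hbranch a b d e f) (enc_list enc_state ((Y, preds' Y X v @ X) # map (\<lambda>w. (w # Y, X)) (preds' Y X v)))"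
proof -
  let ?P = "preds' Y X v" and ?e = "[inp, enc_nat c, enc_nats Y, enc_nats X, enc_nat v]"
  have len: "length ?P \<le> M" using preds_bounds(2) nM(1) by (meson order_trans)
  have P: "runs M ?e (hpreds $0 $1 $2 $3 $4) (enc_nats ?P)"
    using assms(6-) by (intro runs_preds runs_var) auto
  have "runs M ?e (HAppend 5 (hpreds $0 $1 $2 $3 $4) $3) (enc_nats (?P @ X))"
    using len by (intro runs_append[OF P] runs_var) auto
  then have 1: "runs M ?e (HNode $2 (HAppend 5 (hpreds $0 $1 $2 $3 $4) $3)) (enc_state (Y, ?P @ X))"
    unfolding enc_state_def by (intro runs_node runs_var) auto
  have 2: "runs M ?e (HMap 5 (hpreds $0 $1 $2 $3 $4) (HNode (HNode $5 $2) $3))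
      (enc_list enc_state (map (\<lambda>w. (w # Y, X)) ?P))"
    using len by (intro runs_map[OF P]) (auto simp: enc_state_def intro!: runs_node runs_var)
  show ?thesis unfolding hbranch_def by (rule runs_call5[OF assms(1-5) runs_cons[OF 1 2]])
qed

lemma runs_expand:
  assumes "runs M env a inp" "runs M env b (enc_nat c)" "runs M env d (enc_nat h)" "runs M env e (enc_state st)"
    "set (fst st) \<subseteq> {..<n}" "length (fst st) \<le> M" "set (snd st) \<subseteq> {..<n}" "length (snd st) \<le> M"
  shows "runs M env (hexpand a b d e) (enc_list enc_state (expand' st))"
proof -
  let ?e = "[inp, enc_nat c, enc_nat h, enc_state st]" and ?ch = "choices' (fst st) (snd st)"
  have st: "runs M ?e (HLeft $3) (enc_nats (fst st))" "runs M ?e (HRight $3) (enc_nats (snd st))"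
    by (auto intro!: runs_state runs_var)
  have ch: "runs M ?e (hchoices $0 $1 $2 (HLeft $3) (HRight $3)) (enc_nats ?ch)"
    using assms(5-) by (intro runs_choices st runs_var) auto
  have hd: "hd ?ch < n" if "?ch \<noteq> []"
  proof -
    have "set ?ch \<subseteq> set (undom' (fst st))" by (auto simp: choices_def)
    then show ?thesis using hd_in_set[OF that] undom_bounds(1) by blast
  qed
  show ?thesis
    unfolding hexpand_def expand_alt Let_def
  proof (rule runs_call4[OF assms(1-4)], rule runs_if_list[OF ch])
    assume ne: "?ch \<noteq> []"
    show "runs M ?e (hbranch $0 $1 (HLeft $3) (HRight $3)
       (HLeft (hchoices $0 $1 $2 (HLeft $3) (HRight $3))))
     (enc_list enc_state (if ?ch = [] then [st] else (fst st, preds' (fst st) (snd st) (hd ?ch) @ snd st)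
         # map (\<lambda>v. (v # fst st, snd st)) (preds' (fst st) (snd st) (hd ?ch))))"
      unfolding if_not_P[OF ne] using assms(5-) hd[OF ne]
      by (intro runs_branch st runs_hd[OF ch ne] runs_var) auto
  next
    assume em: "?ch = []"
    show "runs M ?e (HNode $3 HLeaf)
     (enc_list enc_state (if ?ch = [] then [st] else (fst st, preds' (fst st) (snd st) (hd ?ch) @ snd st)
         # map (\<lambda>v. (v # fst st, snd st)) (preds' (fst st) (snd st) (hd ?ch))))"
      unfolding if_P[OF em] by (intro runs_cons runs_nil runs_var) auto
  qed
qed

text \<open>A round adds either one chosen vertex or fewer than \<open>h\<close> excluded ones, if
  it changes the state at all.\<close>

definition state_ok :: "nat \<Rightarrow> nat list \<times> nat list \<Rightarrow> bool" where
  "state_ok m st \<longleftrightarrow> set (fst st) \<subseteq> {..<n} \<and> length (fst st) \<le> m \<and> set (snd st) \<subseteq> {..<n} \<and> length (snd st) \<le> m * h"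

lemma expand_ok:
  assumes "state_ok m st"
  shows "length (expand' st) \<le> Suc h" "\<And>st'. st' \<in> set (expand' st) \<Longrightarrow> state_ok (Suc m) st'"
proof -
  let ?ch = "choices' (fst st) (snd st)"
  let ?P = "preds' (fst st) (snd st) (hd ?ch)"
  have P: "length ?P < h" if "?ch \<noteq> []" using hd_in_set[OF that] by (auto simp: choices_def)
  show "length (expand' st) \<le> Suc h" using P by (auto simp: expand_alt Let_def)
  show "state_ok (Suc m) st'" if st': "st' \<in> set (expand' st)" for st'
  proof (cases "?ch = []")
    case True
    then show ?thesis using st' assms by (auto simp: expand_alt state_ok_def)
  next
    case False
    then have "st' = (fst st, ?P @ snd st) \<or> (\<exists>v\<in>set ?P. st' = (v # fst st, snd st))"
      using st' by (auto simp: expand_alt Let_def)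
    moreover have "set ?P \<subseteq> {..<n}" by (rule preds_bounds(1))
    ultimately show ?thesis using P[OF False] assms by (auto simp: state_ok_def)
  qed
qed

lemma states_Suc: "states' (Suc m) = concat (map (expand') (states' m))"
  by (simp add: states_def)

lemma states_ok: "st \<in> set (states' m) \<Longrightarrow> state_ok m st"
proof (induction m arbitrary: st)
  case 0 then show ?case by (simp add: states_def state_ok_def)
next
  case (Suc m)
  then obtain st0 where "st0 \<in> set (states' m)" "st \<in> set (expand' st0)" by (auto simp: states_Suc)
  then show ?case using Suc.IH expand_ok(2) by blast
qed

lemma length_states: "length (states' m) \<le> Suc h ^ m"
proof (induction m)
  case 0 then show ?case by (simp add: states_def)
next
  case (Suc m)
  have "length (states' (Suc m)) = sum_list (map (\<lambda>st. length (expand' st)) (states' m))"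
    by (simp add: states_Suc length_concat o_def)
  also have "\<dots> \<le> sum_list (map (\<lambda>st. Suc h) (states' m))"
    using states_ok expand_ok(1) by (intro sum_list_mono) blast
  also have "\<dots> = Suc h * length (states' m)" by (simp add: sum_list_triv)
  also have "\<dots> \<le> Suc h * Suc h ^ m" using Suc by (rule mult_le_mono2)
  finally show ?case by simp
qed

lemma state_bounds:
  assumes "st \<in> set (states' m)" "m \<le> Suc c * K"
  shows "set (fst st) \<subseteq> {..<n}" "length (fst st) \<le> M" "set (snd st) \<subseteq> {..<n}" "length (snd st) \<le> M"
proof -
  have ok: "state_ok m st" using assms(1) by (rule states_ok)
  then show "set (fst st) \<subseteq> {..<n}" "set (snd st) \<subseteq> {..<n}" by (auto simp: state_ok_def)
  show "length (fst st) \<le> M" using ok assms(2) rounds unfolding state_ok_def by linarith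
  have "m * h \<le> Suc c * K * h" using assms(2) by (rule mult_le_mono1)
  then show "length (snd st) \<le> M" using ok excluded unfolding state_ok_def by linarith
qed

lemma states_bound: "m \<le> Suc c * K \<Longrightarrow> length (states' m) \<le> M"
proof -
  assume "m \<le> Suc c * K"
  then have "Suc h ^ m \<le> Suc h ^ (Suc c * K)" by (intro power_increasing) auto
  then show ?thesis using length_states[of m] branches(2) by linarith
qed

lemma runs_states:
  assumes "runs M env a inp" "runs M env b (enc_nat c)" "runs M env d (enc_nat h)" "runs M env e (enc_nat (Suc c * K))"
  shows "runs M env (hstates a b d e) (enc_list enc_state (states' (Suc c * K)))"
  unfolding hstates_def
proof (rule runs_call4[OF assms(1-4)], subst states_def, rule runs_iter[where g = "enc_list enc_state"])
  let ?e = "[inp, enc_nat c, enc_nat h, enc_nat (Suc c * K)]"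
  let ?s = "\<lambda>ss. concat (map (expand') ss)"
  show "runs M ?e $3 (enc_nat (Suc c * K))" by (rule runs_var) simp_all
  show "length (vlist (enc_nat (Suc c * K))) = Suc c * K" by (rule length_vlist_enc_nat)
  show "Suc c * K \<le> M" by (rule rounds)
  show "runs M ?e (HNode (HNode HLeaf HLeaf) HLeaf) (enc_list enc_state [([], [])])"
    by (auto simp: enc_state_def intro!: runs_node runs_leaf)
  fix j x assume j: "j < Suc c * K"
  have eq: "(?s ^^ j) [([], [])] = states' j" by (simp add: states_def)
  have lt: "j \<le> Suc c * K" using j by simp
  show "runs M (?e @ [x, enc_list enc_state ((?s ^^ j) [([], [])])]) (HConcatMap 6 $5 (hexpand $0 $1 $2 $6))
    (enc_list enc_state (?s ((?s ^^ j) [([], [])])))"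
    unfolding eq
  proof (rule runs_concat_map[where f = enc_state])
    show "runs M (?e @ [x, enc_list enc_state (states' j)]) $5 (enc_list enc_state (states' j))"
      by (rule runs_var) simp_all
    show "length (states' j) \<le> M" using lt by (rule states_bound)
    fix st assume st: "st \<in> set (states' j)"
    show "length (expand' st) \<le> M" using expand_ok(1)[OF states_ok[OF st]] branches(1) by linarith
    show "runs M ((?e @ [x, enc_list enc_state (states' j)]) @ [enc_state st, acc]) (hexpand $0 $1 $2 $6)
      (enc_list enc_state (expand' st))" for acc
      using state_bounds[OF st lt] by (intro runs_expand runs_var) auto
  qed simp
qed

lemma runs_covers:
  assumes "runs M env a inp" "runs M env b (enc_nat v)" "runs M env d (enc_nat z)" "v < n" "z < n"
  shows "runs M env (hcovers a b d) (enc_bool (covers Z T v z))"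
  unfolding hcovers_def covers_def using assms(4-) nM
  by (intro runs_call3[OF assms(1-3)] runs_or runs_and runs_term runs_zr runs_eq runs_var) auto

definition fact_ok :: "fact \<Rightarrow> bool" where
  "fact_ok u \<longleftrightarrow> fst u < n \<and> set (fst (snd u)) \<subseteq> {..<n} \<and> length (fst (snd u)) \<le> M \<and> snd (snd u) \<le> n"

lemma runs_base:
  assumes "runs M env a inp" "runs M env b (enc_nats Y)" "runs M env d (enc_fact u)"
    "set Y \<subseteq> {..<n}" "length Y \<le> M" "fact_ok u"
  shows "runs M env (hbase a b d) (enc_bool (base_fact Z T Y u))"
  unfolding hbase_def base_fact_alt using assms(4-) nM
  by (intro runs_call3[OF assms(1-3)] runs_and runs_is_zero runs_all[where f = enc_nat] runs_iff runs_mem runs_covers runs_fact runs_var)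
    (auto simp: fact_ok_def)

lemma runs_joins:
  assumes "runs M env a inp" "runs M env b (enc_nats Y)" "runs M env d (enc_fact u1)" "runs M env e (enc_fact u2)" "runs M env f (enc_fact u)"
    "set Y \<subseteq> {..<n}" "length Y \<le> M" "fact_ok u1" "fact_ok u2" "fact_ok u"
  shows "runs M env (hjoins a b d e f) (enc_bool (joins Z Ns Y u1 u2 u))"
  unfolding hjoins_def joins_alt using assms(6-) nM M Ns_bounds
  by (intro runs_call5[OF assms(1-5)] runs_and runs_eq runs_Suc runs_plus runs_all[where f = enc_nat] runs_iff runs_or runs_mem runs_nonterms runs_zr runs_fact runs_var)
    (auto simp: fact_ok_def)

context
  fixes Y :: "nat list"
  assumes Y: "set Y \<subseteq> {..<n}" "length Y \<le> Suc c * K"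
begin

abbreviation "infer' \<equiv> infer Z T Ns r K Y"

lemma YM: "length Y \<le> M" using Y(2) rounds by linarith

lemma card_universe: "length (universe (r # Ns) Y K) \<le> M" "2 ^ length Y \<le> M" "2 ^ length Y * Suc K \<le> M"
proof -
  have p: "(2::nat) ^ length Y \<le> 2 ^ (Suc c * K)" using Y(2) by (intro power_increasing) auto
  have "length (universe (r # Ns) Y K) = length (r # Ns) * 2 ^ length Y * Suc K" by (rule length_universe)
  also have "\<dots> \<le> Suc n * 2 ^ (Suc c * K) * Suc K" using p Ns_bounds(2) by (intro mult_le_mono) auto
  finally show "length (universe (r # Ns) Y K) \<le> M" using facts by linarith
  have "1 * 2 ^ length Y * Suc K \<le> Suc n * 2 ^ (Suc c * K) * Suc K" using p by (intro mult_le_mono) auto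
  then show *: "2 ^ length Y * Suc K \<le> M" using facts by simp
  have "2 ^ length Y * 1 \<le> 2 ^ length Y * Suc K" by (rule mult_le_mono2) simp
  then show "2 ^ length Y \<le> M" using * by simp
qed

lemma universe_ok: "u \<in> set (universe (r # Ns) Y K) \<Longrightarrow> fact_ok u"
proof -
  assume u: "u \<in> set (universe (r # Ns) Y K)"
  obtain v X j where eq: "u = (v, X, j)" using prod_cases3 by blast
  have "v \<in> set (r # Ns)" "X \<in> set (subseqs Y)" "j \<le> K" using u unfolding eq universe_iff by auto
  then show ?thesis using subseqs_bounds[of X Y] Y YM Ns_bounds(1) root K by (auto simp: fact_ok_def eq)
qed

lemma runs_univ:
  assumes "runs M env a inp" "runs M env b (enc_nats Y)" "runs M env d (enc_nat K)"
  shows "runs M env (huniv a b d) (enc_list enc_fact (universe (r # Ns) Y K))"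
  unfolding huniv_def universe_def
proof (rule runs_call3[OF assms(1-3)], rule runs_concat_map[where f = enc_nat])
  let ?e = "[inp, enc_nats Y, enc_nat K]"
  show "runs M ?e (HNode (hroot $0) (hnonterms $0)) (enc_nats (r # Ns))"
    by (intro runs_cons runs_root runs_nonterms runs_var) auto
  show "3 = length ?e" by simp
  show "length (r # Ns) \<le> M" using Ns_bounds(2) M by simp
  fix v :: nat
  have cS: "length (concat (map (\<lambda>X. map (\<lambda>j. (v, X, j)) [0..<Suc K]) (subseqs Y))) = 2 ^ length Y * Suc K"
    by (simp add: length_concat o_def sum_list_triv length_subseqs algebra_simps del: upt_Suc)
  then show "length (concat (map (\<lambda>X. map (\<lambda>j. (v, X, j)) [0..<Suc K]) (subseqs Y))) \<le> M"
    using card_universe(3) by simp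
  fix acc
  show "runs M (?e @ [enc_nat v, acc]) (HConcatMap 5 (hsubs $1) (HMap 7 (hrange (HNode HLeaf $2)) (HNode $3 (HNode $5 $7))))
    (enc_list enc_fact (concat (map (\<lambda>X. map (\<lambda>j. (v, X, j)) [0..<Suc K]) (subseqs Y))))"
  proof (rule runs_concat_map[where f = enc_nats])
    show "runs M (?e @ [enc_nat v, acc]) (hsubs $1) (enc_list enc_nats (subseqs Y))"
      using YM card_universe(2) by (intro runs_subs runs_var) auto
    show "length (subseqs Y) \<le> M" using card_universe(2) by (simp add: length_subseqs)
    fix X :: "nat list" and acc'
    show "length (map (\<lambda>j. (v, X, j)) [0..<Suc K]) \<le> M" using K M by simp
    let ?e2 = "(?e @ [enc_nat v, acc]) @ [enc_nats X, acc']"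
    have rg: "runs M ?e2 (hrange (HNode HLeaf $2)) (enc_nats [0..<Suc K])"
    proof (rule runs_range)
      show "runs M ?e2 (HNode HLeaf $2) (enc_nat (Suc K))" by (intro runs_Suc runs_var) auto
    qed (use K M in auto)
    show "runs M ?e2 (HMap 7 (hrange (HNode HLeaf $2)) (HNode $3 (HNode $5 $7)))
      (enc_list enc_fact (map (\<lambda>j. (v, X, j)) [0..<Suc K]))"
      using K M by (intro runs_map[OF rg]) (auto simp: enc_fact_def intro!: runs_node runs_var simp del: upt_Suc)
  qed simp
qed

lemma runs_infer:
  assumes "runs M env a inp" "runs M env b (enc_nat K)" "runs M env d (enc_nats Y)" "runs M env e (enc_list enc_fact L)"
    "length L \<le> M" "\<And>u. u \<in> set L \<Longrightarrow> fact_ok u"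
  shows "runs M env (hinfer a b d e) (enc_list enc_fact (infer' L))"
  unfolding hinfer_def infer_def using assms(5,6) Y(1) YM card_universe(1) universe_ok
  by (intro runs_call4[OF assms(1-4)] runs_filter runs_univ runs_or runs_ex[where f = enc_fact] runs_base runs_joins runs_var) auto

lemma infer_ok: "u \<in> set (infer' L) \<Longrightarrow> fact_ok u" "length (infer' L) \<le> M"
proof -
  show "u \<in> set (infer' L) \<Longrightarrow> fact_ok u" using universe_ok by (auto simp: infer_def)
  show "length (infer' L) \<le> M" unfolding infer_def using length_filter_le card_universe(1) by (rule order_trans)
qed

lemma infer_power_ok: "u \<in> set ((infer' ^^ j) []) \<Longrightarrow> fact_ok u" "length ((infer' ^^ j) []) \<le> M"
  using infer_ok by (cases j; auto)+

lemma runs_reach: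
  assumes "runs M env a inp" "runs M env b (enc_nat K)" "runs M env d (enc_nats Y)"
  shows "runs M env (hreach a b d) (enc_bool (reaches_all Z T Ns r K Y))"
proof -
  let ?e = "[inp, enc_nat K, enc_nats Y]"
  have L: "runs M ?e (HFold (HNode HLeaf $1) HLeaf (hinfer $0 $1 $2 $4))
    (enc_list enc_fact ((infer' ^^ Suc K) []))"
  proof (rule runs_iter[where g = "enc_list enc_fact"])
    show "runs M ?e (HNode HLeaf $1) (enc_nat (Suc K))" by (intro runs_Suc runs_var) auto
    show "length (vlist (enc_nat (Suc K))) = Suc K" by (rule length_vlist_enc_nat)
    show "Suc K \<le> M" using K M by simp
    show "runs M ?e HLeaf (enc_list enc_fact [])" by (rule runs_nil)
    fix j x
    show "runs M (?e @ [x, enc_list enc_fact ((infer' ^^ j) [])]) (hinfer $0 $1 $2 $4)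
      (enc_list enc_fact (infer' ((infer' ^^ j) [])))"
      using infer_power_ok by (intro runs_infer runs_var) auto
  qed
  show ?thesis unfolding hreach_def reaches_all_def
  proof (rule runs_call3[OF assms], rule runs_ex[OF L])
    show "length ((infer' ^^ Suc K) []) \<le> M" by (rule infer_power_ok(2))
    fix u acc assume "u \<in> set ((infer' ^^ Suc K) [])"
    then have "fact_ok u" by (rule infer_power_ok(1))
    then show "runs M (?e @ [enc_fact u, acc]) (HAnd (HEq 5 (HLeft $3) (hroot $0)) (HAll 5 $2 (hmem $5 (HLeft (HRight $3)))))
      (enc_bool (fst u = r \<and> (\<forall>z\<in>set Y. z \<in> set (fst (snd u)))))"
      using YM Y(1) root nM by (intro runs_and runs_eq runs_root runs_all[where f = enc_nat] runs_mem runs_fact runs_var) (auto simp: fact_ok_def)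
  qed simp
qed

end

lemma runs_rounds:
  assumes "runs M env a (enc_nat c)" "runs M env b (enc_nat K)"
  shows "runs M env (hrounds a b) (enc_nat (Suc c * K))"
proof -
  have p: "((\<lambda>x. Suc c + x) ^^ j) 0 = Suc c * j" for j by (induction j) auto
  have "runs M [enc_nat c, enc_nat K] (HFold $1 HLeaf (HAppend 4 (HNode HLeaf $0) $3)) (enc_nat (((\<lambda>x. Suc c + x) ^^ K) 0))"
  proof (rule runs_iter[where g = enc_nat])
    show "runs M [enc_nat c, enc_nat K] $1 (enc_nat K)" by (rule runs_var) simp_all
    show "length (vlist (enc_nat K)) = K" by (rule length_vlist_enc_nat)
    show "K \<le> M" using K nM by simp
    show "runs M [enc_nat c, enc_nat K] HLeaf (enc_nat 0)" by (simp add: enc_nat_simps runs_leaf)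
    fix j x
    show "runs M ([enc_nat c, enc_nat K] @ [x, enc_nat (((\<lambda>x. Suc c + x) ^^ j) 0)]) (HAppend 4 (HNode HLeaf $0) $3)
       (enc_nat (Suc c + ((\<lambda>x. Suc c + x) ^^ j) 0))"
      using cM by (intro runs_plus runs_Suc runs_var) auto
  qed
  then show ?thesis unfolding hrounds_def p by (intro runs_call2[OF assms])
qed

text \<open>The conjunction is lazy: \<open>hreach\<close> runs only on states that pass the length
  test, and this test is the premise under which its loops stay within \<open>M\<close>.\<close>

lemma runs_search:
  assumes "runs M env a inp" "runs M env b (enc_nat c)" "runs M env d (enc_nat h)" "runs M env e (enc_nat K)"
  shows "runs M env (hsearch a b d e) (enc_bool (search Z T Ns Bs r c h K))"
proof -
  let ?e = "[inp, enc_nat c, enc_nat h, enc_nat K]"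
  let ?Z = "\<lambda>st. fst st @ undom' (fst st)"
  have eq: "search Z T Ns Bs r c h K \<longleftrightarrow> (\<exists>st\<in>set (states' (Suc c * K)). length (?Z st) \<le> Suc c * K \<and> reaches_all Z T Ns r K (?Z st))"
    unfolding search_def by (rule bex_cong[OF refl]) (simp add: split_beta)
  have rd: "runs M ?e (hrounds $1 $3) (enc_nat (Suc c * K))" by (intro runs_rounds runs_var) auto
  have "runs M ?e (hstates $0 $1 $2 (hrounds $1 $3)) (enc_list enc_state (states' (Suc c * K)))"
    by (intro runs_states rd runs_var) auto
  then show ?thesis unfolding hsearch_def eq
  proof (rule runs_call4[OF assms runs_ex])
    show "length (states' (Suc c * K)) \<le> M" by (rule states_bound) simp
    fix st acc assume st: "st \<in> set (states' (Suc c * K))"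
    note sb = state_bounds[OF st order_refl]
    let ?f = "?e @ [enc_state st, acc]"
    have Y: "runs M ?f (HLeft $4) (enc_nats (fst st))" by (intro runs_state runs_var) auto
    have Z: "runs M ?f (HAppend 6 (HLeft $4) (hundom $0 (HLeft $4))) (enc_nats (?Z st))"
      using sb by (intro runs_append runs_undom Y runs_var) auto
    have "runs M ?f (hrounds $1 $3) (enc_nat (Suc c * K))" by (intro runs_rounds runs_var) auto
    then show "runs M ?f (HAnd (HNot (HLt 6 (hrounds $1 $3) (HAppend 6 (HLeft $4) (hundom $0 (HLeft $4)))))
       (hreach $0 $3 (HAppend 6 (HLeft $4) (hundom $0 (HLeft $4)))))
       (enc_bool (length (?Z st) \<le> Suc c * K \<and> reaches_all Z T Ns r K (?Z st)))"
    proof (intro runs_and runs_le[OF Z])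
      show "length (vlist (enc_nat (Suc c * K))) = Suc c * K" by (rule length_vlist_enc_nat)
      show "Suc c * K \<le> M" by (rule rounds)
      assume "length (?Z st) \<le> Suc c * K"
      then show "runs M ?f (hreach $0 $3 (HAppend 6 (HLeft $4) (hundom $0 (HLeft $4))))
         (enc_bool (reaches_all Z T Ns r K (?Z st)))"
        using sb(1) undom_bounds(1) by (intro runs_reach Z runs_var) auto
    qed simp_all
  qed simp
qed

end

section \<open>Running time\<close>

fun elit :: "nat \<Rightarrow> expr" where
  "elit 0 = ELeaf"
| "elit (Suc m) = ENode ELeaf (elit m)"

lemma eval_elit: "eval P env (elit m) (enc_nat m) (2 * m + 1)"
proof (induction m)
  case 0 show ?case using eval_leaf[of P env] by (simp add: enc_nat_simps)
next
  case (Suc m)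
  have "eval P env (ENode ELeaf (elit m)) (Node Leaf (enc_nat m)) (1 + (2 * m + 1) + 1)"
    by (rule eval_node[OF eval_leaf Suc])
  then show ?case by (simp add: enc_nat_simps)
qed

definition hbig :: hexpr where
  "hbig = hsearch $0 $1 $2 (hkmin $0)"
definition hsmall :: hexpr where
  "hsmall = HNot (HNonempty (hsources $0))"

text \<open>Budget \<open>0\<close> is treated separately, since then not even the constants depending on \<open>h\<close> may enter
  the running time.\<close>

definition main_expr :: "nat \<Rightarrow> nat \<Rightarrow> nat \<Rightarrow> expr \<Rightarrow> expr" where
  "main_expr i c h e = EIf (ERight (ERight (ERight (EVar 0)))) (ECall i [EVar 0, elit c, elit h]) e"

text \<open>One factor pays for one unit of budget: the power covers search states as well as target
  subsets, the rest covers exclusion lists and the constants themselves.\<close>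

definition growth :: "nat \<Rightarrow> nat" where
  "growth h = Suc (high_deg h) * Suc h * (2 * Suc h) ^ Suc (high_deg h)"

text \<open>\<open>s\<close> is the input size. The quadratic factor covers the product of
  \<open>n + 1\<close> and \<open>K + 1\<close> in the number of facts.\<close>

definition loop_bound :: "nat \<Rightarrow> nat \<Rightarrow> nat \<Rightarrow> nat" where
  "loop_bound h k s = growth h ^ k * (2 * (s + 1)\<^sup>2)"

lemma growth_ge: "Suc (high_deg h) * Suc h \<le> growth h" "Suc h ^ Suc (high_deg h) \<le> growth h"
  "2 ^ Suc (high_deg h) \<le> growth h" "1 \<le> growth h"
proof -
  have 1: "(1::nat) \<le> (2 * Suc h) ^ Suc (high_deg h)" by (rule one_le_power) simp
  show *: "Suc (high_deg h) * Suc h \<le> growth h" unfolding growth_def using mult_le_mono2[OF 1] by (metis mult.right_neutral)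
  have "Suc h ^ Suc (high_deg h) \<le> (2 * Suc h) ^ Suc (high_deg h)" "2 ^ Suc (high_deg h) \<le> (2 * Suc h) ^ Suc (high_deg h)"
    by (intro power_mono; simp)+
  moreover have "(2 * Suc h) ^ Suc (high_deg h) \<le> growth h" unfolding growth_def
    using mult_le_mono1[of 1 "Suc (high_deg h) * Suc h" "(2 * Suc h) ^ Suc (high_deg h)"] by simp
  ultimately show "Suc h ^ Suc (high_deg h) \<le> growth h" "2 ^ Suc (high_deg h) \<le> growth h" by linarith+
  have "1 \<le> Suc (high_deg h) * Suc h" by simp
  then show "1 \<le> growth h" using * by linarith
qed

lemma length_le_size_enc_list: "length xs \<le> size (enc_list f xs)"
  by (induction xs) auto

lemma size_enc_dst: "n \<le> size (enc_dst n D r T k)" "length (binary k) \<le> size (enc_dst n D r T k)"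
proof -
  have "n \<le> size (enc_list enc_bool (map (\<lambda>v. v = r) [0..<n]))"
    using length_le_size_enc_list[of "map (\<lambda>v. v = r) [0..<n]" enc_bool] by simp
  then show "n \<le> size (enc_dst n D r T k)" by (simp add: enc_dst_def)
  show "length (binary k) \<le> size (enc_dst n D r T k)"
    using length_le_size_enc_list[of "binary k" enc_bool] by (simp add: enc_dst_def)
qed

lemma loop_bound_ge:
  assumes "x \<le> growth h ^ k" "y \<le> 2 * (s + 1)\<^sup>2"
  shows "x * y \<le> loop_bound h k s"
  unfolding loop_bound_def by (rule mult_le_mono[OF assms])

lemma square_ge: "2 * s + 2 \<le> 2 * (s + 1)\<^sup>2" for s :: nat
  by (simp add: power2_eq_square)

lemma instance_run_dst:
  assumes d: "dst_instance n D r T"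
  shows "instance_run n (parcs D) r T k (loop_bound h k (size (enc_dst n D r T k))) (enc_dst n D r T k)"
proof -
  interpret terminal_digraph n "parcs D" r T using d by (rule terminal_digraph_instance)
  let ?s = "size (enc_dst n D r T k)"
  have "1 * (2 * ?s + 2) \<le> loop_bound h k ?s" by (rule loop_bound_ge[OF one_le_power[OF growth_ge(4)] square_ge])
  then show ?thesis using size_enc_dst[where n = n and D = D and r = r and T = T and k = k]
    by unfold_locales (simp_all add: enc_dst_def)
qed

lemma search_run_dst:
  assumes d: "dst_instance n D r T" and k: "k > 0"
  shows "search_run n (parcs D) r T k (loop_bound h k (size (enc_dst n D r T k))) (enc_dst n D r T k) (high_deg h) h (min n k)"
proof -
  let ?s = "size (enc_dst n D r T k)" and ?c = "high_deg h" and ?K = "min n k" and ?G = "growth h"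
  let ?M = "loop_bound h k ?s"
  interpret instance_run n "parcs D" r T k ?M "enc_dst n D r T k" using d by (rule instance_run_dst)
  have ns: "n \<le> ?s" by (rule size_enc_dst(1))
  \<comment> \<open>Here \<open>k > 0\<close> is essential: one factor \<open>?G\<close> absorbs the
    constants that do not scale with the budget.\<close>
  have G1: "?G \<le> ?G ^ k" using growth_ge(4)[of h] k by (simp add: self_le_power)
  have GK: "?G ^ ?K \<le> ?G ^ k" using growth_ge(4)[of h] by (intro power_increasing) auto
  have sq: "1 \<le> 2 * (?s + 1)\<^sup>2" "?s + 1 \<le> 2 * (?s + 1)\<^sup>2" "(?s + 1) * (?s + 1) \<le> 2 * (?s + 1)\<^sup>2"
    by (simp_all add: power2_eq_square)
  have pw: "x ^ (Suc ?c * ?K) \<le> ?G ^ k" if "x ^ Suc ?c \<le> ?G" for x :: nat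
  proof -
    have "x ^ (Suc ?c * ?K) = (x ^ Suc ?c) ^ ?K" by (rule power_mult)
    also have "\<dots> \<le> ?G ^ ?K" using that by (rule power_mono) simp
    finally show ?thesis using GK by linarith
  qed
  have ch: "Suc ?c * Suc h \<le> ?G ^ k" using growth_ge(1)[of h] G1 by linarith
  have cG: "Suc ?c \<le> ?G ^ k" "Suc h \<le> ?G ^ k" using ch by (auto intro: order_trans[rotated])
  have Ks: "?K \<le> 2 * (?s + 1)\<^sup>2" using ns sq(2) by linarith
  show ?thesis
  proof
    show "?K \<le> n" by simp
    show "Suc ?c \<le> ?M" using loop_bound_ge[OF cG(1) sq(1)] by simp
    show "Suc ?c * ?K \<le> ?M" by (rule loop_bound_ge[OF cG(1) Ks])
    show "Suc h \<le> ?M" using loop_bound_ge[OF cG(2) sq(1)] by simp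
    show "Suc h ^ (Suc ?c * ?K) \<le> ?M" using loop_bound_ge[OF pw[OF growth_ge(2)] sq(1)] by simp
    have "Suc ?c * ?K * h \<le> Suc ?c * ?K * Suc h" by (rule mult_le_mono2) simp
    also have "\<dots> = (Suc ?c * Suc h) * ?K" by (simp only: mult.assoc mult.commute[of ?K])
    also have "\<dots> \<le> ?M" by (rule loop_bound_ge[OF ch Ks])
    finally show "Suc ?c * ?K * h \<le> ?M" .
    have "Suc n * Suc ?K \<le> (?s + 1) * (?s + 1)" using ns by (intro mult_le_mono) auto
    then have "Suc n * Suc ?K \<le> 2 * (?s + 1)\<^sup>2" using sq(3) by linarith
    then have "2 ^ (Suc ?c * ?K) * (Suc n * Suc ?K) \<le> ?M" by (rule loop_bound_ge[OF pw[OF growth_ge(3)]])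
    then show "Suc n * 2 ^ (Suc ?c * ?K) * Suc ?K \<le> ?M" by (simp only: mult.commute mult.left_commute mult.assoc)
  qed
qed

lemma runs_hbig:
  assumes d: "dst_instance n D r T" and ex: "excludes_topological_clique h D" and k: "k > 0"
  shows "runs (loop_bound h k (size (enc_dst n D r T k))) [enc_dst n D r T k, enc_nat (high_deg h), enc_nat h] hbig
    (enc_bool (dst_solvable D r T k))"
proof -
  let ?M = "loop_bound h k (size (enc_dst n D r T k))"
  interpret search_run n "parcs D" r T k ?M "enc_dst n D r T k" "high_deg h" h "min n k" using d k by (rule search_run_dst)
  have "runs ?M [enc_dst n D r T k, enc_nat (high_deg h), enc_nat h] hbig (enc_bool (search Z T Ns Bs r (high_deg h) h (min n k)))"
    unfolding hbig_def by (intro runs_search runs_kmin runs_var) auto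
  moreover have "search Z T Ns Bs r (high_deg h) h (min n k) \<longleftrightarrow> dst_solvable D r T k"
    using solve_correct[OF d ex, of "min n k"] dst_solvable_min[OF d, of k] by (simp add: solve_def min.commute)
  ultimately show ?thesis by simp
qed

lemma runs_hsmall:
  assumes d: "dst_instance n D r T"
  shows "runs (loop_bound h 0 (size (enc_dst n D r T 0))) [enc_dst n D r T 0] hsmall (enc_bool (dst_solvable D r T 0))"
proof -
  let ?M = "loop_bound h 0 (size (enc_dst n D r T 0))"
  interpret instance_run n "parcs D" r T 0 ?M "enc_dst n D r T 0" using d by (rule instance_run_dst)
  have "runs ?M [enc_dst n D r T 0] hsmall (enc_bool (\<not> (Bs \<noteq> [])))"
    unfolding hsmall_def by (intro runs_not runs_nonempty[where f = enc_nat] runs_sources runs_var) auto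
  then show ?thesis using dst_solvable_0[OF d] by simp
qed

text \<open>Both loop expressions, and with them \<open>K\<close> and \<open>d\<close>, are fixed
  before \<open>h\<close>; the programs for different \<open>h\<close> differ only in two
  literals.\<close>

theorem theorem3:
  shows "\<exists>(f :: nat \<Rightarrow> nat) (p :: nat poly). \<forall>h. \<exists>P :: program. \<forall>n D r T k.
           dst_instance n D r T \<longrightarrow> excludes_topological_clique h D \<longrightarrow>
           (\<exists>t. computes_in P (enc_dst n D r T k) (enc_bool (dst_solvable D r T k)) t \<and>
                t \<le> f h ^ k * poly p (size (enc_dst n D r T k)))"
proof -
  \<comment> \<open>Position \<open>0\<close> is reserved for the entry point, so the first part is
    compiled for a prefix of length \<open>1\<close>; its body \<open>e1\<close> takes one more
    place before the auxiliary code of the second part.\<close>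
  obtain e1 fs1 where e1: "compiled 1 3 hbig e1 fs1" using compiled_exists by blast
  obtain e2 fs2 where e2: "compiled (2 + length fs1) 1 hsmall e2 fs2" using compiled_exists by blast
  \<comment> \<open>The summand with \<open>13\<close> pays for testing the budget and for building
    the two literals, whose values are below \<open>M\<close> when \<open>k > 0\<close>.\<close>
  have "polybounded (\<lambda>M. bnd hbig 3 M + bnd hsmall 1 M + 13 * (M + 1))"
    by (intro polybounded_add polybounded_mult polybounded_bnd polybounded_Suc polybounded_const)
  then obtain K d where Kd: "\<And>M. bnd hbig 3 M + bnd hsmall 1 M + 13 * (M + 1) \<le> K * (M + 1) ^ d"
    by (auto simp: polybounded_def)
  \<comment> \<open>The cost has degree \<open>d\<close> in \<open>M\<close>, so the base of the
    exponential is raised to that power.\<close>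
  define f where "f h = growth h ^ d" for h
  define p :: "nat poly" where "p = [:K:] * ([:3:] * [:1, 1:] ^ 2) ^ d"
  have p: "poly p s = K * (3 * (s + 1)\<^sup>2) ^ d" for s
    by (simp add: p_def power2_eq_square algebra_simps)
  have time: "K * (loop_bound h k s + 1) ^ d \<le> f h ^ k * poly p s" for h k s
  proof -
    have "1 \<le> growth h ^ k * (s + 1)\<^sup>2" using growth_ge(4)[of h] by simp
    moreover have "growth h ^ k * (3 * (s + 1)\<^sup>2) = growth h ^ k * (2 * (s + 1)\<^sup>2) + growth h ^ k * (s + 1)\<^sup>2" by simp
    ultimately have "loop_bound h k s + 1 \<le> growth h ^ k * (3 * (s + 1)\<^sup>2)" unfolding loop_bound_def by linarith
    then have "(loop_bound h k s + 1) ^ d \<le> (growth h ^ k * (3 * (s + 1)\<^sup>2)) ^ d" by (rule power_mono) simp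
    also have "\<dots> = f h ^ k * (3 * (s + 1)\<^sup>2) ^ d"
      by (simp only: power_mult_distrib f_def power_mult[symmetric] mult.commute)
    finally have "K * (loop_bound h k s + 1) ^ d \<le> K * (f h ^ k * (3 * (s + 1)\<^sup>2) ^ d)" by (rule mult_le_mono2)
    then show ?thesis by (simp only: p mult.left_commute)
  qed
  have "\<exists>P. \<forall>n D r T k. dst_instance n D r T \<longrightarrow> excludes_topological_clique h D \<longrightarrow>
           (\<exists>t. computes_in P (enc_dst n D r T k) (enc_bool (dst_solvable D r T k)) t \<and>
                t \<le> f h ^ k * poly p (size (enc_dst n D r T k)))" for h
  proof -
    let ?c = "high_deg h" and ?i = "1 + length fs1"
    define main where "main = main_expr ?i ?c h e2"
    define P where "P = [main] @ fs1 @ [e1] @ fs2"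
    have P0: "P ! 0 = main" "P \<noteq> []" by (simp_all add: P_def)
    have Pi: "?i < length P" "P ! ?i = e1" by (simp_all add: P_def nth_append)
    show ?thesis
    proof (rule exI[of _ P], intro allI impI)
      fix n D r T k
      assume dst: "dst_instance n D r T" and ex: "excludes_topological_clique h D"
      let ?x = "enc_dst n D r T k" and ?b = "enc_bool (dst_solvable D r T k)"
      let ?M = "loop_bound h k (size ?x)"
      have bits: "eval P [?x] (ERight (ERight (ERight (EVar 0)))) (enc_list enc_bool (binary k)) (1 + 1 + 1 + 1)"
      proof -
        have "eval P [?x] (EVar 0) ?x 1" using eval_var[of 0 "[?x]" P] by simp
        from eval_right[OF eval_right[OF eval_right[OF this]]] show ?thesis by (simp add: enc_dst_def)
      qed
      have "\<exists>t\<le>bnd hbig 3 ?M + bnd hsmall 1 ?M + 13 * (?M + 1). eval P [?x] main ?b t"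
      proof (cases "k = 0")
        case True
        then have "enc_list enc_bool (binary k) = Leaf" by (simp add: binary.simps)
        note b0 = bits[unfolded this]
        have "fits ?M [?x] hsmall" "sem [?x] hsmall = ?b" using runs_hsmall[OF dst, of h] True by (auto simp: runs_def)
        then obtain t where t: "t \<le> bnd hsmall 1 ?M" "eval (([main] @ fs1 @ [e1]) @ fs2 @ []) [?x] e2 ?b t"
          using compiledD[OF e2, of "[main] @ fs1 @ [e1]" "[?x]" ?M "[]"] by auto
        have "eval P [?x] e2 ?b t" using t(2) by (simp add: P_def)
        then have "eval P [?x] main ?b (1 + 1 + 1 + 1 + t + 1)"
          unfolding main_def main_expr_def by (rule eval_if_leaf[OF b0])
        then show ?thesis using t(1) by (intro exI[of _ "1 + 1 + 1 + 1 + t + 1"]) simp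
      next
        case False
        then have "binary k = odd k # binary (k div 2)" by (subst binary.simps) simp
        then have "enc_list enc_bool (binary k) = Node (enc_bool (odd k)) (enc_list enc_bool (binary (k div 2)))" by simp
        note b0 = bits[unfolded this]
        let ?env = "[?x, enc_nat ?c, enc_nat h]"
        have "fits ?M ?env hbig" "sem ?env hbig = ?b" using runs_hbig[OF dst ex] False by (auto simp: runs_def)
        then obtain t where t: "t \<le> bnd hbig 3 ?M" "eval ([main] @ fs1 @ ([e1] @ fs2)) ?env e1 ?b t"
          using compiledD[OF e1, of "[main]" ?env ?M "[e1] @ fs2"] by auto
        have t': "eval P ?env (P ! ?i) ?b t" using t(2) unfolding Pi(2) by (simp add: P_def)
        have "eval P [?x] (EVar 0) ?x 1" using eval_var[of 0 "[?x]" P] by simp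
        then have "evals P [?x] [EVar 0, elit ?c, elit h] ?env (1 + ((2 * ?c + 1) + ((2 * h + 1) + 0)))"
          by (intro evals_Cons eval_elit evals_Nil)
        from eval_call[OF Pi(1) this t'] have
          "eval P [?x] main ?b (1 + 1 + 1 + 1 + (1 + ((2 * ?c + 1) + ((2 * h + 1) + 0)) + t + 1) + 1)"
          unfolding main_def main_expr_def by (rule eval_if_node[OF b0])
        moreover interpret search_run n "parcs D" r T k ?M ?x ?c h "min n k" using dst False by (intro search_run_dst) simp_all
        have "1 + 1 + 1 + 1 + (1 + ((2 * ?c + 1) + ((2 * h + 1) + 0)) + t + 1) + 1 \<le> bnd hbig 3 ?M + bnd hsmall 1 ?M + 13 * (?M + 1)"
          using t(1) cM branches(1) by simp
        ultimately show ?thesis by blast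
      qed
      then obtain t where "t \<le> bnd hbig 3 ?M + bnd hsmall 1 ?M + 13 * (?M + 1)" "eval P [?x] main ?b t" by blast
      moreover note Kd[of ?M] time[of h k "size ?x"]
      ultimately show "\<exists>t. computes_in P ?x ?b t \<and> t \<le> f h ^ k * poly p (size ?x)"
        unfolding computes_in_def P0(1) using P0(2) by (meson order_trans)
    qed
  qed
  then show ?thesis by blast
qed

end
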